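(* Let $\mathfrak{g}=\mathfrak{sl}(2,\mathbb{C})$, let $L(\Lambda_0)$ and $L(\Lambda_1)$ be the level $1$ standard $\widehat{\mathfrak{g}}$-modules with highest weight vectors $v_{\Lambda_0}$, $v_{\Lambda_1}$, and let $f_{\Lambda_i}: U(\bar{\mathfrak{n}}_-)\to W(\Lambda_i)$ ($i=0,1$) and $f_{\Lambda_1}': U(\bar{\mathfrak{n}}_{\le -2})\to W(\Lambda_1)$ be the maps $a\mapsto a\cdot v_{\Lambda_i}$ and $a\mapsto a\cdot v_{\Lambda_1}$, respectively. Then $$\operatorname{Ker} f_{\Lambda_0}=I_{\Lambda_0},\qquad\text{and also}\qquad \operatorname{Ker} f_{\Lambda_1}'=I_{\Lambda_1}',$$ or equivalently (for the latter equality) $$\operatorname{Ker} f_{\Lambda_1}=I_{\Lambda_1}.$$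
   Context: Let $\mathfrak{g}=\mathfrak{sl}(2,\mathbb{C})=\mathbb{C}x_{-\alpha}\oplus\mathbb{C}h\oplus\mathbb{C}x_\alpha$ with $[h,x_{\pm\alpha}]=\pm2x_{\pm\alpha}$, $[x_\alpha,x_{-\alpha}]=h$, and $\langle a,b\rangle=\operatorname{tr}(ab)$. The affine Lie algebra is $\widehat{\mathfrak{g}}=\mathfrak{g}\otimes\mathbb{C}[t,t^{-1}]\oplus\mathbb{C}\mathbf{k}$ with $\mathbf{k}$ central and $[a\otimes t^m,b\otimes t^n]=[a,b]\otimes t^{m+n}+m\langle a,b\rangle\delta_{m+n,0}\mathbf{k}$. Write $a(m)$ for $a\otimes t^m$ (as an element of the enveloping algebra or as an operator on a module). For $i=0,1$, $L(\Lambda_i)$ is the irreducible highest weight (standard) $\widehat{\mathfrak{g}}$-module of highest weight $\Lambda_i$, where $\Lambda_i(\mathbf{k})=1$, $\Lambda_i(h)=\delta_{i,1}$, with respect to the triangular decomposition whose positive part is $\mathbb{C}x_\alpha\oplus\mathfrak{g}\otimes t\mathbb{C}[t]$; $v_{\Lambda_i}$ is a highest weight vector. Put $\mathfrak{n}=\mathbb{C}x_\alpha$, $\bar{\mathfrak{n}}=\mathfrak{n}\otimes\mathbb{C}[t,t^{-1}]$, $\bar{\mathfrak{n}}_-=\mathfrak{n}\otimes t^{-1}\mathbb{C}[t^{-1}]$, $\bar{\mathfrak{n}}_{\le-2}=\mathfrak{n}\otimes t^{-2}\mathbb{C}[t^{-1}]$. These are abelian, so $U(\bar{\mathfrak{n}}_-)=\mathbb{C}[x_\alpha(-1),x_\alpha(-2),\dots]$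 and $U(\bar{\mathfrak{n}}_{\le-2})=\mathbb{C}[x_\alpha(-2),x_\alpha(-3),\dots]$ are polynomial algebras. The principal subspace of $L(\Lambda_i)$ is $W(\Lambda_i)=U(\bar{\mathfrak{n}})\cdot v_{\Lambda_i}=U(\bar{\mathfrak{n}}_-)\cdot v_{\Lambda_i}$; one also has $W(\Lambda_1)=U(\bar{\mathfrak{n}}_{\le-2})\cdot v_{\Lambda_1}$. Define $$R_t^0=\sum_{m_1,m_2\le-1,\ m_1+m_2=-t}x_\alpha(m_1)x_\alpha(m_2)\in U(\bar{\mathfrak{n}}_-)\ (t\ge2),$$ $$R_t^1=\sum_{m_1,m_2\le-2,\ m_1+m_2=-t}x_\alpha(m_1)x_\alpha(m_2)\in U(\bar{\mathfrak{n}}_{\le-2})\ (t\ge4),$$ (sums over ordered pairs of integers), and the ideals $$I_{\Lambda_0}=\sum_{t\ge2}U(\bar{\mathfrak{n}}_-)R_t^0,\qquad I_{\Lambda_1}=\sum_{t\ge2}U(\bar{\mathfrak{n}}_-)R_t^0+U(\bar{\mathfrak{n}}_-)x_\alpha(-1),\qquad I_{\Lambda_1}'=\sum_{t\ge4}U(\bar{\mathfrak{n}}_{\le-2})R_t^1,$$ the first two in $U(\bar{\mathfrak{n}}_-)$, the third in $U(\bar{\mathfrak{n}}_{\le-2})$. *)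

theory Defs
  imports "HOL-Analysis.Analysis" "HOL-Library.Poly_Mapping"
begin

typedef sl2 = "{A :: complex^2^2. trace A = 0}"
  morphisms mat_of_sl2 Abs_sl2
  by (intro exI[of _ 0]) (simp add: trace_def)

setup_lifting type_definition_sl2

instantiation sl2 :: ab_group_add
begin

lift_definition zero_sl2 :: sl2 is 0 by (simp add: trace_def)
lift_definition plus_sl2 :: "sl2 \<Rightarrow> sl2 \<Rightarrow> sl2" is "(+)" by (simp add: trace_add)
lift_definition minus_sl2 :: "sl2 \<Rightarrow> sl2 \<Rightarrow> sl2" is "(-)" by (simp add: trace_sub)
lift_definition uminus_sl2 :: "sl2 \<Rightarrow> sl2" is uminus
  subgoal for A using trace_sub[of 0 A] by (simp add: trace_def)
  done

instance by standard (transfer; simp)+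

end

lift_definition sl2_scale :: "complex \<Rightarrow> sl2 \<Rightarrow> sl2" is "\<lambda>c A. \<chi> i j. c * A $ i $ j"
  by (simp add: trace_def sum_2) (metis distrib_left mult_zero_right)

lift_definition sl2_bracket :: "sl2 \<Rightarrow> sl2 \<Rightarrow> sl2" is "\<lambda>A B. A ** B - B ** A"
  by (metis trace_sub trace_mul_sym diff_self)

definition sl2_form :: "sl2 \<Rightarrow> sl2 \<Rightarrow> complex" where
  "sl2_form a b = trace (mat_of_sl2 a ** mat_of_sl2 b)"

lift_definition x_pos :: sl2 is "vector [vector [0, 1], vector [0, 0]]"
  by (simp add: trace_def sum_2)

lift_definition x_neg :: sl2 is "vector [vector [0, 0], vector [1, 0]]"
  by (simp add: trace_def sum_2)

lift_definition h_cartan :: sl2 is "vector [vector [1, 0], vector [0, -1]]"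
  by (simp add: trace_def sum_2)

lemma sl2_brackets:
  "sl2_bracket h_cartan x_pos = sl2_scale 2 x_pos"
  "sl2_bracket h_cartan x_neg = sl2_scale (-2) x_neg"
  "sl2_bracket x_pos x_neg = h_cartan"
  by (transfer; simp add: vec_eq_iff matrix_matrix_mult_def forall_2 sum_2)+

lemma sl2_bracket_self: "sl2_bracket a a = 0"
  by transfer simp

lemma sl2_bracket_zero [simp]: "sl2_bracket 0 a = 0" "sl2_bracket a 0 = 0"
  by (transfer; simp add: matrix_matrix_mult_def vec_eq_iff)+

lemma sl2_form_zero [simp]: "sl2_form 0 a = 0" "sl2_form a 0 = 0"
  by (simp_all add: sl2_form_def zero_sl2.rep_eq matrix_matrix_mult_def trace_def)

lemma sl2_scale_zero [simp]: "sl2_scale c 0 = 0"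
  by transfer (simp add: vec_eq_iff)

(* The pair (f, c) stands for the sum of the f_m \<otimes> t^m plus c k, where f is a finitely supported
   family of elements of sl(2,C) indexed by the integers. *)
type_synonym affine = "(int \<Rightarrow>\<^sub>0 sl2) \<times> complex"

definition affine_scale :: "complex \<Rightarrow> affine \<Rightarrow> affine" where
  "affine_scale c x = (Poly_Mapping.map (sl2_scale c) (fst x), c * snd x)"

definition loop :: "sl2 \<Rightarrow> int \<Rightarrow> affine" where
  "loop a m = (Poly_Mapping.single m a, 0)"

definition central :: affine where
  "central = (0, 1)"

definition affine_bracket :: "affine \<Rightarrow> affine \<Rightarrow> affine" where
  "affine_bracket x y =
    (let f = fst x; g = fst y in
      (\<Sum>m\<in>Poly_Mapping.keys f. \<Sum>n\<in>Poly_Mapping.keys g.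
         Poly_Mapping.single (m + n) (sl2_bracket (Poly_Mapping.lookup f m) (Poly_Mapping.lookup g n)),
       \<Sum>m\<in>Poly_Mapping.keys f. \<Sum>n\<in>Poly_Mapping.keys g.
         (if m + n = 0 then of_int m * sl2_form (Poly_Mapping.lookup f m) (Poly_Mapping.lookup g n) else 0)))"

lemma affine_bracket_loop:
  "affine_bracket (loop a m) (loop b n) =
     loop (sl2_bracket a b) (m + n) +
     affine_scale (if m + n = 0 then of_int m * sl2_form a b else 0) central"
proof -
  have "Poly_Mapping.map (sl2_scale c) 0 = 0" for c
    by (rule poly_mapping_eqI) (simp add: Poly_Mapping.map.rep_eq)
  then show ?thesis
    by (cases "a = 0"; cases "b = 0")
      (auto simp: affine_bracket_def loop_def affine_scale_def central_def)
qed

lemma affine_bracket_central: "affine_bracket central y = 0" "affine_bracket x central = 0"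
  by (simp_all add: affine_bracket_def central_def zero_prod_def)

(* The positive part C x_alpha + g \<otimes> t C[t] of the triangular decomposition. *)
definition affine_pos :: "affine set" where
  "affine_pos = {(f, c). c = 0 \<and> (\<forall>m<0. Poly_Mapping.lookup f m = 0) \<and> (\<exists>z. Poly_Mapping.lookup f 0 = sl2_scale z x_pos)}"

(* The carrier of the module is the whole type 'v. *)
locale affine_module = vector_space scl
  for scl :: "complex \<Rightarrow> 'v::ab_group_add \<Rightarrow> 'v" +
  fixes act :: "affine \<Rightarrow> 'v \<Rightarrow> 'v"
  assumes act_add_left: "act (x + y) v = act x v + act y v"
    and act_scale_left: "act (affine_scale c x) v = scl c (act x v)"
    and act_add_right: "act x (v + w) = act x v + act x w"
    and act_scale_right: "act x (scl c v) = scl c (act x v)"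
    and act_bracket: "act (affine_bracket x y) v = act x (act y v) - act y (act x v)"

definition submodule ::
    "(complex \<Rightarrow> 'v::ab_group_add \<Rightarrow> 'v) \<Rightarrow> (affine \<Rightarrow> 'v \<Rightarrow> 'v) \<Rightarrow> 'v set \<Rightarrow> bool" where
  "submodule scl act S \<longleftrightarrow> module.subspace scl S \<and> (\<forall>x. \<forall>w\<in>S. act x w \<in> S)"

definition irreducible_module ::
    "(complex \<Rightarrow> 'v::ab_group_add \<Rightarrow> 'v) \<Rightarrow> (affine \<Rightarrow> 'v \<Rightarrow> 'v) \<Rightarrow> bool" where
  "irreducible_module scl act \<longleftrightarrow>
     affine_module scl act \<and> (\<exists>w::'v. w \<noteq> 0) \<and>
     (\<forall>S. submodule scl act S \<longrightarrow> S = {0} \<or> S = UNIV)"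

(* A weight is a linear functional on C h + C k; it is encoded as the pair of its values
   at h and at k. *)
type_synonym weight = "complex \<times> complex"

definition fundamental_weight :: "nat \<Rightarrow> weight" where
  "fundamental_weight i = (if i = 1 then 1 else 0, 1)"

definition highest_weight_vector ::
    "(complex \<Rightarrow> 'v::ab_group_add \<Rightarrow> 'v) \<Rightarrow> (affine \<Rightarrow> 'v \<Rightarrow> 'v) \<Rightarrow> weight \<Rightarrow> 'v \<Rightarrow> bool" where
  "highest_weight_vector scl act \<Lambda> v \<longleftrightarrow>
     v \<noteq> 0 \<and> (\<forall>x\<in>affine_pos. act x v = 0) \<and>
     act (loop h_cartan 0) v = scl (fst \<Lambda>) v \<and> act central v = scl (snd \<Lambda>) v"

(* That v generates the module need not be required: it follows from irreducibility. *)
definition irreducible_highest_weight_module ::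
    "(complex \<Rightarrow> 'v::ab_group_add \<Rightarrow> 'v) \<Rightarrow> (affine \<Rightarrow> 'v \<Rightarrow> 'v) \<Rightarrow> weight \<Rightarrow> 'v \<Rightarrow> bool" where
  "irreducible_highest_weight_module scl act \<Lambda> v \<longleftrightarrow>
     irreducible_module scl act \<and> highest_weight_vector scl act \<Lambda> v"

(* The loop algebra of n = C x_alpha is abelian, so its enveloping algebra is the polynomial
   algebra over the complex numbers in the variables x_alpha(m), m an integer. A polynomial is a
   finitely supported family of coefficients indexed by exponent vectors; the multiplication of
   the type is the polynomial (convolution) product. *)
type_synonym U_nbar = "(int \<Rightarrow>\<^sub>0 nat) \<Rightarrow>\<^sub>0 complex"

definition xvar :: "int \<Rightarrow> U_nbar" where
  "xvar m = Poly_Mapping.single (Poly_Mapping.single m 1) 1"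

(* The enveloping algebra of n \<otimes> t^k C[t^{-1}], as a subalgebra. *)
definition U_nbar_le :: "int \<Rightarrow> U_nbar set" where
  "U_nbar_le k = {p. \<forall>e\<in>Poly_Mapping.keys p. Poly_Mapping.keys e \<subseteq> {..k}}"

abbreviation U_nbar_minus :: "U_nbar set" where
  "U_nbar_minus \<equiv> U_nbar_le (-1)"

abbreviation U_nbar_le_minus2 :: "U_nbar set" where
  "U_nbar_le_minus2 \<equiv> U_nbar_le (-2)"

(* Action of the monomial with exponents e. The operators x_alpha(m) commute on a module, so
   the (increasing) order of the factors is immaterial; see mono_act_add. *)
definition mono_act :: "(affine \<Rightarrow> 'v \<Rightarrow> 'v) \<Rightarrow> (int \<Rightarrow>\<^sub>0 nat) \<Rightarrow> 'v \<Rightarrow> 'v" where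
  "mono_act act e w =
     foldr (\<lambda>m. act (loop x_pos m) ^^ Poly_Mapping.lookup e m) (sorted_list_of_set (Poly_Mapping.keys e)) w"

definition U_act ::
    "(complex \<Rightarrow> 'v::ab_group_add \<Rightarrow> 'v) \<Rightarrow> (affine \<Rightarrow> 'v \<Rightarrow> 'v) \<Rightarrow> U_nbar \<Rightarrow> 'v \<Rightarrow> 'v" where
  "U_act scl act p w = (\<Sum>e\<in>Poly_Mapping.keys p. scl (Poly_Mapping.lookup p e) (mono_act act e w))"

definition principal_subspace ::
    "(complex \<Rightarrow> 'v::ab_group_add \<Rightarrow> 'v) \<Rightarrow> (affine \<Rightarrow> 'v \<Rightarrow> 'v) \<Rightarrow> 'v \<Rightarrow> 'v set" where
  "principal_subspace scl act v = (\<lambda>a. U_act scl act a v) ` UNIV"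

lemma U_act_in_principal_subspace:
  "(\<lambda>a. U_act scl act a v) \<in> U_nbar_le k \<rightarrow> principal_subspace scl act v"
  by (auto simp: principal_subspace_def)

definition kernel_on :: "'a set \<Rightarrow> ('a \<Rightarrow> 'b::zero) \<Rightarrow> 'a set" where
  "kernel_on A f = {a \<in> A. f a = 0}"

context affine_module
begin

lemma act_zero_left: "act 0 v = 0"
  using act_add_left[of 0 0 v] by simp

lemma act_zero_right: "act x 0 = 0"
  using act_add_right[of x 0 0] by simp

lemma act_sum_right: "act x (sum f A) = (\<Sum>a\<in>A. act x (f a))"
  by (induction A rule: infinite_finite_induct) (simp_all add: act_zero_right act_add_right)

lemma act_x_pos_commute:
  "act (loop x_pos m) (act (loop x_pos n) w) = act (loop x_pos n) (act (loop x_pos m) w)"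
proof -
  have "sl2_form x_pos x_pos = 0"
    unfolding sl2_form_def
    by (simp add: x_pos.rep_eq trace_def sum_2 matrix_matrix_mult_def)
  then have "affine_bracket (loop x_pos m) (loop x_pos n) = 0"
    unfolding affine_bracket_loop
    by (simp add: sl2_bracket_self loop_def affine_scale_def central_def zero_prod_def
        Poly_Mapping.map_eq_zero_iff)
  then show ?thesis
    using act_bracket[of "loop x_pos m" "loop x_pos n" w] by (simp add: act_zero_left)
qed

end

lemma funpow_commute_point:
  assumes "\<And>w. f (g w) = g (f w)"
  shows "(f ^^ i) ((g ^^ j) w) = (g ^^ j) ((f ^^ i) w)"
proof -
  have 1: "f ((g ^^ j) w) = (g ^^ j) (f w)" for w
    by (induction j) (simp_all add: assms)
  show ?thesis
    by (induction i) (simp_all add: 1)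
qed

lemma foldr_commute_point:
  assumes "\<And>m w. f (X m w) = X m (f w)"
  shows "f (foldr (\<lambda>m. X m ^^ g m) xs w) = foldr (\<lambda>m. X m ^^ g m) xs (f w)"
proof (induction xs)
  case (Cons a xs)
  have "f ((X a ^^ k) u) = (X a ^^ k) (f u)" for k u
    using funpow_commute_point[of f "X a" 1 k] assms by simp
  then show ?case by (simp add: Cons)
qed simp

lemma foldr_funpow_add:
  assumes "\<And>m n w. X m (X n w) = X n (X m w)"
  shows "foldr (\<lambda>m. X m ^^ (g m + h m)) xs w =
         foldr (\<lambda>m. X m ^^ g m) xs (foldr (\<lambda>m. X m ^^ h m) xs w)"
proof (induction xs)
  case (Cons a xs)
  have "(X a ^^ h a) (foldr (\<lambda>m. X m ^^ g m) xs u) =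
        foldr (\<lambda>m. X m ^^ g m) xs ((X a ^^ h a) u)" for u
    by (rule foldr_commute_point)
       (use funpow_commute_point[of "X a" "X _" "h a" 1] assms in simp)
  then show ?case using Cons by (simp add: funpow_add o_def)
qed simp

lemma foldr_filter_exponents:
  "foldr (\<lambda>m. X m ^^ g m) (filter (\<lambda>m. g m \<noteq> 0) xs) w = foldr (\<lambda>m. X m ^^ (g m :: nat)) xs w"
  by (induction xs) auto

lemma mono_act_superset:
  assumes "finite S" "Poly_Mapping.keys e \<subseteq> S"
  shows "mono_act act e w =
         foldr (\<lambda>m. act (loop x_pos m) ^^ Poly_Mapping.lookup e m) (sorted_list_of_set S) w"
proof -
  have "sorted_list_of_set (Poly_Mapping.keys e) = filter (\<lambda>m. Poly_Mapping.lookup e m \<noteq> 0) (sorted_list_of_set S)"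
    by (rule sorted_distinct_set_unique)
       (use assms in \<open>auto simp: sorted_wrt_filter in_keys_iff\<close>)
  then show ?thesis by (simp only: mono_act_def foldr_filter_exponents)
qed

lemma U_act_superset:
  assumes "vector_space scl" "finite S" "Poly_Mapping.keys p \<subseteq> S"
  shows "U_act scl act p w = (\<Sum>e\<in>S. scl (Poly_Mapping.lookup p e) (mono_act act e w))"
proof -
  interpret vector_space scl by fact
  show ?thesis unfolding U_act_def
    by (rule sum.mono_neutral_left) (use assms in \<open>auto simp: in_keys_iff\<close>)
qed

lemma poly_mapping_sum_single: "p = (\<Sum>e\<in>Poly_Mapping.keys p. Poly_Mapping.single e (Poly_Mapping.lookup p e))"
proof (rule poly_mapping_eqI)
  fix k
  have "Poly_Mapping.lookup (\<Sum>e\<in>Poly_Mapping.keys p. Poly_Mapping.single e (Poly_Mapping.lookup p e)) k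
      = (\<Sum>e\<in>Poly_Mapping.keys p. if k = e then Poly_Mapping.lookup p e else 0)"
    unfolding lookup_sum by (rule sum.cong) (simp_all add: lookup_single when_def)
  also have "\<dots> = Poly_Mapping.lookup p k"
    by (subst sum.delta') (simp_all add: in_keys_iff)
  finally show "Poly_Mapping.lookup p k = Poly_Mapping.lookup
      (\<Sum>e\<in>Poly_Mapping.keys p. Poly_Mapping.single e (Poly_Mapping.lookup p e)) k" ..
qed

context affine_module
begin

lemma mono_act_add: "mono_act act (e1 + e2) w = mono_act act e1 (mono_act act e2 w)"
proof -
  define S where "S = Poly_Mapping.keys e1 \<union> Poly_Mapping.keys e2"
  have S: "finite S" "Poly_Mapping.keys e1 \<subseteq> S" "Poly_Mapping.keys e2 \<subseteq> S" "Poly_Mapping.keys (e1 + e2) \<subseteq> S"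
    using keys_add[of e1 e2] by (auto simp: S_def)
  show ?thesis
    unfolding mono_act_superset[OF S(1,2)] mono_act_superset[OF S(1,3)]
      mono_act_superset[OF S(1,4)] lookup_add
    by (rule foldr_funpow_add) (rule act_x_pos_commute)
qed

lemma U_act_add: "U_act scl act (p + q) w = U_act scl act p w + U_act scl act q w"
proof -
  have vs: "vector_space scl" ..
  define S where "S = Poly_Mapping.keys p \<union> Poly_Mapping.keys q"
  have S: "finite S" "Poly_Mapping.keys p \<subseteq> S" "Poly_Mapping.keys q \<subseteq> S" "Poly_Mapping.keys (p + q) \<subseteq> S"
    using keys_add[of p q] by (auto simp: S_def)
  show ?thesis
    unfolding U_act_superset[OF vs S(1,2)] U_act_superset[OF vs S(1,3)]
      U_act_superset[OF vs S(1,4)]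
    by (simp add: lookup_add scale_left_distrib sum.distrib)
qed

lemma U_act_zero [simp]: "U_act scl act 0 w = 0"
  by (simp add: U_act_def)

lemma U_act_sum: "U_act scl act (sum f A) w = (\<Sum>a\<in>A. U_act scl act (f a) w)"
  by (induction A rule: infinite_finite_induct) (simp_all add: U_act_add)

lemma U_act_single: "U_act scl act (Poly_Mapping.single e c) w = scl c (mono_act act e w)"
  by (cases "c = 0") (simp_all add: U_act_def)

lemma mono_act_linear:
  "mono_act act e (u + w) = mono_act act e u + mono_act act e w"
  "mono_act act e (scl c w) = scl c (mono_act act e w)"
proof -
  have 1: "(act x ^^ k) (u + w) = (act x ^^ k) u + (act x ^^ k) w"
    "(act x ^^ k) (scl c w) = scl c ((act x ^^ k) w)" for x k u w
    by (induction k) (simp_all add: act_add_right act_scale_right)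
  have "foldr (\<lambda>m. act (loop x_pos m) ^^ g m) xs (u + w) =
    foldr (\<lambda>m. act (loop x_pos m) ^^ g m) xs u + foldr (\<lambda>m. act (loop x_pos m) ^^ g m) xs w"
    "foldr (\<lambda>m. act (loop x_pos m) ^^ g m) xs (scl c w) =
    scl c (foldr (\<lambda>m. act (loop x_pos m) ^^ g m) xs w)" for g xs
    by (induction xs) (simp_all add: 1)
  then show "mono_act act e (u + w) = mono_act act e u + mono_act act e w"
    "mono_act act e (scl c w) = scl c (mono_act act e w)"
    by (simp_all add: mono_act_def)
qed

lemma mono_act_zero_right: "mono_act act e 0 = 0"
  using mono_act_linear(1)[of e 0 0] by simp

lemma U_act_add_right: "U_act scl act p (u + w) = U_act scl act p u + U_act scl act p w"
  by (simp add: U_act_def mono_act_linear scale_right_distrib sum.distrib)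

lemma U_act_scale_right: "U_act scl act p (scl c w) = scl c (U_act scl act p w)"
  by (simp add: U_act_def mono_act_linear scale_sum_right mult.commute)

lemma U_act_zero_right: "U_act scl act p 0 = 0"
  using U_act_add_right[of p 0 0] by simp

lemma U_act_sum_right: "U_act scl act p (sum f A) = (\<Sum>a\<in>A. U_act scl act p (f a))"
  by (induction A rule: infinite_finite_induct) (simp_all add: U_act_add_right U_act_zero_right)

lemma U_act_one: "U_act scl act 1 w = w"
  by (simp add: U_act_def mono_act_def)

lemma U_act_xvar: "U_act scl act (xvar m) w = act (loop x_pos m) w"
  by (simp add: xvar_def U_act_single mono_act_def)

lemma U_act_mult: "U_act scl act (p * q) w = U_act scl act p (U_act scl act q w)"
proof -
  have "p * q = (\<Sum>e\<in>Poly_Mapping.keys p. \<Sum>f\<in>Poly_Mapping.keys q.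
      Poly_Mapping.single (e + f) (Poly_Mapping.lookup p e * Poly_Mapping.lookup q f))"
  proof -
    have "p * q = (\<Sum>e\<in>Poly_Mapping.keys p. Poly_Mapping.single e (Poly_Mapping.lookup p e)) * (\<Sum>e\<in>Poly_Mapping.keys q. Poly_Mapping.single e (Poly_Mapping.lookup q e))"
      by (simp only: poly_mapping_sum_single[symmetric])
    then show ?thesis
      by (simp only: sum_product mult_single)
  qed
  then have "U_act scl act (p * q) w = (\<Sum>e\<in>Poly_Mapping.keys p. \<Sum>f\<in>Poly_Mapping.keys q.
      scl (Poly_Mapping.lookup p e * Poly_Mapping.lookup q f) (mono_act act e (mono_act act f w)))"
    by (simp add: U_act_sum U_act_single mono_act_add)
  also have "\<dots> = (\<Sum>f\<in>Poly_Mapping.keys q. scl (Poly_Mapping.lookup q f) (U_act scl act p (mono_act act f w)))"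
    by (subst sum.swap) (simp add: U_act_def scale_sum_right mult.commute)
  also have "\<dots> = U_act scl act p (U_act scl act q w)"
    by (simp add: U_act_def[of _ _ q] U_act_sum_right U_act_scale_right)
  finally show ?thesis .
qed

end

definition quad_sum :: "int \<Rightarrow> int \<Rightarrow> U_nbar" where
  "quad_sum k t = (\<Sum>(m1, m2) \<in> {(m1, m2). m1 \<le> k \<and> m2 \<le> k \<and> m1 + m2 = -t}. xvar m1 * xvar m2)"

lemma finite_quad_sum_index: "finite {(m1, m2). m1 \<le> k \<and> m2 \<le> k \<and> m1 + m2 = -(t::int)}"
  by (rule finite_subset[of _ "{-t-k..k} \<times> {-t-k..k}"]) auto

abbreviation R0 :: "int \<Rightarrow> U_nbar" where
  "R0 t \<equiv> quad_sum (-1) t"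

abbreviation R1 :: "int \<Rightarrow> U_nbar" where
  "R1 t \<equiv> quad_sum (-2) t"

(* The sum over t in T of the principal ideals A r(t): all finite sums of elements a(t) r(t)
   with a(t) in A. *)
definition ideal_sum :: "U_nbar set \<Rightarrow> int set \<Rightarrow> (int \<Rightarrow> U_nbar) \<Rightarrow> U_nbar set" where
  "ideal_sum A T r = {\<Sum>t\<in>F. a t * r t | F a. finite F \<and> F \<subseteq> T \<and> (\<forall>t\<in>F. a t \<in> A)}"

definition I_Lambda0 :: "U_nbar set" where
  "I_Lambda0 = ideal_sum U_nbar_minus {2..} R0"

definition I_Lambda1 :: "U_nbar set" where
  "I_Lambda1 = {p + b * xvar (-1) | p b. p \<in> ideal_sum U_nbar_minus {2..} R0 \<and> b \<in> U_nbar_minus}"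

definition I_Lambda1' :: "U_nbar set" where
  "I_Lambda1' = ideal_sum U_nbar_le_minus2 {4..} R1"

end

theory Submission
  imports Defs "HOL-Library.FSet" "HOL-Library.Function_Algebras"
begin

text \<open>
  Both level one modules are compared with one concrete module, the Fock space of fermions of two
  colors, on which x_alpha(m) moves a fermion of color 2 to color 1 and raises its index by m. For
  integers a and b let vac a b be the sea filled from a on in color 1 and from b on in color 2; then
  vac 0 0 and vac (-1) 0 are highest weight vectors of weights Lambda_0 and Lambda_1. An element of
  the polynomial algebra annihilates the highest weight vector of the given irreducible module if
  and only if it annihilates the sea: in the submodule of the product generated by the pair of
  highest weight vectors, the vectors (0, w) are excluded by irreducibility and the vectors (f, 0)
  by the positive definite contravariant form on Fock space. Here it must be known that
  the highest weight vector is not in the span of the proper descendants; since no degree operator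
  is given on the module, the Sugawara operator takes its place.

  On Fock space the kernels are determined for all seas simultaneously. The operator x_alpha(k)
  with k = a - b - 1 maps vac a b to vac (a - 1) (b + 1) up to sign, creation of a fermion at
  (1, a - 1) maps it to vac (a - 1) b and commutes with all x_alpha(m), and both facts feed an
  induction on weight.
\<close>

section \<open>Level one modules\<close>

text \<open>The kernel at \<open>vac a b\<close> depends only on k = a - b - 1, the largest mode for
  which x_alpha(k) does not kill the sea; the two seas of the theorem have k = -1 and k = -2. Write
  J_k for \<open>quad_ideal k\<close>. Creation at (1, a - 1) lowers k by one, x_alpha(k) lowers it
  by two, and the ideals follow the same pattern: J_(k-1) lies in J_k + U x(k), and J_(k-2) x(k)
  lies in J_k. Creation alone sees a polynomial only modulo x(k), because x_alpha(k) kills the new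
  sea; the second move recovers the cofactor of x(k). Giving x(m) the weight k + 1 - m makes both
  moves decrease: passing to k - 1 lowers the weight of every nonconstant monomial, and splitting
  off x(k) costs one unit. That J_k kills the sea starts from x(k)^2, by the exclusion principle,
  and climbs to the other relations by commutators with a first order differential operator. States
  are arbitrary functions on basis states, so operators with infinite matrices are defined
  pointwise; finite windows of modes serve to justify commutators and adjoints.\<close>

lemma sl2_form_values:
  "sl2_form x_pos x_neg = 1" "sl2_form x_neg x_pos = 1" "sl2_form h_cartan h_cartan = 2"
  "sl2_form x_pos x_pos = 0" "sl2_form x_neg x_neg = 0"
  "sl2_form x_pos h_cartan = 0" "sl2_form h_cartan x_pos = 0"
  "sl2_form x_neg h_cartan = 0" "sl2_form h_cartan x_neg = 0"
  by (simp_all add: sl2_form_def x_pos.rep_eq x_neg.rep_eq h_cartan.rep_eq trace_def sum_2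
      matrix_matrix_mult_def)

lemma sl2_decomposition:
  "a = sl2_scale (mat_of_sl2 a $ 1 $ 2) x_pos + sl2_scale (mat_of_sl2 a $ 1 $ 1) h_cartan
     + sl2_scale (mat_of_sl2 a $ 2 $ 1) x_neg"
proof -
  have "mat_of_sl2 a $ 1 $ 1 + mat_of_sl2 a $ 2 $ 2 = 0"
    using mat_of_sl2[of a] by (simp add: trace_def sum_2)
  then have "mat_of_sl2 a $ 2 $ 2 = - mat_of_sl2 a $ 1 $ 1"
    by (simp add: eq_neg_iff_add_eq_0 add.commute)
  then show ?thesis
    by (simp add: mat_of_sl2_inject[symmetric] plus_sl2.rep_eq sl2_scale.rep_eq x_pos.rep_eq
        x_neg.rep_eq h_cartan.rep_eq vec_eq_iff forall_2)
qed

lemma loop_scale: "loop (sl2_scale c a) m = affine_scale c (loop a m)"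
  by (simp add: loop_def affine_scale_def)

lemma loop_add: "loop (a + b) m = loop a m + loop b m"
  by (simp add: loop_def single_add)

lemma affine_decomposition:
  "x = (\<Sum>m\<in>Poly_Mapping.keys (fst x). loop (Poly_Mapping.lookup (fst x) m) m) + affine_scale (snd x) central"
proof (rule prod_eqI)
  have 0: "Poly_Mapping.map (sl2_scale c) 0 = 0" for c
    by (rule poly_mapping_eqI) (simp add: Poly_Mapping.map.rep_eq)
  have 1: "fst (loop a m) = Poly_Mapping.single m a" "snd (loop a m) = 0" for a m
    by (simp_all add: loop_def)
  have p: "(p :: int \<Rightarrow>\<^sub>0 sl2) = (\<Sum>e\<in>Poly_Mapping.keys p. Poly_Mapping.single e (Poly_Mapping.lookup p e))" for p
    by (rule poly_mapping_eqI)
      (simp add: lookup_sum lookup_single when_def in_keys_iff sum.delta cong: if_cong)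
  show "fst x = fst ((\<Sum>m\<in>Poly_Mapping.keys (fst x). loop (Poly_Mapping.lookup (fst x) m) m) + affine_scale (snd x) central)"
    using p[of "fst x"] by (simp add: fst_sum 1 affine_scale_def central_def 0)
  show "snd x = snd ((\<Sum>m\<in>Poly_Mapping.keys (fst x). loop (Poly_Mapping.lookup (fst x) m) m) + affine_scale (snd x) central)"
    by (simp add: snd_sum 1 affine_scale_def central_def)
qed

context affine_module
begin

abbreviation (input) xp :: "int \<Rightarrow> 'v \<Rightarrow> 'v" where "xp m \<equiv> act (loop x_pos m)"
abbreviation (input) xm :: "int \<Rightarrow> 'v \<Rightarrow> 'v" where "xm m \<equiv> act (loop x_neg m)"
abbreviation (input) hh :: "int \<Rightarrow> 'v \<Rightarrow> 'v" where "hh m \<equiv> act (loop h_cartan m)"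

lemma act_sum_left: "act (sum f A) v = (\<Sum>a\<in>A. act (f a) v)"
  by (induction A rule: infinite_finite_induct) (simp_all add: act_zero_left act_add_left)

lemma act_diff_right: "act x (v - w) = act x v - act x w"
  using act_add_right[of x "v - w" w] by (simp add: algebra_simps)

lemma act_neg_right: "act x (- w) = - act x w"
  using act_diff_right[of x 0 w] by (simp add: act_zero_right)

lemma act_loop_decomposition:
  "act (loop a m) w = scl (mat_of_sl2 a $ 1 $ 2) (xp m w) + scl (mat_of_sl2 a $ 1 $ 1) (hh m w)
     + scl (mat_of_sl2 a $ 2 $ 1) (xm m w)"
  by (subst sl2_decomposition[of a])
    (simp only: loop_add loop_scale act_add_left act_scale_left)

lemma act_decomposition:
  "act x w = (\<Sum>m\<in>Poly_Mapping.keys (fst x). act (loop (Poly_Mapping.lookup (fst x) m) m) w)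
     + scl (snd x) (act central w)"
  by (subst affine_decomposition[of x]) (simp only: act_add_left act_sum_left act_scale_left)

lemma act_loop_commute:
  "act (loop a m) (act (loop b n) w) = act (loop b n) (act (loop a m) w)
     + act (loop (sl2_bracket a b) (m + n)) w
     + scl (if m + n = 0 then of_int m * sl2_form a b else 0) (act central w)"
  using act_bracket[of "loop a m" "loop b n" w]
  by (simp add: affine_bracket_loop act_add_left act_scale_left algebra_simps)

end

text \<open>The level is fixed on the whole space, so that the product of two such modules, with
  diagonal action, is again one; the comparison of modules takes place in that product.\<close>

locale level_one_module = affine_module scl act
  for scl :: "complex \<Rightarrow> 'v::ab_group_add \<Rightarrow> 'v" and act +
  assumes act_central: "act central w = w"
begin

lemma xp_xm: "xp m (xm n w) = xm n (xp m w) + hh (m + n) w + scl (if m + n = 0 then of_int m else 0) w"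
  using act_loop_commute[of x_pos m x_neg n w]
  by (simp add: act_central sl2_brackets sl2_form_values)

lemma hh_xp: "hh m (xp n w) = xp n (hh m w) + scl 2 (xp (m + n) w)"
  using act_loop_commute[of h_cartan m x_pos n w]
  by (simp add: act_central sl2_brackets sl2_form_values loop_scale act_scale_left)

lemma hh_xm: "hh m (xm n w) = xm n (hh m w) - scl 2 (xm (m + n) w)"
  using act_loop_commute[of h_cartan m x_neg n w]
  by (simp add: act_central sl2_brackets sl2_form_values loop_scale act_scale_left)

lemma xm_xm: "xm m (xm n w) = xm n (xm m w)"
  using act_loop_commute[of x_neg m x_neg n w] act_zero_left
  by (simp add: act_central sl2_bracket_self sl2_form_values loop_def act_zero_left zero_prod_def[symmetric])

text \<open>\<open>xp 0\<close>, \<open>xm 0\<close>, \<open>xp (-1)\<close>, \<open>xm 1\<close>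
  are the Chevalley generators e_1, f_1, f_0, e_0 of the affine algebra. Commutators among them give
  h(-1) and h(1), and commuting with these shifts the modes of x_alpha and x_(-alpha) by one, up to
  a factor 2 or -2.\<close>

lemma submodule_generators:
  assumes S: "module.subspace scl S"
    and cl: "\<And>w. w \<in> S \<Longrightarrow> xp 0 w \<in> S" "\<And>w. w \<in> S \<Longrightarrow> xm 0 w \<in> S"
      "\<And>w. w \<in> S \<Longrightarrow> xp (-1) w \<in> S" "\<And>w. w \<in> S \<Longrightarrow> xm 1 w \<in> S"
  shows "submodule scl act S"
proof -
  note ss = subspace_add[OF S] subspace_diff[OF S] subspace_scale[OF S]
  have h1: "hh (-1) w \<in> S" if "w \<in> S" for w
  proof -
    have "hh (-1) w = xp (-1) (xm 0 w) - xm 0 (xp (-1) w)" by (simp add: xp_xm)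
    then show ?thesis using that by (simp add: ss cl)
  qed
  have h2: "hh 1 w \<in> S" if "w \<in> S" for w
  proof -
    have "hh 1 w = xp 0 (xm 1 w) - xm 1 (xp 0 w)" by (simp add: xp_xm)
    then show ?thesis using that by (simp add: ss cl)
  qed
  have half: "z = scl (1/2) (scl 2 z)" for z by simp
  have up: "(\<forall>w\<in>S. xp m w \<in> S) \<and> (\<forall>w\<in>S. xm m w \<in> S)" for m
  proof (induction m rule: int_induct[of _ 0])
    case base then show ?case using cl by auto
  next
    case (step1 i)
    have "scl 2 (xp (i + 1) w) = hh 1 (xp i w) - xp i (hh 1 w)"
      "scl 2 (xm (i + 1) w) = xm i (hh 1 w) - hh 1 (xm i w)" for w
      by (simp_all add: hh_xp hh_xm add.commute)
    then have "scl 2 (xp (i + 1) w) \<in> S" "scl 2 (xm (i + 1) w) \<in> S" if "w \<in> S" for w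
      using that step1 by (simp_all add: ss h2)
    then show ?case by (metis half ss(3))
  next
    case (step2 i)
    have "scl 2 (xp (i - 1) w) = hh (-1) (xp i w) - xp i (hh (-1) w)"
      "scl 2 (xm (i - 1) w) = xm i (hh (-1) w) - hh (-1) (xm i w)" for w
      by (simp_all add: hh_xp hh_xm)
    then have "scl 2 (xp (i - 1) w) \<in> S" "scl 2 (xm (i - 1) w) \<in> S" if "w \<in> S" for w
      using that step2 by (simp_all add: ss h1)
    then show ?case by (metis half ss(3))
  qed
  have hh: "hh m w \<in> S" if "w \<in> S" for m w
  proof -
    have "hh m w = xp m (xm 0 w) - xm 0 (xp m w)" by (simp add: xp_xm)
    then show ?thesis using that up by (simp add: ss)
  qed
  have "act (loop a m) w \<in> S" if "w \<in> S" for a m w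
    by (subst act_loop_decomposition) (use that up hh in \<open>simp add: ss\<close>)
  then have "act x w \<in> S" if "w \<in> S" for x w
    by (subst act_decomposition) (use that act_central in \<open>auto intro!: ss subspace_sum[OF S]\<close>)
  then show ?thesis using S by (simp add: submodule_def)
qed

text \<open>The Sugawara operator truncated at mode n; it replaces the degree operator, which is not part
  of the algebra acting here. Subtracting h(0) makes both lowering generators strictly increase the
  eigenvalue.\<close>
definition casimir :: "nat \<Rightarrow> 'v \<Rightarrow> 'v" where
  "casimir n w = xp 0 (xm 0 w) + xm 0 (xp 0 w) + scl (1/2) (hh 0 (hh 0 w)) - hh 0 w
    + scl 2 (\<Sum>k=1..n. xp (- int k) (xm (int k) w) + xm (- int k) (xp (int k) w)
        + scl (1/2) (hh (- int k) (hh (int k) w)))"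

text \<open>On a vector killed by all modes from \<open>N\<close> on, \<open>casimir n\<close> no
  longer changes once \<open>n\<close> has reached \<open>N\<close>, so this is an eigenspace of the
  full Sugawara operator. The vanishing of high modes is recorded because
  \<open>casimir_commute_xp\<close> uses it.\<close>

definition casimir_eigenspace :: "complex \<Rightarrow> 'v set" where
  "casimir_eigenspace c = {w. \<exists>N. \<forall>n\<ge>N. xp (int n) w = 0 \<and> xm (int n) w = 0 \<and> hh (int n) w = 0
     \<and> casimir n w = scl c w}"

lemma casimir_add: "casimir n (u + w) = casimir n u + casimir n w"
  by (simp add: casimir_def act_add_right sum.distrib scale_right_distrib algebra_simps)

lemma casimir_scale: "casimir n (scl c w) = scl c (casimir n w)"
  by (simp add: casimir_def act_scale_right scale_sum_right scale_right_distrib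
      scale_right_diff_distrib mult.commute)

lemma casimir_eigenspace_subspace: "subspace (casimir_eigenspace c)"
proof (rule subspaceI)
  show "0 \<in> casimir_eigenspace c"
    using casimir_scale[of _ 0 0] by (simp add: casimir_eigenspace_def act_zero_right)
next
  fix x y assume "x \<in> casimir_eigenspace c" "y \<in> casimir_eigenspace c"
  then obtain N M where N: "\<forall>n\<ge>N. xp (int n) x = 0 \<and> xm (int n) x = 0 \<and> hh (int n) x = 0
     \<and> casimir n x = scl c x" "\<forall>n\<ge>M. xp (int n) y = 0 \<and> xm (int n) y = 0 \<and> hh (int n) y = 0
     \<and> casimir n y = scl c y" unfolding casimir_eigenspace_def by blast
  show "x + y \<in> casimir_eigenspace c" unfolding casimir_eigenspace_def
    by (rule CollectI, rule exI[of _ "max N M"])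
      (use N in \<open>simp add: act_add_right casimir_add scale_right_distrib\<close>)
next
  fix a x assume "x \<in> casimir_eigenspace c"
  then show "scl a x \<in> casimir_eigenspace c"
    by (fastforce simp: casimir_eigenspace_def act_scale_right casimir_scale mult.commute)
qed

text \<open>Each mode contributes an expression invariant under the finite-dimensional sl(2), hence
  commuting with \<open>xm 0\<close>; the increment 2 comes from the subtracted \<open>hh 0\<close>
  alone.\<close>

lemma casimir_commute_xm0: "casimir n (xm 0 w) = xm 0 (casimir n w) + scl 2 (xm 0 w)"
proof -
  have 1: "xp (- k) (xm k (xm 0 w)) + xm (- k) (xp k (xm 0 w)) + scl (1/2) (hh (- k) (hh k (xm 0 w)))
     = xm 0 (xp (- k) (xm k w) + xm (- k) (xp k w) + scl (1/2) (hh (- k) (hh k w)))" for k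
  proof -
    have a: "xp (- k) (xm k (xm 0 w)) = xm 0 (xp (- k) (xm k w)) + hh (-k) (xm k w)"
      by (simp add: xm_xm[of k 0] xp_xm[of _ 0])
    have b: "xm (- k) (xp k (xm 0 w)) = xm 0 (xm (-k) (xp k w)) + xm (-k) (hh k w)"
      by (simp add: xp_xm[of _ 0] act_add_right act_scale_right xm_xm[of "-k" 0])
    have c: "hh (- k) (hh k (xm 0 w)) = xm 0 (hh (-k) (hh k w)) - scl 2 (xm (-k) (hh k w)) - scl 2 (hh (-k) (xm k w))"
      by (simp add: hh_xm[of _ 0] act_diff_right act_scale_right)
    show ?thesis by (simp add: a b c act_add_right act_scale_right scale_right_diff_distrib)
  qed
  have a: "xp 0 (xm 0 (xm 0 w)) = xm 0 (xp 0 (xm 0 w)) + hh 0 (xm 0 w)"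
    "xm 0 (xp 0 (xm 0 w)) = xm 0 (xm 0 (xp 0 w)) + xm 0 (hh 0 w)"
    "hh 0 (hh 0 (xm 0 w)) = xm 0 (hh 0 (hh 0 w)) - scl 2 (xm 0 (hh 0 w)) - scl 2 (hh 0 (xm 0 w))"
    "hh 0 (xm 0 w) = xm 0 (hh 0 w) - scl 2 (xm 0 w)"
    by (simp_all add: xp_xm[of 0 0] hh_xm[of 0 0] act_add_right act_diff_right act_scale_right)
  have 2: "xp 0 (xm 0 (xm 0 w)) + xm 0 (xp 0 (xm 0 w)) + scl (1/2) (hh 0 (hh 0 (xm 0 w))) - hh 0 (xm 0 w)
      = xm 0 (xp 0 (xm 0 w) + xm 0 (xp 0 w) + scl (1/2) (hh 0 (hh 0 w)) - hh 0 w) + scl 2 (xm 0 w)"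
    by (simp only: a(1,3) act_add_right act_diff_right act_scale_right scale_right_diff_distrib scale_scale)
      (simp add: a(2,4))
  show ?thesis
    unfolding casimir_def 1
    by (subst 2) (simp add: act_add_right act_scale_right act_sum_right act_diff_right algebra_simps)
qed

text \<open>In the limit \<open>casimir\<close> is 6 L_0 - h(0), where 6 = 2 (1 + 2) comes from the
  level 1 and the dual Coxeter number 2. As x_alpha(-1) raises L_0 by 1 and h(0) by 2, the increment
  is 6 - 2 = 4.\<close>

lemma casimir_commute_xp:
  assumes "hh (int n) w = 0" "xp (int n) w = 0" "n > 0"
  shows "casimir n (xp (-1) w) = xp (-1) (casimir n w) + scl 4 (xp (-1) w)"
proof -
  define A where "A k = xp (- k) (xm k w) + xm (- k) (xp k w) + scl (1/2) (hh (- k) (hh k w))" for k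
  \<comment> \<open>Commuting x_alpha(-1) through the summand of index \<open>k\<close> leaves a
    difference of consecutive values of \<open>B\<close>, so the sum telescopes. The upper end
    vanishes by the hypotheses; the lower end cancels the zero mode terms up to multiples of
    \<open>xp (-1) w\<close>. The extra \<open>xp (-1) w\<close> at \<open>k = 1\<close> is the
    central term.\<close>
  define B where "B k = xp (- k - 1) (hh k w) - hh (- k - 1) (xp k w)" for k
  have xx: "xp m (xp k z) = xp k (xp m z)" for m k z by (rule act_x_pos_commute)
  have mp: "xm k (xp m z) = xp m (xm k z) - hh (m + k) z - scl (if m + k = 0 then of_int m else 0) z" for k m z
    by (simp add: xp_xm)
  have step: "xp (- k) (xm k (xp (-1) w)) + xm (- k) (xp k (xp (-1) w)) + scl (1/2) (hh (- k) (hh k (xp (-1) w)))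
      = xp (-1) (A k) + B k - B (k - 1) + (if k = 1 then xp (-1) w else 0)" if "k \<ge> 1" for k
  proof -
    have a: "xp (- k) (xm k (xp (-1) w)) = xp (-1) (xp (-k) (xm k w)) - xp (-k) (hh (k - 1) w)
        + (if k = 1 then xp (-1) w else 0)"
      by (simp add: mp[of k "-1"] act_diff_right act_scale_right xx[of "-k" "-1"] act_zero_right act_neg_right)
    have b: "xm (- k) (xp k (xp (-1) w)) = xp (-1) (xm (-k) (xp k w)) - hh (-k - 1) (xp k w)"
      using that by (simp add: xx[of k "-1"] mp[of "-k" "-1"] minus_diff_commute)
    have c: "hh (- k) (hh k (xp (-1) w)) = xp (-1) (hh (-k) (hh k w)) + scl 2 (xp (-k - 1) (hh k w)) + scl 2 (hh (-k) (xp (k - 1) w))"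
      by (simp add: hh_xp[of _ "-1"] act_add_right act_scale_right)
    show ?thesis
      unfolding a b c A_def B_def
      by (simp add: act_add_right act_scale_right scale_right_distrib)
  qed
  have s: "(\<Sum>k=1..n. xp (- int k) (xm (int k) (xp (-1) w)) + xm (- int k) (xp (int k) (xp (-1) w))
        + scl (1/2) (hh (- int k) (hh (int k) (xp (-1) w))))
     = xp (-1) (\<Sum>k=1..n. A (int k)) + (B n - B 0 + (if n = 0 then 0 else xp (-1) w))" for n
  proof (induction n)
    case 0 then show ?case by (simp add: act_zero_right)
  next
    case (Suc n)
    have "1 \<le> int (Suc n)" by simp
    note st = step[OF this]
    have n: "int (Suc n) - 1 = int n" "int (Suc n) = 1 \<longleftrightarrow> n = 0" by auto
    show ?case unfolding sum.nat_ivl_Suc'[OF le_add1[of 1 n, unfolded plus_1_eq_Suc]] st n act_add_right Suc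
      by simp
  qed
  have z: "xp 0 (xm 0 (xp (-1) w)) = xp (-1) (xp 0 (xm 0 w)) - xp 0 (hh (-1) w)"
    "xm 0 (xp 0 (xp (-1) w)) = xp (-1) (xm 0 (xp 0 w)) - hh (-1) (xp 0 w)"
    "hh 0 (hh 0 (xp (-1) w)) = xp (-1) (hh 0 (hh 0 w)) + scl 2 (xp (-1) (hh 0 w)) + scl 2 (hh 0 (xp (-1) w))"
    "hh 0 (xp (-1) w) = xp (-1) (hh 0 w) + scl 2 (xp (-1) w)"
    "hh (-1) (xp 0 w) = xp 0 (hh (-1) w) + scl 2 (xp (-1) w)"
    by (simp_all add: mp[of 0 "-1"] act_diff_right xx[of 0 "-1"] hh_xp act_add_right act_scale_right)
  have Bn: "B n = 0" by (simp add: B_def assms act_zero_right)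
  have B0: "B 0 = xp (-1) (hh 0 w) - hh (-1) (xp 0 w)" by (simp add: B_def)
  have two: "scl 2 y = y + y" for y
    using scale_left_distrib[of 1 1 y] by simp
  have four: "scl 4 y = y + y + y + y" for y
    using scale_left_distrib[of 2 2 y] by (simp add: two)
  have half: "scl (1/2) (scl 2 y) = y" "scl (1/2) (y + y) = y" for y
    using two[of y] scale_scale[of "1/2" 2 y] by simp_all
  show ?thesis using assms(3)
    unfolding casimir_def s A_def[symmetric] Bn B0
    by (simp add: z hh_xp[of 0 "-1"] act_add_right act_diff_right act_scale_right scale_right_distrib scale_right_diff_distrib)
       (simp add: two four algebra_simps)
qed

section \<open>Words in the lowering generators and the highest weight vector\<close>

fun word_act :: "bool list \<Rightarrow> 'v \<Rightarrow> 'v" where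
  "word_act [] u = u"
| "word_act (b # bs) u = (if b then xm 0 else xp (-1)) (word_act bs u)"

text \<open>Pushing a raising generator to the right through a word leaves only h(0) and scalar
  terms, and words are eigenvectors of h(0); at the end the generator kills \<open>u\<close>. So the
  raising generators preserve the span as well.\<close>

lemma submodule_words:
  assumes u: "xp 0 u = 0" "xm 1 u = 0" "hh 0 u = scl l u"
  shows "submodule scl act (span (range (\<lambda>bs. word_act bs u)))" (is "submodule scl act ?N")
proof -
  have hw: "\<exists>c. hh 0 (word_act bs u) = scl c (word_act bs u)" for bs
  proof (induction bs)
    case Nil then show ?case using u by auto
  next
    case (Cons b bs)
    then obtain c where c: "hh 0 (word_act bs u) = scl c (word_act bs u)" by blast
    show ?case
    proof (cases b)
      case True
      then show ?thesis using c
        by (intro exI[of _ "c - 2"]) (simp add: hh_xm act_scale_right scale_left_diff_distrib)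
    next
      case False
      then show ?thesis using c
        by (intro exI[of _ "c + 2"]) (simp add: hh_xp act_scale_right scale_left_distrib)
    qed
  qed
  have wN: "word_act bs u \<in> ?N" for bs by (rule span_base) simp
  have cl: "act x w \<in> ?N" if "\<And>bs. act x (word_act bs u) \<in> ?N" "w \<in> ?N" for x w
    using that(2)
  proof (induction rule: span_induct_alt)
    case base then show ?case by (simp add: act_zero_right span_zero)
  next
    case (step c x y)
    then show ?case using that(1) by (auto simp: act_add_right act_scale_right intro!: span_add span_scale)
  qed
  have fN: "xm 0 w \<in> ?N" "xp (-1) w \<in> ?N" if "w \<in> ?N" for w
    using wN[of "True # bs" for bs] wN[of "False # bs" for bs] by (auto intro: cl[OF _ that])
  have hN: "hh 0 w \<in> ?N" if "w \<in> ?N" for w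
  proof (rule cl[OF _ that])
    show "hh 0 (word_act bs u) \<in> ?N" for bs
      using hw[of bs] span_scale[OF wN[of bs]] by auto
  qed
  have e1: "xp 0 (word_act bs u) \<in> ?N" for bs
  proof (induction bs)
    case Nil then show ?case by (simp add: u span_zero)
  next
    case (Cons b bs)
    have "xp 0 (xm 0 (word_act bs u)) = xm 0 (xp 0 (word_act bs u)) + hh 0 (word_act bs u)"
      by (simp add: xp_xm)
    moreover have "xp 0 (xp (-1) (word_act bs u)) = xp (-1) (xp 0 (word_act bs u))"
      by (rule act_x_pos_commute)
    ultimately show ?case using Cons fN hN wN by (auto intro!: span_add)
  qed
  have e0: "xm 1 (word_act bs u) \<in> ?N" for bs
  proof (induction bs)
    case Nil then show ?case by (simp add: u span_zero)
  next
    case (Cons b bs)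
    have "xm 1 (xp (-1) (word_act bs u)) = xp (-1) (xm 1 (word_act bs u)) - hh 0 (word_act bs u) + word_act bs u"
      using xp_xm[of "-1" 1 "word_act bs u"] by (simp add: algebra_simps)
    moreover have "xm 1 (xm 0 (word_act bs u)) = xm 0 (xm 1 (word_act bs u))"
      by (rule xm_xm)
    ultimately show ?case using Cons fN hN wN by (auto intro!: span_add span_diff)
  qed
  show ?thesis
    by (rule submodule_generators) (use cl[OF e1] cl[OF e0] fN in auto)
qed

lemma casimir_eigenspace_xm0:
  assumes "w \<in> casimir_eigenspace c" shows "xm 0 w \<in> casimir_eigenspace (c + 2)"
proof -
  obtain N where N: "\<And>n. n \<ge> N \<Longrightarrow> xp (int n) w = 0 \<and> xm (int n) w = 0 \<and> hh (int n) w = 0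
     \<and> casimir n w = scl c w" using assms unfolding casimir_eigenspace_def by blast
  show ?thesis unfolding casimir_eigenspace_def
  proof (intro CollectI exI[of _ N] allI impI)
    fix n assume "n \<ge> N"
    note N = N[OF this]
    show "xp (int n) (xm 0 w) = 0 \<and> xm (int n) (xm 0 w) = 0 \<and> hh (int n) (xm 0 w) = 0
     \<and> casimir n (xm 0 w) = scl (c + 2) (xm 0 w)"
      using N by (simp add: xp_xm[of _ 0] hh_xm[of _ 0] xm_xm[of "int n" 0] casimir_commute_xm0
          act_zero_right act_scale_right scale_left_distrib)
  qed
qed

lemma casimir_eigenspace_xp:
  assumes "w \<in> casimir_eigenspace c" shows "xp (-1) w \<in> casimir_eigenspace (c + 4)"
proof -
  obtain N where N: "\<And>n. n \<ge> N \<Longrightarrow> xp (int n) w = 0 \<and> xm (int n) w = 0 \<and> hh (int n) w = 0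
     \<and> casimir n w = scl c w" using assms unfolding casimir_eigenspace_def by blast
  show ?thesis unfolding casimir_eigenspace_def
  \<comment> \<open>Mode n moved past x_alpha(-1) produces mode n - 1, which must be at least
    \<open>N\<close> to vanish and must be positive to avoid the central term.\<close>
  proof (intro CollectI exI[of _ "N + 2"] allI impI)
    fix n assume n: "n \<ge> N + 2"
    then obtain m where m: "n = Suc m" "m \<ge> N" "m > 0" by (cases n) auto
    have N': "xp (1 + int m) w = 0" "xm (1 + int m) w = 0" "hh (1 + int m) w = 0"
      "casimir (Suc m) w = scl c w" "xp (int m) w = 0" "hh (int m) w = 0"
      using N[of "Suc m"] N[of m] m by auto
    have "xm (1 + int m) (xp (-1) w) = 0"
      using xp_xm[of "-1" "1 + int m" w] N' m by (simp add: act_zero_right)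
    moreover have "casimir (Suc m) (xp (-1) w) = scl (c + 4) (xp (-1) w)"
      using N' m by (subst casimir_commute_xp) (simp_all add: act_scale_right scale_left_distrib)
    moreover have "hh (1 + int m) (xp (-1) w) = 0"
      using N' by (simp add: hh_xp[of _ "-1"] act_zero_right)
    ultimately show "xp (int n) (xp (-1) w) = 0 \<and> xm (int n) (xp (-1) w) = 0 \<and> hh (int n) (xp (-1) w) = 0
     \<and> casimir n (xp (-1) w) = scl (c + 4) (xp (-1) w)"
      using N' act_x_pos_commute[of "1 + int m" "-1" w] m by (simp add: act_zero_right)
  qed
qed

definition highest_weight :: "complex \<Rightarrow> 'v \<Rightarrow> bool" where
  "highest_weight l u \<longleftrightarrow> u \<noteq> 0 \<and> xp 0 u = 0 \<and> hh 0 u = scl l u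
     \<and> (\<forall>n>0. xp n u = 0 \<and> xm n u = 0 \<and> hh n u = 0)"

text \<open>A letter \<open>True\<close> adds 2 to the eigenvalue and a letter \<open>False\<close>
  adds 4, so only the empty word keeps the eigenvalue of \<open>u\<close>.\<close>

lemma casimir_eigenspace_words:
  assumes u: "highest_weight l u"
  shows "word_act bs u \<in> casimir_eigenspace (l\<^sup>2 / 2 + 2 * of_nat (length bs + length (filter Not bs)))"
proof (induction bs)
  case Nil
  have "xp 0 (xm 0 u) = scl l u" using u by (simp add: xp_xm highest_weight_def act_zero_right)
  then have "casimir n u = scl (l\<^sup>2 / 2) u" for n
    using u by (simp add: casimir_def highest_weight_def act_zero_right act_scale_right power2_eq_square)
  then show ?case using u
    by (auto simp: casimir_eigenspace_def highest_weight_def intro!: exI[of _ 1])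
next
  case (Cons b bs)
  show ?case
    using casimir_eigenspace_xm0[OF Cons] casimir_eigenspace_xp[OF Cons]
    by (cases b) (simp_all add: algebra_simps)
qed

text \<open>Applying \<open>T - c k\<close> to the vanishing sum removes the summand
  \<open>k\<close> and multiplies the others by nonzero factors, which is the induction
  step.\<close>

lemma eigenvector_sum_zero:
  assumes T: "\<And>u w. T (u + w) = T u + T w" "\<And>c w. T (scl c w) = scl c (T w)"
  shows "finite J \<Longrightarrow> inj_on c J \<Longrightarrow> (\<And>j. j \<in> J \<Longrightarrow> T (x j) = scl (c j) (x j)) \<Longrightarrow> (\<Sum>j\<in>J. x j) = 0
    \<Longrightarrow> j \<in> J \<Longrightarrow> x j = 0"
proof (induction J arbitrary: x j rule: finite_induct)
  case (insert k J)
  have T0: "T 0 = 0" using T(2)[of 0 0] by simp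
  have Ts: "T (\<Sum>j\<in>A. y j) = (\<Sum>j\<in>A. T (y j))" for A and y :: "'c \<Rightarrow> _"
    by (induction A rule: infinite_finite_induct) (simp_all add: T0 T)
  have "(\<Sum>j\<in>J. scl (c j - c k) (x j)) = (\<Sum>j\<in>insert k J. scl (c j - c k) (x j))"
    using insert.hyps by simp
  also have "\<dots> = (\<Sum>j\<in>insert k J. scl (c j) (x j)) - scl (c k) (\<Sum>j\<in>insert k J. x j)"
    by (simp only: scale_left_diff_distrib sum_subtractf scale_sum_right)
  also have "(\<Sum>j\<in>insert k J. scl (c j) (x j)) = (\<Sum>j\<in>insert k J. T (x j))"
    using insert.prems(2) by (intro sum.cong) auto
  also have "\<dots> = T (\<Sum>j\<in>insert k J. x j)"
    by (simp only: Ts)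
  finally have s: "(\<Sum>j\<in>J. scl (c j - c k) (x j)) = 0" using insert.prems T0 by simp
  have z: "x j = 0" if "j \<in> J" for j
  proof -
    have "scl (c j - c k) (x j) = 0"
      by (rule insert.IH[OF _ _ s that]) (use insert in \<open>auto simp: T mult.commute\<close>)
    moreover have "c j \<noteq> c k" using insert that by (auto simp: inj_on_def)
    ultimately show ?thesis by simp
  qed
  then have "x k = 0" using insert by simp
  then show ?case using z insert by auto
qed simp

text \<open>Otherwise \<open>u\<close> would be a sum of vectors whose Sugawara eigenvalues exceed
  its own by positive integers.\<close>

lemma highest_weight_notin_span_words:
  assumes u: "highest_weight l u"
  shows "u \<notin> span {word_act bs u | bs. bs \<noteq> []}"
proof
  define E where "E j = casimir_eigenspace (l\<^sup>2 / 2 + of_nat j)" for j :: nat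
  assume "u \<in> span {word_act bs u | bs. bs \<noteq> []}"
  moreover have "\<exists>J x. finite J \<and> 0 \<notin> J \<and> w = (\<Sum>j\<in>J. x j) \<and> (\<forall>j\<in>J. x j \<in> E j)"
    if "w \<in> span {word_act bs u | bs. bs \<noteq> []}" for w
    using that
  proof (induction rule: span_induct_alt)
    case base then show ?case by (intro exI[of _ "{}"]) auto
  next
    case (step a z w)
    then obtain J x bs where J: "finite J" "0 \<notin> J" "w = (\<Sum>j\<in>J. x j)" "\<forall>j\<in>J. x j \<in> E j"
      and z: "z = word_act bs u" "bs \<noteq> []" by blast
    define k where "k = 2 * (length bs + length (filter Not bs))"
    have k: "scl a z \<in> E k" "k \<noteq> 0"
      using casimir_eigenspace_words[OF u, of bs] z
      by (auto simp: E_def k_def intro: subspace_scale[OF casimir_eigenspace_subspace])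
    define y where "y j = (if j = k then scl a z else 0) + (if j \<in> J then x j else 0)" for j
    have "scl a z + w = (\<Sum>j\<in>insert k J. y j)"
      unfolding y_def sum.distrib J(3) using J(1)
      by (simp add: sum.If_cases insert_absorb Int_absorb1 subset_insertI)
    moreover have "\<forall>j\<in>insert k J. y j \<in> E j"
      using J k unfolding y_def E_def
      by (auto intro!: subspace_add[OF casimir_eigenspace_subspace] subspace_0[OF casimir_eigenspace_subspace])
    ultimately show ?case using J k by (intro exI[of _ "insert k J"] exI[of _ y]) auto
  qed
  ultimately obtain J x where J: "finite J" "0 \<notin> J" "u = (\<Sum>j\<in>J. x j)" "\<forall>j\<in>J. x j \<in> E j" by blast
  \<comment> \<open>The relation becomes a vanishing sum of eigenvectors with distinct eigenvalues;
    \<open>- u\<close> takes the index 0, which is not in \<open>J\<close>.\<close>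
  define y where "y j = (if j = 0 then - u else x j)" for j
  have y: "y j \<in> E j" if "j \<in> insert 0 J" for j
    using J that casimir_eigenspace_words[OF u, of "[]"]
    by (auto simp: y_def E_def intro: subspace_neg[OF casimir_eigenspace_subspace])
  have "\<exists>N. \<forall>n\<ge>N. casimir n (y j) = scl (l\<^sup>2 / 2 + of_nat j) (y j)" if "j \<in> insert 0 J" for j
    using y[OF that] unfolding E_def casimir_eigenspace_def by blast
  then obtain N where N: "\<And>j n. j \<in> insert 0 J \<Longrightarrow> n \<ge> N j \<Longrightarrow> casimir n (y j) = scl (l\<^sup>2 / 2 + of_nat j) (y j)"
    by metis
  \<comment> \<open>Each summand has its own bound beyond which the truncation is immaterial; a
    common \<open>n\<close> makes all of them eigenvectors of the single operator
    \<open>casimir n\<close>.\<close>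
  define n where "n = Max (N ` insert 0 J)"
  have n: "n \<ge> N j" if "j \<in> insert 0 J" for j unfolding n_def using J(1) that by (intro Max_ge) auto
  have "(\<Sum>j\<in>insert 0 J. y j) = y 0 + (\<Sum>j\<in>J. y j)" using J by simp
  also have "(\<Sum>j\<in>J. y j) = u" unfolding J(3) using J(2) by (intro sum.cong) (auto simp: y_def)
  finally have s: "(\<Sum>j\<in>insert 0 J. y j) = 0" by (simp add: y_def)
  have "y 0 = 0"
    by (rule eigenvector_sum_zero[where T = "casimir n" and c = "\<lambda>j. l\<^sup>2 / 2 + of_nat j", OF casimir_add casimir_scale _ _ _ s])
      (use J N n in \<open>auto simp: inj_on_def\<close>)
  then show False using u by (simp add: y_def highest_weight_def)
qed

end

section \<open>Comparison of an irreducible module with a unitary one\<close>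

lemma level_one_module_prod:
  assumes "level_one_module s1 a1" "level_one_module s2 a2"
  shows "level_one_module (\<lambda>c p. (s1 c (fst p), s2 c (snd p))) (\<lambda>x p. (a1 x (fst p), a2 x (snd p)))"
proof -
  interpret A: level_one_module s1 a1 by fact
  interpret B: level_one_module s2 a2 by fact
  show ?thesis
    by unfold_locales
      (simp_all add: A.scale_right_distrib B.scale_right_distrib A.scale_left_distrib B.scale_left_distrib
        A.act_add_left B.act_add_left A.act_add_right B.act_add_right A.act_scale_left B.act_scale_left
        A.act_scale_right B.act_scale_right A.act_bracket B.act_bracket A.act_central B.act_central)
qed

context affine_module
begin

lemma U_act_submodule:
  assumes S: "submodule scl act S" and w: "w \<in> S"
  shows "U_act scl act p w \<in> S"
proof -
  have ss: "subspace S" using S by (simp add: submodule_def)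
  have cl: "act x z \<in> S" if "z \<in> S" for x z
    using S that unfolding submodule_def by blast
  have 1: "(act x ^^ k) z \<in> S" if "z \<in> S" for x k z
    using that by (induction k) (auto intro: cl)
  have 2: "foldr (\<lambda>m. act (loop x_pos m) ^^ g m) xs w \<in> S" for g xs
    by (induction xs) (auto intro: 1 w)
  show ?thesis unfolding U_act_def mono_act_def
    by (rule subspace_sum[OF ss], rule subspace_scale[OF ss], rule 2)
qed

end

lemma U_act_prod:
  "U_act (\<lambda>c p. (s1 c (fst p), s2 c (snd p))) (\<lambda>x p. (a1 x (fst p), a2 x (snd p))) p (u, v)
     = (U_act s1 a1 p u, U_act s2 a2 p v)"
proof -
  let ?a = "\<lambda>x p. (a1 x (fst p), a2 x (snd p))"
  have 1: "(?a x ^^ k) z = ((a1 x ^^ k) (fst z), (a2 x ^^ k) (snd z))" for x k z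
    by (induction k) simp_all
  have "foldr (\<lambda>m. ?a (loop x_pos m) ^^ g m) xs (u, v)
     = (foldr (\<lambda>m. a1 (loop x_pos m) ^^ g m) xs u, foldr (\<lambda>m. a2 (loop x_pos m) ^^ g m) xs v)"
    for g xs by (induction xs) (simp_all add: 1)
  then show ?thesis
    by (simp add: U_act_def mono_act_def prod_eq_iff fst_sum snd_sum)
qed

text \<open>The form is controlled only for first arguments in \<open>H\<close>, because on Fock space it is a sum over
  the support of the first argument.\<close>
locale unitary_module = level_one_module scl act
  for scl :: "complex \<Rightarrow> 'v::ab_group_add \<Rightarrow> 'v" and act +
  fixes form :: "'v \<Rightarrow> 'v \<Rightarrow> complex" and H :: "'v set"
  assumes H: "submodule scl act H"
    and form_add_left: "x \<in> H \<Longrightarrow> y \<in> H \<Longrightarrow> form (x + y) z = form x z + form y z"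
    and form_scale_left: "x \<in> H \<Longrightarrow> form (scl c x) z = cnj c * form x z"
    and form_add_right: "form x (y + z) = form x y + form x z"
    and form_scale_right: "form x (scl c y) = c * form x y"
    and form_adjoint_xp: "x \<in> H \<Longrightarrow> form (act (loop x_pos m) x) y = form x (act (loop x_neg (-m)) y)"
    and form_adjoint_xm: "x \<in> H \<Longrightarrow> form (act (loop x_neg m) x) y = form x (act (loop x_pos (-m)) y)"
    and form_definite: "x \<in> H \<Longrightarrow> form x x = 0 \<Longrightarrow> x = 0"

text \<open>Once the submodule \<open>N\<close> generated by \<open>(u, v)\<close> meets both
  coordinate axes only in 0, it is the graph of an injective partial map; since it contains the pair
  of values of \<open>p\<close>, these values vanish together.\<close>

lemma U_act_eq_0_transfer:
  assumes F: "unitary_module sF aF form H"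
    and L: "level_one_module sL aL" "irreducible_module sL aL"
    and u: "level_one_module.highest_weight sF aF l u" "u \<in> H"
    and v: "level_one_module.highest_weight sL aL l v"
  shows "U_act sL aL p v = 0 \<longleftrightarrow> U_act sF aF p u = 0"
proof -
  interpret F: unitary_module sF aF form H by fact
  interpret L: level_one_module sL aL by fact
  define sP where "sP = (\<lambda>c p. (sF c (fst p), sL c (snd p)))"
  define aP where "aP = (\<lambda>x p. (aF x (fst p), aL x (snd p)))"
  interpret P: level_one_module sP aP
    unfolding sP_def aP_def by (rule level_one_module_prod) unfold_locales
  have aP: "aP x (f, g) = (aF x f, aL x g)" and sP: "sP c (f, g) = (sF c f, sL c g)" for x f g c
    by (simp_all add: aP_def sP_def)
  have u': "u \<noteq> 0" "aF (loop x_pos 0) u = 0" "aF (loop h_cartan 0) u = sF l u"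
      "aF (loop x_neg 1) u = 0"
    and v': "v \<noteq> 0" "aL (loop x_pos 0) v = 0" "aL (loop h_cartan 0) v = sL l v"
      "aL (loop x_neg 1) v = 0"
    using u v unfolding F.highest_weight_def L.highest_weight_def by auto
  define N where "N = P.span (range (\<lambda>bs. P.word_act bs (u, v)))"
  have N: "submodule sP aP N"
    unfolding N_def by (rule P.submodule_words[where l = l]) (simp_all add: aP sP u' v' zero_prod_def)
  have N_sub: "P.subspace N" using N by (simp add: submodule_def)
  have N_act: "aP x w \<in> N" if "w \<in> N" for x w
    using N that unfolding submodule_def by blast
  have N_ops: "(x + y, x' + y') \<in> N" "(sF c x, sL c x') \<in> N" "(aF z x, aL z x') \<in> N"
    if "(x, x') \<in> N" "(y, y') \<in> N" for x x' y y' c z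
    using that P.subspace_add[OF N_sub that] P.subspace_scale[OF N_sub that(1), where c = c] N_act[OF that(1), of z]
    by (simp_all add: sP aP)
  have wP: "P.word_act bs (u, v) = (F.word_act bs u, L.word_act bs v)" for bs
    by (induction bs) (simp_all add: aP)
  have H_act: "aF x z \<in> H" if "z \<in> H" for x z
    using F.H that unfolding submodule_def by blast
  have FH: "F.word_act bs u \<in> H" for bs
    by (induction bs) (simp_all add: u H_act)
  have form0: "form x 0 = 0" for x using F.form_scale_right[of x 0 0] by simp
  have form0l: "form 0 x = 0" for x using F.form_scale_left[OF u(2), of 0 x] by simp
  \<comment> \<open>The lowering generators are adjoint to \<open>xp 0\<close> and
    \<open>xm 1\<close>, which kill \<open>u\<close>; hence \<open>u\<close> is orthogonal to every
    nonempty word.\<close>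
  have vac0: "form u (aF (loop x_neg 0) x) = 0" "form u (aF (loop x_pos (-1)) x) = 0" for x
    using F.form_adjoint_xp[OF u(2), of 0 x] F.form_adjoint_xm[OF u(2), of 1 x] u' by (simp_all add: form0l)
  have vacw: "form u (F.word_act bs u) = 0" if "bs \<noteq> []" for bs
    using that by (cases bs) (auto simp: vac0)
  have uu: "form u u \<noteq> 0" using F.form_definite[OF u(2)] u' by auto
  \<comment> \<open>The coefficient \<open>c\<close> of the highest weight vectors is common to both
    components. In the first it is read off by pairing with \<open>u\<close>, in the second it is
    determined because \<open>v\<close> is outside the span of the nonempty words; this ties the two
    sides together.\<close>
  have decomp: "\<exists>c z z'. x = sF c u + z \<and> x' = sL c v + z' \<and> form u z = 0
      \<and> z' \<in> L.span {L.word_act bs v |bs. bs \<noteq> []}" if "(x, x') \<in> N" for x x'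
  proof -
    have "\<exists>c z z'. fst y = sF c u + z \<and> snd y = sL c v + z' \<and> form u z = 0
      \<and> z' \<in> L.span {L.word_act bs v |bs. bs \<noteq> []}" if "y \<in> N" for y
      using that unfolding N_def
    proof (induction rule: P.span_induct_alt)
      case base then show ?case
        by (intro exI[of _ 0]) (simp add: form0 L.span_zero)
    next
      case (step c x y)
      from step(2) obtain d z z' where y: "fst y = sF d u + z" "snd y = sL d v + z'" "form u z = 0"
        "z' \<in> L.span {L.word_act bs v |bs. bs \<noteq> []}" by blast
      from step(1) obtain bs where x: "x = (F.word_act bs u, L.word_act bs v)" by (auto simp: wP)
      show ?case
      proof (cases "bs = []")
        case True
        then show ?thesis using x y
          by (intro exI[of _ "c + d"] exI[of _ z] exI[of _ z'])
            (simp add: sP F.scale_left_distrib L.scale_left_distrib add.assoc)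
      next
        case False
        have "sL c (L.word_act bs v) + z' \<in> L.span {L.word_act bs v |bs. bs \<noteq> []}"
          using False y by (intro L.span_add L.span_scale) (auto intro: L.span_base)
        then show ?thesis using x y False
          by (intro exI[of _ d] exI[of _ "sF c (F.word_act bs u) + z"] exI[of _ "sL c (L.word_act bs v) + z'"])
            (simp add: sP F.form_add_right F.form_scale_right vacw)
      qed
    qed
    from this[OF that] show ?thesis by simp
  qed
  have v_notin: "v \<notin> L.span {L.word_act bs v |bs. bs \<noteq> []}"
    by (rule L.highest_weight_notin_span_words[OF v])
  have "P.word_act [] (u, v) \<in> N" unfolding N_def by (rule P.span_base, rule rangeI)
  then have Nu: "(u, v) \<in> N" by simp
  have UN: "(U_act sF aF p u, U_act sL aL p v) \<in> N"
    using P.U_act_submodule[OF N Nu, of p] unfolding sP_def aP_def U_act_prod .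
  have left: "x' = 0" if "(0, x') \<in> N" for x'
  proof -
    have "submodule sL aL {x'. (0, x') \<in> N}"
      unfolding submodule_def
    proof (intro conjI allI ballI)
      show "L.subspace {x'. (0, x') \<in> N}"
        using N_ops[of 0 _ 0] P.subspace_0[OF N_sub] by (intro L.subspaceI) (auto simp: zero_prod_def)
      show "aL x w \<in> {x'. (0, x') \<in> N}" if "w \<in> {x'. (0, x') \<in> N}" for x w
        using N_ops(3)[of 0 w 0 w x] that by (simp add: F.act_zero_right)
    qed
    then have "{x'. (0, x') \<in> N} = {0} \<or> {x'. (0, x') \<in> N} = UNIV"
      using L(2) unfolding irreducible_module_def by blast
    moreover have "(0, v) \<notin> N"
    proof
      assume "(0, v) \<in> N"
      then obtain c z z' where z: "0 = sF c u + z" "v = sL c v + z'" "form u z = 0"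
        "z' \<in> L.span {L.word_act bs v |bs. bs \<noteq> []}" using decomp by blast
      have "form u (sF c u + z) = 0" using z(1) form0 by metis
      then have "c = 0" using z(3) uu by (simp add: F.form_add_right F.form_scale_right)
      then show False using z v_notin by simp
    qed
    ultimately show ?thesis using that by blast
  qed
  have right: "x = 0" if "(x, 0) \<in> N" for x
  proof -
    have K: "form u k = 0" if kN: "(k, 0) \<in> N" for k
    proof -
      obtain c z z' where z: "k = sF c u + z" "0 = sL c v + z'" "form u z = 0"
        "z' \<in> L.span {L.word_act bs v |bs. bs \<noteq> []}" using decomp[OF kN] by blast
      have "c = 0"
      proof (rule ccontr)
        assume "c \<noteq> 0"
        then have "v = sL (- inverse c) (- sL c v)" by simp
        also have "- sL c v = z'" using z(2) by (metis minus_unique)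
        finally have veq: "v = sL (- inverse c) z'" .
        have "sL (- inverse c) z' \<in> L.span {L.word_act bs v |bs. bs \<noteq> []}" by (rule L.span_scale[OF z(4)])
        then show False unfolding veq[symmetric] using v_notin by blast
      qed
      then show ?thesis using z by (simp add: F.form_add_right F.form_scale_right)
    qed
    \<comment> \<open>Adjunction moves the word onto \<open>k\<close>, and pairs
      \<open>(k, 0)\<close> stay in \<open>N\<close> under the action. Since the first components of
      \<open>N\<close> are combinations of words, such a \<open>k\<close> is orthogonal to all of
      them, itself included.\<close>
    have wK: "form (F.word_act bs u) k = 0" if "(k, 0) \<in> N" for bs k
      using that
    proof (induction bs arbitrary: k)
      case Nil then show ?case by (simp add: K)
    next
      case (Cons b bs)
      have "(aF y k, 0) \<in> N" for y using N_ops(3)[OF Cons.prems Cons.prems] by (simp add: L.act_zero_right)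
      then show ?case
        by (auto simp: F.form_adjoint_xp F.form_adjoint_xm FH Cons.IH)
    qed
    have "fst y \<in> H \<and> (\<forall>k. (k, 0) \<in> N \<longrightarrow> form (fst y) k = 0)" if "y \<in> N" for y
      using that unfolding N_def
    proof (induction rule: P.span_induct_alt)
      case base
      then show ?case using F.H F.subspace_0 by (auto simp: submodule_def form0l)
    next
      case (step c x y)
      from step(1) obtain bs where x: "x = (F.word_act bs u, L.word_act bs v)" by (auto simp: wP)
      have "F.subspace H" using F.H by (simp add: submodule_def)
      then have "sF c (F.word_act bs u) \<in> H" "sF c (F.word_act bs u) + fst y \<in> H"
        using FH[of bs] step(2) by (auto intro: F.subspace_add F.subspace_scale)
      then show ?case using step(2) wK FH[of bs]
        by (simp add: x sP F.form_add_left F.form_scale_left flip: N_def)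
    qed
    from this[OF that] that show ?thesis using F.form_definite by auto
  qed
  show ?thesis using UN left right by metis
qed

text \<open>The highest weight condition fixes the central action on \<open>v\<close> only. The
  fixed space of the central element is a submodule, as this element commutes with everything, and
  it contains \<open>v\<close>; irreducibility makes it the whole space.\<close>

lemma irreducible_highest_weight_module_level_one:
  assumes "irreducible_highest_weight_module scl act (l, 1) v"
  shows "level_one_module scl act" "irreducible_module scl act"
    "level_one_module.highest_weight scl act l v"
proof -
  show irr: "irreducible_module scl act"
    using assms by (simp add: irreducible_highest_weight_module_def)
  interpret affine_module scl act using irr by (simp add: irreducible_module_def)
  have v: "v \<noteq> 0" "act (loop h_cartan 0) v = scl l v" "act central v = v"
    and pos: "\<And>x. x \<in> affine_pos \<Longrightarrow> act x v = 0"
    using assms by (auto simp: irreducible_highest_weight_module_def highest_weight_vector_def)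
  have "submodule scl act {w. act central w = w}"
  proof -
    have "act central (act x w) = act x w" if "act central w = w" for x w
      using act_bracket[of central x w] that by (simp add: affine_bracket_central act_zero_left)
    then show ?thesis
      by (auto simp: submodule_def act_zero_right act_add_right act_scale_right intro!: subspaceI)
  qed
  then have "act central w = w" for w
    using irr v unfolding irreducible_module_def by blast
  then show L: "level_one_module scl act" by unfold_locales
  interpret level_one_module scl act by fact
  have pos': "loop a m \<in> affine_pos" if "m > 0" for a m
  proof -
    have "(0::sl2) = sl2_scale 0 x_pos" by transfer (simp add: vec_eq_iff)
    then show ?thesis using that
      by (auto simp: affine_pos_def loop_def lookup_single when_def intro!: exI[of _ 0])
  qed
  have "x_pos = sl2_scale 1 x_pos" by transfer (simp add: vec_eq_iff)
  then have "loop x_pos 0 \<in> affine_pos"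
    by (auto simp: affine_pos_def loop_def lookup_single when_def)
  then show "highest_weight l v"
    using v pos pos' by (simp add: highest_weight_def)
qed

section \<open>Fermionic Fock space\<close>

type_synonym mode = "2 \<times> int"

text \<open>A basis state is encoded by the finite set of modes at which its occupied set differs from
  the Dirac sea of all modes with nonnegative index.\<close>
type_synonym fock = "mode fset \<Rightarrow> complex"

text \<open>The two colors are interleaved into one linear order of the modes, along which
  Jordan-Wigner signs are counted.\<close>

definition mode_code :: "mode \<Rightarrow> int" where
  "mode_code p = 2 * snd p + (if fst p = 1 then 0 else 1)"

lemma mode_code_eq_iff [simp]: "mode_code p = mode_code q \<longleftrightarrow> p = q"
proof
  assume "mode_code p = mode_code q"
  moreover have "fst p = 1 \<or> fst p = 2" "fst q = 1 \<or> fst q = 2" using exhaust_2 by auto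
  ultimately show "p = q"
    unfolding mode_code_def prod_eq_iff by (auto split: if_splits) presburger+
qed simp

definition occupied :: "mode fset \<Rightarrow> mode \<Rightarrow> bool" where
  "occupied D p \<longleftrightarrow> (p |\<in>| D) \<noteq> (0 \<le> snd p)"

definition flip :: "mode \<Rightarrow> mode fset \<Rightarrow> mode fset" where
  "flip p D = (if p |\<in>| D then D |-| {|p|} else finsert p D)"

text \<open>The count runs over modes that differ from the sea of nonnegative modes. Counting
  occupied modes below \<open>p\<close> instead would change the sign by a factor depending on
  \<open>p\<close> only, to which the anticommutation relations are insensitive.\<close>

definition jw_sign :: "mode \<Rightarrow> mode fset \<Rightarrow> complex" where
  "jw_sign p D = (-1) ^ card {q \<in> fset D. mode_code q < mode_code p}"

lemma mem_flip: "q |\<in>| flip p D \<longleftrightarrow> (q |\<in>| D) \<noteq> (q = p)"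
  by (auto simp: flip_def)

lemma flip_flip [simp]: "flip p (flip p D) = D"
  by (rule fset_eqI) (auto simp: mem_flip)

lemma flip_commute: "flip p (flip q D) = flip q (flip p D)"
  by (rule fset_eqI) (auto simp: mem_flip)

lemma occupied_flip: "occupied (flip p D) q \<longleftrightarrow> occupied D q \<noteq> (q = p)"
  by (auto simp: occupied_def mem_flip)

lemma jw_sign_square [simp]: "jw_sign p D * jw_sign p D = 1"
  by (simp add: jw_sign_def power_mult_distrib[symmetric])

lemma jw_sign_nonzero [simp]: "jw_sign p D \<noteq> 0"
  by (simp add: jw_sign_def)

lemma jw_sign_flip: "jw_sign p (flip q D) = (if mode_code q < mode_code p then - jw_sign p D else jw_sign p D)"
proof (cases "mode_code q < mode_code p")
  case False
  then have "{r \<in> fset (flip q D). mode_code r < mode_code p} = {r \<in> fset D. mode_code r < mode_code p}"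
    by (auto simp: mem_flip)
  then show ?thesis using False by (simp add: jw_sign_def)
next
  case True
  define S where "S = {r \<in> fset D. mode_code r < mode_code p \<and> r \<noteq> q}"
  have fS: "finite S" "q \<notin> S" by (auto simp: S_def)
  have "{r \<in> fset (flip q D). mode_code r < mode_code p} = (if q |\<in>| D then S else insert q S)"
    "{r \<in> fset D. mode_code r < mode_code p} = (if q |\<in>| D then insert q S else S)"
    using True by (auto simp: mem_flip S_def)
  then show ?thesis using True fS by (simp add: jw_sign_def)
qed

text \<open>A state is a coefficient function, so the operator is a pullback: the coefficient at
  \<open>D\<close> is taken from the state before \<open>p\<close> was filled. Hence
  \<open>p\<close> has to be occupied in \<open>D\<close>, and empty in the case of
  \<open>ann\<close>.\<close>

definition cre :: "mode \<Rightarrow> fock \<Rightarrow> fock" where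
  "cre p f = (\<lambda>D. if occupied D p then jw_sign p D * f (flip p D) else 0)"

definition ann :: "mode \<Rightarrow> fock \<Rightarrow> fock" where
  "ann p f = (\<lambda>D. if occupied D p then 0 else jw_sign p D * f (flip p D))"

lemma cre_linear: "cre p (f + g) = cre p f + cre p g" "cre p (f - g) = cre p f - cre p g"
  "cre p (- f) = - cre p f" "cre p 0 = 0"
  by (auto simp: cre_def fun_eq_iff algebra_simps)

lemma ann_linear: "ann p (f + g) = ann p f + ann p g" "ann p (f - g) = ann p f - ann p g"
  "ann p (- f) = - ann p f" "ann p 0 = 0"
  by (auto simp: ann_def fun_eq_iff algebra_simps)

lemma code_neq: "p \<noteq> q \<Longrightarrow> mode_code p < mode_code q \<longleftrightarrow> \<not> mode_code q < mode_code p"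
  by (metis linorder_neq_iff mode_code_eq_iff order_less_asym)

lemma cre_cre: "cre p (cre q f) = - cre q (cre p f)"
proof (cases "p = q")
  case True
  then have "cre p (cre q f) = 0" by (auto simp: cre_def occupied_flip fun_eq_iff)
  then show ?thesis using True by simp
next
  case False
  then show ?thesis using code_neq[OF False]
    by (auto simp: cre_def fun_eq_iff occupied_flip jw_sign_flip flip_commute[of p q])
qed

lemma ann_ann: "ann p (ann q f) = - ann q (ann p f)"
proof (cases "p = q")
  case True
  then have "ann p (ann q f) = 0" by (auto simp: ann_def occupied_flip fun_eq_iff)
  then show ?thesis using True by simp
next
  case False
  then show ?thesis using code_neq[OF False]
    by (auto simp: ann_def fun_eq_iff occupied_flip jw_sign_flip flip_commute[of p q])
qed

lemma ann_cre: "ann p (cre q f) = (if p = q then f else 0) - cre q (ann p f)"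
proof (cases "p = q")
  case True
  then show ?thesis
    by (auto simp: ann_def cre_def occupied_flip fun_eq_iff jw_sign_flip mult.assoc[symmetric])
next
  case False
  then show ?thesis using code_neq[OF False]
    by (auto simp: ann_def cre_def fun_eq_iff occupied_flip jw_sign_flip flip_commute[of p q])
qed

definition bil :: "mode \<Rightarrow> mode \<Rightarrow> fock \<Rightarrow> fock" where
  "bil p q f = cre p (ann q f)"

text \<open>These operators behave like the matrix units of gl_infinity. In
  \<open>bil p q (bil r s f)\<close> the term with two creations and two annihilations is symmetric
  under exchange of the pairs, because two signs cancel, and drops out of the commutator.\<close>

lemma bil_commutator:
  "bil p q (bil r s f) - bil r s (bil p q f) = (if q = r then bil p s f else 0) - (if p = s then bil r q f else 0)"
proof -
  have 1: "bil p q (bil r s f) = (if q = r then bil p s f else 0) - cre p (cre r (ann q (ann s f)))"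
    for p q r s
    by (simp add: bil_def ann_cre cre_linear)
  have "cre p (cre r (ann q (ann s f))) = cre r (cre p (ann s (ann q f)))"
    by (subst cre_cre, subst ann_ann) (simp add: cre_linear)
  then show ?thesis using 1[of p q r s] 1[of r s p q] by (auto simp: eq_commute)
qed

lemma bil_linear: "bil p q (f + g) = bil p q f + bil p q g" "bil p q (f - g) = bil p q f - bil p q g"
  by (simp_all add: bil_def cre_linear ann_linear)

lemma bil_scale: "bil p q (\<lambda>D. c * f D) = (\<lambda>D. c * bil p q f D)"
  by (auto simp: bil_def cre_def ann_def)

lemma bil_sum: "bil p q (\<lambda>D. \<Sum>i\<in>A. g i D) = (\<lambda>D. \<Sum>i\<in>A. bil p q (g i) D)"
  by (simp add: bil_def cre_def ann_def fun_eq_iff sum_distrib_left)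

lemma bil_eq:
  "bil p q f D = (if p = q then (if occupied D p then f D else 0)
     else if occupied D p \<and> \<not> occupied D q then jw_sign p D * jw_sign q (flip p D) * f (flip q (flip p D)) else 0)"
  by (auto simp: bil_def cre_def ann_def occupied_flip jw_sign_flip mult.assoc[symmetric])

text \<open>Normal ordering with respect to the Dirac sea.\<close>
definition nbil :: "mode \<Rightarrow> mode \<Rightarrow> fock \<Rightarrow> fock" where
  "nbil p q f D = bil p q f D - (if p = q \<and> 0 \<le> snd p then f D else 0)"

text \<open>Pairs outside this relation contribute nothing at \<open>D\<close>; on the diagonal,
  normal ordering leaves only the modes that differ from the sea.\<close>

definition active :: "mode fset \<Rightarrow> mode \<Rightarrow> mode \<Rightarrow> bool" where
  "active D p q \<longleftrightarrow> (if p = q then p |\<in>| D else occupied D p \<and> \<not> occupied D q)"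

lemma nbil_inactive: "\<not> active D p q \<Longrightarrow> nbil p q f D = 0"
  by (auto simp: active_def nbil_def bil_eq occupied_def)

lemma nbil_cong: "f D = g D \<Longrightarrow> f (flip q (flip p D)) = g (flip q (flip p D)) \<Longrightarrow> nbil p q f D = nbil p q g D"
  by (simp add: nbil_def bil_eq)

definition window :: "int \<Rightarrow> mode set" where
  "window n = {p. \<bar>snd p\<bar> \<le> n}"

lemma window_eq: "window n = UNIV \<times> {-n..n}"
  by (auto simp: window_def)

lemma finite_window [simp]: "finite (window n)"
  by (simp add: window_eq)

lemma window_mono: "m \<le> n \<Longrightarrow> window m \<subseteq> window n"
  by (auto simp: window_def)

text \<open>Beyond the range of \<open>D\<close> the occupied modes are those of the sea, all filled
  above and all empty below. Two modes that far out and at bounded distance lie on the same side, so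
  no transition between them is possible.\<close>

lemma active_window:
  "\<exists>n. \<forall>p q. \<bar>snd p - snd q\<bar> \<le> b \<longrightarrow> active D p q \<longrightarrow> p \<in> window n \<and> q \<in> window n"
proof -
  have "finite (snd ` fset D)" by simp
  then obtain m where m: "\<forall>i\<in>snd ` fset D. \<bar>i\<bar> \<le> m"
    by (metis finite_imageI bdd_above_finite[of "abs ` snd ` fset D"] bdd_above_def imageI)
  have "p \<in> window (\<bar>m\<bar> + 2 * \<bar>b\<bar>) \<and> q \<in> window (\<bar>m\<bar> + 2 * \<bar>b\<bar>)"
    if "\<bar>snd p - snd q\<bar> \<le> b" "active D p q" for p q
  proof -
    have mem: "r |\<in>| D \<Longrightarrow> \<bar>snd r\<bar> \<le> \<bar>m\<bar>" for r using m by fastforce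
    have "\<not> active D p q" if "\<bar>snd p\<bar> > \<bar>m\<bar> + \<bar>b\<bar>"
      using mem[of p] mem[of q] that \<open>\<bar>snd p - snd q\<bar> \<le> b\<close>
      by (auto simp: active_def occupied_def)
    then have "\<bar>snd p\<bar> \<le> \<bar>m\<bar> + \<bar>b\<bar>" using that(2) by linarith
    then show ?thesis using that(1) unfolding window_def mem_Collect_eq by linarith
  qed
  then show ?thesis by blast
qed

section \<open>Normal ordered quadratic operators\<close>

type_synonym mode_matrix = "mode \<Rightarrow> mode \<Rightarrow> complex"

definition band :: "int \<Rightarrow> mode_matrix \<Rightarrow> bool" where
  "band b M \<longleftrightarrow> (\<forall>p q. M p q \<noteq> 0 \<longrightarrow> \<bar>snd p - snd q\<bar> \<le> b)"

definition wquad :: "int \<Rightarrow> mode_matrix \<Rightarrow> fock \<Rightarrow> fock" where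
  "wquad n M f D = (\<Sum>p\<in>window n. \<Sum>q\<in>window n. M p q * nbil p q f D)"

text \<open>For a banded matrix the index set is finite by \<open>active_window\<close>, so the
  infinite sum has a value at each \<open>D\<close>, whatever the function \<open>f\<close>. The
  window from which on \<open>wquad\<close> agrees with it depends on \<open>D\<close>.\<close>

definition quad :: "mode_matrix \<Rightarrow> fock \<Rightarrow> fock" where
  "quad M f D = (\<Sum>(p, q)\<in>{(p, q). M p q \<noteq> 0 \<and> active D p q}. M p q * nbil p q f D)"

lemma quad_eq_sum:
  assumes "finite A" "{(p, q). M p q \<noteq> 0 \<and> active D p q} \<subseteq> A"
  shows "quad M f D = (\<Sum>(p, q)\<in>A. M p q * nbil p q f D)"
  unfolding quad_def
proof (rule sum.mono_neutral_left)
  show "\<forall>z\<in>A - {(p, q). M p q \<noteq> 0 \<and> active D p q}. (case z of (p, q) \<Rightarrow> M p q * nbil p q f D) = 0"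
    using nbil_inactive by (auto simp: case_prod_unfold) blast
qed (use assms in auto)

lemma quad_window:
  assumes "band b M"
  shows "\<exists>m. \<forall>n\<ge>m. \<forall>f. quad M f D = wquad n M f D"
proof -
  obtain m where m: "\<And>p q. \<bar>snd p - snd q\<bar> \<le> b \<Longrightarrow> active D p q \<Longrightarrow> p \<in> window m \<and> q \<in> window m"
    using active_window by blast
  have "quad M f D = wquad n M f D" if "n \<ge> m" for n f
  proof -
    have "quad M f D = (\<Sum>(p, q)\<in>window n \<times> window n. M p q * nbil p q f D)"
    proof (rule quad_eq_sum)
      show "{(p, q). M p q \<noteq> 0 \<and> active D p q} \<subseteq> window n \<times> window n"
        using m assms window_mono[OF that] unfolding band_def by blast
    qed simp
    then show ?thesis by (simp add: wquad_def sum.cartesian_product)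
  qed
  then show ?thesis by blast
qed

lemma wquad_cong:
  assumes "g D = h D" "\<And>p q. p \<in> window n \<Longrightarrow> q \<in> window n \<Longrightarrow> g (flip q (flip p D)) = h (flip q (flip p D))"
  shows "wquad n M g D = wquad n M h D"
  unfolding wquad_def by (intro sum.cong refl arg_cong2[of _ _ _ _ "(*)"] nbil_cong) (use assms in auto)

lemma uniform_bound:
  fixes P :: "'a \<Rightarrow> int \<Rightarrow> bool"
  assumes "finite A" "\<And>x. x \<in> A \<Longrightarrow> \<exists>m. \<forall>n\<ge>m. P x n"
  shows "\<exists>m. \<forall>n\<ge>m. \<forall>x\<in>A. P x n"
  using assms
proof (induction A rule: finite_induct)
  case (insert x A)
  from insert.prems[of x] obtain m where "\<forall>n\<ge>m. P x n" by auto
  moreover obtain m' where "\<forall>n\<ge>m'. \<forall>x\<in>A. P x n" using insert by auto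
  ultimately show ?case by (intro exI[of _ "max m m'"]) auto
qed auto

text \<open>The outer operator reads the inner function at finitely many states, so one window
  serves the inner operator at all of them.\<close>

lemma quad_quad_window:
  assumes "band b M" "band b' M'"
  shows "\<exists>m. \<forall>n\<ge>m. \<forall>f. quad M (quad M' f) D = wquad n M (wquad n M' f) D"
proof -
  obtain m where m: "\<forall>n\<ge>m. \<forall>f. quad M f D = wquad n M f D" using quad_window[OF assms(1)] by blast
  define R where "R = insert D ((\<lambda>(p, q). flip q (flip p D)) ` (window m \<times> window m))"
  have "finite R" by (simp add: R_def)
  then obtain m' where m': "\<forall>n\<ge>m'. \<forall>D\<in>R. \<forall>f. quad M' f D = wquad n M' f D"
    using uniform_bound[of R "\<lambda>D n. \<forall>f. quad M' f D = wquad n M' f D"] quad_window[OF assms(2)] by blast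
  have "quad M (quad M' f) D = wquad n M (wquad n M' f) D" if "n \<ge> max m m'" for n f
  proof -
    have "quad M (quad M' f) D = wquad m M (quad M' f) D" using m by simp
    also have "\<dots> = wquad m M (wquad n M' f) D"
      by (rule wquad_cong) (use m' that in \<open>auto simp: R_def\<close>)
    also have "\<dots> = wquad n M (wquad n M' f) D" using m that by (metis max.boundedE order_refl)
    finally show ?thesis .
  qed
  then show ?thesis by blast
qed

definition wbil :: "int \<Rightarrow> mode_matrix \<Rightarrow> fock \<Rightarrow> fock" where
  "wbil n M f D = (\<Sum>x\<in>window n \<times> window n. M (fst x) (snd x) * bil (fst x) (snd x) f D)"

definition wtrace :: "int \<Rightarrow> mode_matrix \<Rightarrow> complex" where
  "wtrace n M = (\<Sum>p\<in>{p\<in>window n. 0 \<le> snd p}. M p p)"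

text \<open>Inside a finite window normal ordering subtracts a scalar and so does not affect
  commutators; the central term arises only when the commutator itself is normal ordered
  again.\<close>

lemma wquad_eq: "wquad n M f = (\<lambda>D. wbil n M f D - wtrace n M * f D)"
proof
  fix D
  have "wquad n M f D = wbil n M f D - (\<Sum>p\<in>window n. \<Sum>q\<in>window n. M p q * (if p = q \<and> 0 \<le> snd p then f D else 0))"
    unfolding wquad_def wbil_def nbil_def
    by (simp add: sum.cartesian_product case_prod_unfold sum_subtractf right_diff_distrib)
  also have "(\<Sum>p\<in>window n. \<Sum>q\<in>window n. M p q * (if p = q \<and> 0 \<le> snd p then f D else 0))
     = (\<Sum>p\<in>window n. if 0 \<le> snd p then M p p * f D else 0)"
  proof (rule sum.cong)
    fix p assume "p \<in> window n"
    have "(\<Sum>q\<in>window n. M p q * (if p = q \<and> 0 \<le> snd p then f D else 0))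
      = (\<Sum>q\<in>window n. if p = q then (if 0 \<le> snd p then M p p * f D else 0) else 0)"
      by (intro sum.cong) auto
    also have "\<dots> = (if 0 \<le> snd p then M p p * f D else 0)"
      using \<open>p \<in> window n\<close> by (simp add: sum.delta)
    finally show "(\<Sum>q\<in>window n. M p q * (if p = q \<and> 0 \<le> snd p then f D else 0))
      = (if 0 \<le> snd p then M p p * f D else 0)" .
  qed simp
  also have "\<dots> = wtrace n M * f D"
    unfolding wtrace_def sum_distrib_right by (rule sum.inter_filter[symmetric]) simp
  finally show "wquad n M f D = wbil n M f D - wtrace n M * f D" .
qed

lemma wbil_diff_scale: "wbil n M (\<lambda>D. f D - c * g D) D = wbil n M f D - c * wbil n M g D"
proof -
  have "bil p q (\<lambda>D. f D - c * g D) D = bil p q f D - c * bil p q g D" for p q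
    by (simp add: bil_eq right_diff_distrib)
  then show ?thesis
    by (simp add: wbil_def sum_subtractf right_diff_distrib sum_distrib_left mult.left_commute)
qed

lemma bil_wbil: "bil p q (wbil n M f) D = (\<Sum>x\<in>window n \<times> window n. M (fst x) (snd x) * bil p q (bil (fst x) (snd x) f) D)"
proof -
  have "wbil n M f = (\<lambda>D. \<Sum>x\<in>window n \<times> window n. (\<lambda>D. M (fst x) (snd x) * bil (fst x) (snd x) f D) D)"
    by (simp add: wbil_def fun_eq_iff)
  then show ?thesis by (simp only: bil_sum bil_scale)
qed

lemma wbil_commutator:
  "wbil n M (wbil n M' f) D - wbil n M' (wbil n M f) D
    = wbil n (\<lambda>p s. \<Sum>q\<in>window n. M p q * M' q s - M' p q * M q s) f D"
proof -
  let ?W = "window n"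
  let ?P = "\<lambda>M M'. \<lambda>p s. \<Sum>q\<in>?W. M p q * M' q s"
  have prod: "(\<Sum>x\<in>?W \<times> ?W. \<Sum>y\<in>?W \<times> ?W. M (fst x) (snd x) * (M' (fst y) (snd y) * (if snd x = fst y then bil (fst x) (snd y) f D else 0)))
      = wbil n (?P M M') f D" for M M'
  proof -
    have "(\<Sum>y\<in>?W \<times> ?W. M p q * (M' (fst y) (snd y) * (if q = fst y then bil p (snd y) f D else 0)))
       = (\<Sum>s\<in>?W. M p q * (M' q s * bil p s f D))" if "q \<in> ?W" for p q
    proof -
      have "(\<Sum>y\<in>?W \<times> ?W. M p q * (M' (fst y) (snd y) * (if q = fst y then bil p (snd y) f D else 0)))
        = (\<Sum>r\<in>?W. \<Sum>s\<in>?W. M p q * (M' r s * (if q = r then bil p s f D else 0)))"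
        by (simp add: sum.cartesian_product case_prod_unfold)
      also have "\<dots> = (\<Sum>r\<in>?W. if q = r then (\<Sum>s\<in>?W. M p q * (M' q s * bil p s f D)) else 0)"
        by (intro sum.cong) auto
      finally show ?thesis using that by (simp add: sum.delta)
    qed
    then have "(\<Sum>x\<in>?W \<times> ?W. \<Sum>y\<in>?W \<times> ?W. M (fst x) (snd x) * (M' (fst y) (snd y) * (if snd x = fst y then bil (fst x) (snd y) f D else 0)))
      = (\<Sum>x\<in>?W \<times> ?W. \<Sum>s\<in>?W. M (fst x) (snd x) * (M' (snd x) s * bil (fst x) s f D))"
      by (intro sum.cong refl) (simp only: mem_Times_iff)
    also have "\<dots> = (\<Sum>p\<in>?W. \<Sum>q\<in>?W. \<Sum>s\<in>?W. M p q * (M' q s * bil p s f D))"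
      using sum.cartesian_product[of "\<lambda>p q. \<Sum>s\<in>?W. M p q * (M' q s * bil p s f D)" ?W ?W]
      by (simp only: case_prod_unfold)
    also have "\<dots> = (\<Sum>p\<in>?W. \<Sum>s\<in>?W. \<Sum>q\<in>?W. M p q * (M' q s * bil p s f D))"
      by (intro sum.cong refl sum.swap)
    also have "\<dots> = wbil n (?P M M') f D"
      using sum.cartesian_product[of "\<lambda>p s. \<Sum>q\<in>?W. M p q * (M' q s * bil p s f D)" ?W ?W]
      by (simp only: wbil_def sum_distrib_right mult.assoc case_prod_unfold)
    finally show ?thesis .
  qed
  have prod2: "(\<Sum>x\<in>?W \<times> ?W. \<Sum>y\<in>?W \<times> ?W. M (fst x) (snd x) * (M' (fst y) (snd y) * (if snd y = fst x then bil (fst y) (snd x) f D else 0)))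
      = wbil n (?P M' M) f D"
    unfolding prod[of M' M, symmetric] by (subst sum.swap) (simp only: mult.left_commute)
  have exp: "wbil n M (wbil n M' f) D
      = (\<Sum>x\<in>?W \<times> ?W. \<Sum>y\<in>?W \<times> ?W. M (fst x) (snd x) * (M' (fst y) (snd y) * bil (fst x) (snd x) (bil (fst y) (snd y) f) D))" for M M'
    by (subst wbil_def) (simp add: bil_wbil sum_distrib_left)
  have comm: "bil p q (bil r s f) D - bil r s (bil p q f) D
     = (if q = r then bil p s f D else 0) - (if s = p then bil r q f D else 0)" for p q r s
    using fun_cong[OF bil_commutator[of p q r s f], of D] by auto
  have "wbil n M (wbil n M' f) D - wbil n M' (wbil n M f) D
     = (\<Sum>x\<in>?W \<times> ?W. \<Sum>y\<in>?W \<times> ?W. M (fst x) (snd x) * (M' (fst y) (snd y) *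
         (bil (fst x) (snd x) (bil (fst y) (snd y) f) D - bil (fst y) (snd y) (bil (fst x) (snd x) f) D)))"
    unfolding exp
    by (subst (2) sum.swap) (simp add: sum_subtractf right_diff_distrib mult.left_commute)
  also have "\<dots> = wbil n (?P M M') f D - wbil n (?P M' M) f D"
    unfolding comm by (simp only: right_diff_distrib sum_subtractf prod prod2)
  also have "\<dots> = wbil n (\<lambda>p s. \<Sum>q\<in>window n. M p q * M' q s - M' p q * M q s) f D"
    by (simp add: wbil_def sum_subtractf left_diff_distrib)
  finally show ?thesis .
qed

text \<open>\<open>K\<close> is the matrix commutator, computed in rows far enough from the edge of
  the window, and \<open>c\<close> is the Schwinger term. Normal ordering the commutator costs its
  trace over the nonnegative modes; there the pairs of nonnegative modes cancel, and the pairs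
  crossing the surface of the sea remain.\<close>

lemma quad_commutator:
  assumes b: "band b M" "band b M'" "band b K" and "b \<ge> 0"
    and K: "\<And>p s n. b + \<bar>snd p\<bar> \<le> n \<Longrightarrow> K p s = (\<Sum>q\<in>window n. M p q * M' q s - M' p q * M q s)"
    and c: "\<And>n. n \<ge> b \<Longrightarrow> (\<Sum>p\<in>{p\<in>window n. 0 \<le> snd p}. \<Sum>q\<in>{q\<in>window n. snd q < 0}.
        M p q * M' q p - M' p q * M q p) = c"
  shows "quad M (quad M' f) D - quad M' (quad M f) D = quad K f D + c * f D"
proof -
  obtain m1 where m1: "\<forall>n\<ge>m1. \<forall>f. quad M (quad M' f) D = wquad n M (wquad n M' f) D"
    using quad_quad_window[OF b(1,2)] by blast
  obtain m2 where m2: "\<forall>n\<ge>m2. \<forall>f. quad M' (quad M f) D = wquad n M' (wquad n M f) D"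
    using quad_quad_window[OF b(2,1)] by blast
  obtain m3 where m3: "\<forall>n\<ge>m3. \<forall>f. quad K f D = wquad n K f D"
    using quad_window[OF b(3)] by blast
  obtain m4 where m4: "\<And>p q. \<bar>snd p - snd q\<bar> \<le> 2 * b \<Longrightarrow> active D p q \<Longrightarrow> p \<in> window m4 \<and> q \<in> window m4"
    using active_window by blast
  \<comment> \<open>The bound \<open>m4 + b\<close> keeps the active pairs within the band
    \<open>2 * b\<close> of a product at distance at least \<open>b\<close> from the edge of the
    window, where the truncated matrix product is exact.\<close>
  define n where "n = max (max m1 m2) (max (max m3 b) (m4 + b))"
  have n: "n \<ge> m1" "n \<ge> m2" "n \<ge> m3" "n \<ge> m4 + b" "n \<ge> b" by (auto simp: n_def)
  let ?W = "window n"
  define C where "C = (\<lambda>p s. \<Sum>q\<in>?W. M p q * M' q s - M' p q * M q s)"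
  have "quad M (quad M' f) D - quad M' (quad M f) D
      = wquad n M (wquad n M' f) D - wquad n M' (wquad n M f) D" using n m1 m2 by simp
  also have "\<dots> = wbil n M (wbil n M' f) D - wbil n M' (wbil n M f) D"
    unfolding wquad_eq wbil_diff_scale by (simp add: algebra_simps)
  also have "\<dots> = wbil n C f D" unfolding wbil_commutator C_def ..
  also have "\<dots> = wquad n C f D + wtrace n C * f D" by (simp add: wquad_eq)
  also have "wquad n C f D = wquad n K f D"
    unfolding wquad_def
  proof (intro sum.cong refl)
    fix p s
    show "C p s * nbil p s f D = K p s * nbil p s f D"
    proof (cases "active D p s")
      case False then show ?thesis by (simp add: nbil_inactive)
    next
      case True
      show ?thesis
      proof (cases "\<bar>snd p - snd s\<bar> \<le> 2 * b")
        case True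
        then have "b + \<bar>snd p\<bar> \<le> n" using m4[OF True \<open>active D p s\<close>] n by (auto simp: window_def)
        then show ?thesis using K[of p n s] by (simp add: C_def)
      next
        case False
        then have "K p s = 0" using b(3) \<open>b \<ge> 0\<close> unfolding band_def by (smt (verit))
        moreover have z: "M p q * M' q s = 0" "M' p q * M q s = 0" for q
          using False b(1,2) unfolding band_def mult_eq_0_iff by (smt (verit))+
        have "C p s = 0" unfolding C_def z by simp
        ultimately show ?thesis by simp
      qed
    qed
  qed
  also have "wquad n K f D = quad K f D" using m3 n by simp
  also have "wtrace n C = c"
  proof -
    let ?P = "{p\<in>?W. 0 \<le> snd p}" and ?N = "{q\<in>?W. snd q < 0}"
    have W: "?W = ?P \<union> ?N" by auto
    have "wtrace n C = (\<Sum>p\<in>?P. \<Sum>q\<in>?P. M p q * M' q p - M' p q * M q p) + (\<Sum>p\<in>?P. \<Sum>q\<in>?N. M p q * M' q p - M' p q * M q p)"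
      unfolding wtrace_def C_def sum.distrib[symmetric]
      by (intro sum.cong refl, subst W, rule sum.union_disjoint) auto
    also have "(\<Sum>p\<in>?P. \<Sum>q\<in>?P. M p q * M' q p - M' p q * M q p) = 0"
      unfolding sum_subtractf by (subst sum.swap) (simp add: mult.commute)
    finally show ?thesis using c[OF n(5)] by simp
  qed
  finally show ?thesis .
qed

lemma quad_add:
  assumes "band b M" "band b' M'"
  shows "quad (\<lambda>p q. M p q + M' p q) f D = quad M f D + quad M' f D"
proof -
  have "band (max b b') (\<lambda>p q. M p q + M' p q)"
    using assms unfolding band_def by (smt (verit) add.left_neutral)
  then obtain m where "\<forall>n\<ge>m. \<forall>f. quad (\<lambda>p q. M p q + M' p q) f D = wquad n (\<lambda>p q. M p q + M' p q) f D"
    using quad_window by blast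
  moreover obtain m' where "\<forall>n\<ge>m'. \<forall>f. quad M f D = wquad n M f D" using assms quad_window by blast
  moreover obtain m'' where "\<forall>n\<ge>m''. \<forall>f. quad M' f D = wquad n M' f D" using assms quad_window by blast
  moreover define n where "n = max m (max m' m'')"
  ultimately have "quad (\<lambda>p q. M p q + M' p q) f D = wquad n (\<lambda>p q. M p q + M' p q) f D"
    "quad M f D = wquad n M f D" "quad M' f D = wquad n M' f D" by simp_all
  then show ?thesis by (simp add: wquad_def sum.distrib distrib_right)
qed

lemma quad_scale: 
  assumes "band b M"
  shows "quad (\<lambda>p q. c * M p q) f D = c * quad M f D"
proof (cases "c = 0")
  case True then show ?thesis by (simp add: quad_def)
next
  case False then show ?thesis by (simp add: quad_def sum_distrib_left mult.assoc case_prod_unfold)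
qed

lemma quad_scale_arg: "quad M (\<lambda>D. c * f D) D = c * quad M f D"
proof -
  have "nbil p q (\<lambda>D. c * f D) D = c * nbil p q f D" for p q
    by (auto simp: nbil_def bil_scale right_diff_distrib)
  then show ?thesis by (simp add: quad_def sum_distrib_left case_prod_unfold mult.left_commute)
qed

lemma quad_add_arg: "quad M (f + g) D = quad M f D + quad M g D"
proof -
  have "nbil p q (f + g) D = nbil p q f D + nbil p q g D" for p q
    by (auto simp: nbil_def bil_linear)
  then show ?thesis by (simp add: quad_def sum.distrib case_prod_unfold distrib_left)
qed

section \<open>The affine algebra on Fock space\<close>

text \<open>With the mode (c, j) read as e_c t^j, this is the matrix by which the Laurent part of
  \<open>x\<close> acts on C^2 tensored with C[t, t^-1]: constant along block diagonals, hence
  banded.\<close>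

definition affine_matrix :: "affine \<Rightarrow> mode_matrix" where
  "affine_matrix x p q = mat_of_sl2 (Poly_Mapping.lookup (fst x) (snd p - snd q)) $ fst p $ fst q"

definition fock_scale :: "complex \<Rightarrow> fock \<Rightarrow> fock" where
  "fock_scale c f D = c * f D"

definition fock_act :: "affine \<Rightarrow> fock \<Rightarrow> fock" where
  "fock_act x f D = quad (affine_matrix x) f D + snd x * f D"

lemma affine_matrix_band: "\<exists>b. band b (affine_matrix x)"
proof -
  have "\<bar>snd p - snd q\<bar> \<le> (\<Sum>m\<in>Poly_Mapping.keys (fst x). \<bar>m\<bar>)" if "affine_matrix x p q \<noteq> 0" for p q
  proof -
    have "Poly_Mapping.lookup (fst x) (snd p - snd q) \<noteq> 0"
      using that unfolding affine_matrix_def by (metis zero_index zero_sl2.rep_eq)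
    then show ?thesis by (intro member_le_sum) (auto simp: in_keys_iff)
  qed
  then show ?thesis unfolding band_def by blast
qed

lemma affine_matrix_add: "affine_matrix (x + y) = (\<lambda>p q. affine_matrix x p q + affine_matrix y p q)"
  by (simp add: affine_matrix_def fun_eq_iff lookup_add plus_sl2.rep_eq)

lemma affine_matrix_scale: "affine_matrix (affine_scale c x) = (\<lambda>p q. c * affine_matrix x p q)"
proof -
  have "Poly_Mapping.lookup (Poly_Mapping.map (sl2_scale c) f) m = sl2_scale c (Poly_Mapping.lookup f m)" for f :: "int \<Rightarrow>\<^sub>0 sl2" and m
    by (simp add: Poly_Mapping.map.rep_eq when_def)
  then show ?thesis by (simp add: affine_matrix_def fun_eq_iff affine_scale_def sl2_scale.rep_eq)
qed

lemma fock_act_add_left: "fock_act (x + y) f = fock_act x f + fock_act y f"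
proof -
  obtain b b' where "band b (affine_matrix x)" "band b' (affine_matrix y)" using affine_matrix_band by metis
  then show ?thesis
    by (simp add: fun_eq_iff fock_act_def affine_matrix_add quad_add algebra_simps)
qed

lemma fock_act_scale_left: "fock_act (affine_scale c x) f = fock_scale c (fock_act x f)"
proof -
  obtain b where "band b (affine_matrix x)" using affine_matrix_band by metis
  then have "quad (affine_matrix (affine_scale c x)) f D = c * quad (affine_matrix x) f D" for D
    by (simp add: affine_matrix_scale quad_scale)
  then show ?thesis
    by (simp add: fun_eq_iff fock_act_def fock_scale_def affine_scale_def algebra_simps)
qed

lemma fock_act_add_right: "fock_act x (f + g) = fock_act x f + fock_act x g"
  by (simp add: fun_eq_iff fock_act_def quad_add_arg algebra_simps)

lemma fock_act_scale_right: "fock_act x (fock_scale c f) = fock_scale c (fock_act x f)"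
proof -
  have "fock_scale c f = (\<lambda>D. c * f D)" by (simp add: fun_eq_iff fock_scale_def)
  then have "quad M (fock_scale c f) D = c * quad M f D" for M D by (simp only: quad_scale_arg)
  then show ?thesis
    by (simp add: fun_eq_iff fock_act_def fock_scale_def algebra_simps)
qed

lemma affine_matrix_loop:
  "affine_matrix (loop a m) p q = (if snd p - snd q = m then mat_of_sl2 a $ fst p $ fst q else 0)"
  by (simp add: affine_matrix_def loop_def lookup_single when_def zero_sl2.rep_eq)

lemma affine_matrix_loop_band: "\<bar>m\<bar> \<le> b \<Longrightarrow> band b (affine_matrix (loop a m))"
  by (auto simp: band_def affine_matrix_loop split: if_splits)

lemma affine_matrix_loop_product:
  assumes "\<bar>m\<bar> + \<bar>snd p\<bar> \<le> n"
  shows "(\<Sum>q\<in>window n. affine_matrix (loop a m) p q * affine_matrix (loop b k) q s)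
     = (if snd p - snd s = m + k then (mat_of_sl2 a ** mat_of_sl2 b) $ fst p $ fst s else 0)"
proof -
  have "(\<Sum>q\<in>window n. affine_matrix (loop a m) p q * affine_matrix (loop b k) q s)
    = (\<Sum>c\<in>UNIV. \<Sum>j\<in>{-n..n}. affine_matrix (loop a m) p (c, j) * affine_matrix (loop b k) (c, j) s)"
    unfolding window_eq by (simp add: sum.cartesian_product case_prod_unfold)
  also have "\<dots> = (\<Sum>c\<in>UNIV. \<Sum>j\<in>{-n..n}. if j = snd p - m then
      (if snd p - snd s = m + k then mat_of_sl2 a $ fst p $ c * mat_of_sl2 b $ c $ fst s else 0) else 0)"
    by (intro sum.cong refl) (auto simp: affine_matrix_loop)
  also have "\<dots> = (\<Sum>c\<in>UNIV. if snd p - snd s = m + k then mat_of_sl2 a $ fst p $ c * mat_of_sl2 b $ c $ fst s else 0)"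
    using assms by (intro sum.cong refl, subst sum.delta) auto
  finally show ?thesis by (simp add: matrix_matrix_mult_def)
qed

text \<open>For m > 0 the transitions from negative to nonnegative modes end exactly in the indices
  0, ..., m - 1; this count is the factor m in the cocycle of the affine algebra.\<close>

lemma affine_matrix_loop_cocycle:
  assumes "\<bar>m\<bar> \<le> n"
  shows "(\<Sum>p\<in>{p\<in>window n. 0 \<le> snd p}. \<Sum>q\<in>{q\<in>window n. snd q < 0}.
      affine_matrix (loop a m) p q * affine_matrix (loop b k) q p)
    = (if m + k = 0 then of_int (max m 0) * trace (mat_of_sl2 a ** mat_of_sl2 b) else 0)"
proof -
  have P: "{p\<in>window n. 0 \<le> snd p} = UNIV \<times> {0..n}" and N: "{q\<in>window n. snd q < 0} = UNIV \<times> {-n..-1}"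
    by (auto simp: window_def)
  have "(\<Sum>p\<in>{p\<in>window n. 0 \<le> snd p}. \<Sum>q\<in>{q\<in>window n. snd q < 0}.
      affine_matrix (loop a m) p q * affine_matrix (loop b k) q p)
    = (\<Sum>c\<in>UNIV. \<Sum>i\<in>{0..n}. \<Sum>d\<in>UNIV. \<Sum>j\<in>{-n..-1}.
      affine_matrix (loop a m) (c, i) (d, j) * affine_matrix (loop b k) (d, j) (c, i))"
  proof -
    have "(\<Sum>p\<in>(UNIV :: 2 set) \<times> B. g p) = (\<Sum>c\<in>UNIV. \<Sum>i\<in>B. g (c, i))" for B :: "int set" and g :: "mode \<Rightarrow> complex"
      by (simp add: sum.cartesian_product)
    then show ?thesis unfolding P N by (simp only:)
  qed
  also have "\<dots> = (\<Sum>c\<in>UNIV. \<Sum>i\<in>{0..n}. if i < m \<and> m + k = 0 then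
      (\<Sum>d\<in>UNIV. mat_of_sl2 a $ c $ d * mat_of_sl2 b $ d $ c) else 0)"
  proof (intro sum.cong refl)
    fix c :: 2 and i assume i: "i \<in> {0..n}"
    have "(\<Sum>j\<in>{-n..-1}. affine_matrix (loop a m) (c, i) (d, j) * affine_matrix (loop b k) (d, j) (c, i))
      = (\<Sum>j\<in>{-n..-1}. if j = i - m then (if m + k = 0 then mat_of_sl2 a $ c $ d * mat_of_sl2 b $ d $ c else 0) else 0)" for d
      by (intro sum.cong refl) (auto simp: affine_matrix_loop)
    also have "\<dots> d = (if i < m \<and> m + k = 0 then mat_of_sl2 a $ c $ d * mat_of_sl2 b $ d $ c else 0)" for d
      using assms i by (subst sum.delta) auto
    finally show "(\<Sum>d\<in>UNIV. \<Sum>j\<in>{-n..-1}. affine_matrix (loop a m) (c, i) (d, j) * affine_matrix (loop b k) (d, j) (c, i))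
      = (if i < m \<and> m + k = 0 then (\<Sum>d\<in>UNIV. mat_of_sl2 a $ c $ d * mat_of_sl2 b $ d $ c) else 0)"
      by (auto intro: sum.neutral)
  qed
  also have "\<dots> = (\<Sum>i\<in>{0..n}. if i < m \<and> m + k = 0 then trace (mat_of_sl2 a ** mat_of_sl2 b) else 0)"
    by (subst sum.swap) (auto intro!: sum.cong simp: trace_def matrix_matrix_mult_def)
  also have "\<dots> = (\<Sum>i\<in>{i\<in>{0..n}. i < m}. if m + k = 0 then trace (mat_of_sl2 a ** mat_of_sl2 b) else 0)"
    by (subst sum.inter_filter) (auto intro!: sum.cong)
  also have "{i\<in>{0..n}. i < m} = {0..<m}" using assms by auto
  finally show ?thesis by (simp add: max_def)
qed

lemma fock_act_central: "fock_act central f = f"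
proof -
  have 1: "affine_matrix central = (\<lambda>p q. 0)"
    by (simp add: affine_matrix_def central_def fun_eq_iff zero_sl2.rep_eq)
  have 2: "quad (\<lambda>p q. 0) f D = 0" for D by (simp add: quad_def)
  have 3: "snd central = 1" by (simp add: central_def)
  show ?thesis by (simp add: fun_eq_iff fock_act_def 1 2 3)
qed

lemma fock_act_loop_bracket:
  "fock_act (loop a m) (fock_act (loop b k) f) - fock_act (loop b k) (fock_act (loop a m) f)
    = fock_act (affine_bracket (loop a m) (loop b k)) f"
proof
  fix D
  let ?c = "if m + k = 0 then of_int m * sl2_form a b else 0"
  have loop: "fock_act (loop a m) f = quad (affine_matrix (loop a m)) f" for a m f
    by (simp add: fun_eq_iff fock_act_def loop_def)
  have "quad (affine_matrix (loop a m)) (quad (affine_matrix (loop b k)) f) D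
      - quad (affine_matrix (loop b k)) (quad (affine_matrix (loop a m)) f) D
    = quad (affine_matrix (loop (sl2_bracket a b) (m + k))) f D + ?c * f D"
  proof (rule quad_commutator[where b = "\<bar>m\<bar> + \<bar>k\<bar>"])
    fix p s :: mode and n assume n: "\<bar>m\<bar> + \<bar>k\<bar> + \<bar>snd p\<bar> \<le> n"
    show "affine_matrix (loop (sl2_bracket a b) (m + k)) p s =
       (\<Sum>q\<in>window n. affine_matrix (loop a m) p q * affine_matrix (loop b k) q s
         - affine_matrix (loop b k) p q * affine_matrix (loop a m) q s)"
      unfolding sum_subtractf using n
      by (simp add: affine_matrix_loop_product) (simp add: affine_matrix_loop sl2_bracket.rep_eq add.commute)
  next
    fix n assume n: "\<bar>m\<bar> + \<bar>k\<bar> \<le> n"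
    have tr: "trace (mat_of_sl2 b ** mat_of_sl2 a) = trace (mat_of_sl2 a ** mat_of_sl2 b)"
      by (rule trace_mul_sym)
    show "(\<Sum>p\<in>{p\<in>window n. 0 \<le> snd p}. \<Sum>q\<in>{q\<in>window n. snd q < 0}.
        affine_matrix (loop a m) p q * affine_matrix (loop b k) q p
        - affine_matrix (loop b k) p q * affine_matrix (loop a m) q p) = ?c"
      \<comment> \<open>The two orders of the product give max m 0 and max k 0; for k = -m their
        difference is m.\<close>
      unfolding sum_subtractf using n
      by (simp add: affine_matrix_loop_cocycle tr sl2_form_def)
        (auto simp: max_def add_eq_0_iff2 left_diff_distrib[symmetric])
  qed (auto intro: affine_matrix_loop_band)
  moreover have "fock_act (affine_bracket (loop a m) (loop b k)) f D
    = quad (affine_matrix (loop (sl2_bracket a b) (m + k))) f D + ?c * f D"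
  proof -
    show ?thesis
      by (simp add: affine_bracket_loop fock_act_add_left fock_act_scale_left fock_scale_def fock_act_central loop)
  qed
  ultimately show "(fock_act (loop a m) (fock_act (loop b k) f) - fock_act (loop b k) (fock_act (loop a m) f)) D
    = fock_act (affine_bracket (loop a m) (loop b k)) f D"
    by (simp add: loop)
qed

lemma affine_bracket_expand:
  "affine_bracket x y = (\<Sum>m\<in>Poly_Mapping.keys (fst x). \<Sum>k\<in>Poly_Mapping.keys (fst y).
     affine_bracket (loop (Poly_Mapping.lookup (fst x) m) m) (loop (Poly_Mapping.lookup (fst y) k) k))"
proof -
  have z: "Poly_Mapping.map (sl2_scale c) 0 = 0" for c
    by (rule poly_mapping_eqI) (simp add: Poly_Mapping.map.rep_eq)
  show ?thesis
    unfolding affine_bracket_loop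
    by (simp add: prod_eq_iff fst_sum snd_sum affine_bracket_def Let_def loop_def affine_scale_def central_def z)
qed

lemma fock_act_sum_left: "fock_act (sum x A) f = (\<Sum>a\<in>A. fock_act (x a) f)"
proof -
  have "fock_act 0 f = 0" using fock_act_add_left[of 0 0 f] by simp
  then show ?thesis by (induction A rule: infinite_finite_induct) (simp_all add: fock_act_add_left)
qed

lemma fock_act_sum_right: "fock_act x (sum f A) = (\<Sum>a\<in>A. fock_act x (f a))"
proof -
  have "fock_act x 0 = 0" using fock_act_add_right[of x 0 0] by simp
  then show ?thesis by (induction A rule: infinite_finite_induct) (simp_all add: fock_act_add_right)
qed

lemma fock_act_bracket:
  "fock_act (affine_bracket x y) f = fock_act x (fock_act y f) - fock_act y (fock_act x f)"
proof -
  define X where "X m = loop (Poly_Mapping.lookup (fst x) m) m" for m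
  define Y where "Y m = loop (Poly_Mapping.lookup (fst y) m) m" for m
  have exp: "fock_act x f = (\<Sum>m\<in>Poly_Mapping.keys (fst x). fock_act (X m) f) + fock_scale (snd x) f"
    "fock_act y f = (\<Sum>m\<in>Poly_Mapping.keys (fst y). fock_act (Y m) f) + fock_scale (snd y) f" for f
    by (subst affine_decomposition, simp add: X_def Y_def fock_act_add_left fock_act_sum_left fock_act_scale_left fock_act_central)+
  have sc: "fock_scale c (f + g) = fock_scale c f + fock_scale c g"
    "fock_scale c (\<Sum>a\<in>A. h a) = (\<Sum>a\<in>A. fock_scale c (h a))"
    "fock_scale c (fock_scale d f) = fock_scale d (fock_scale c f)" for c d f g A and h :: "int \<Rightarrow> fock"
  proof -
    show s: "fock_scale c (f + g) = fock_scale c f + fock_scale c g" for f g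
      by (simp add: fun_eq_iff fock_scale_def algebra_simps)
    have "fock_scale c 0 = 0" by (simp add: fun_eq_iff fock_scale_def)
    then show "fock_scale c (\<Sum>a\<in>A. h a) = (\<Sum>a\<in>A. fock_scale c (h a))"
      by (induction A rule: infinite_finite_induct) (simp_all add: s)
  qed (simp add: fun_eq_iff fock_scale_def mult.left_commute)
  have "fock_act x (fock_act y f) - fock_act y (fock_act x f)
     = (\<Sum>m\<in>Poly_Mapping.keys (fst x). \<Sum>k\<in>Poly_Mapping.keys (fst y). fock_act (X m) (fock_act (Y k) f))
     - (\<Sum>k\<in>Poly_Mapping.keys (fst y). \<Sum>m\<in>Poly_Mapping.keys (fst x). fock_act (Y k) (fock_act (X m) f))"
    unfolding exp
    by (simp add: fock_act_add_right fock_act_sum_right fock_act_scale_right sc sum.distrib)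
  also have "\<dots> = (\<Sum>m\<in>Poly_Mapping.keys (fst x). \<Sum>k\<in>Poly_Mapping.keys (fst y). fock_act (affine_bracket (X m) (Y k)) f)"
    by (subst (2) sum.swap) (simp add: X_def Y_def fock_act_loop_bracket[symmetric] sum_subtractf)
  also have "\<dots> = fock_act (affine_bracket x y) f"
    unfolding affine_bracket_expand[of x y] fock_act_sum_left X_def Y_def ..
  finally show ?thesis ..
qed

interpretation fock: level_one_module fock_scale fock_act
  by unfold_locales
    (auto simp: fun_eq_iff fock_scale_def algebra_simps fock_act_add_left fock_act_scale_left
      fock_act_add_right fock_act_scale_right fock_act_bracket fock_act_central
      simp del: plus_fun_def)

section \<open>The contravariant form\<close>

definition fock_finite :: "fock set" where
  "fock_finite = {f. finite {D. f D \<noteq> 0}}"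

definition fock_form :: "fock \<Rightarrow> fock \<Rightarrow> complex" where
  "fock_form f g = (\<Sum>D\<in>{D. f D \<noteq> 0}. cnj (f D) * g D)"

lemma fock_form_superset:
  "finite S \<Longrightarrow> {D. f D \<noteq> 0} \<subseteq> S \<Longrightarrow> fock_form f g = (\<Sum>D\<in>S. cnj (f D) * g D)"
  unfolding fock_form_def by (rule sum.mono_neutral_left) auto

lemma fock_form_add_left:
  assumes "f \<in> fock_finite" "f' \<in> fock_finite"
  shows "fock_form (f + f') g = fock_form f g + fock_form f' g"
proof -
  define S where "S = {D. f D \<noteq> 0} \<union> {D. f' D \<noteq> 0}"
  have S: "finite S" "{D. f D \<noteq> 0} \<subseteq> S" "{D. f' D \<noteq> 0} \<subseteq> S" "{D. (f + f') D \<noteq> 0} \<subseteq> S"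
    using assms by (auto simp: S_def fock_finite_def)
  show ?thesis unfolding fock_form_superset[OF S(1,2)] fock_form_superset[OF S(1,3)] fock_form_superset[OF S(1,4)]
    by (simp add: sum.distrib algebra_simps)
qed

lemma fock_form_scale_left: "fock_form (fock_scale c f) g = cnj c * fock_form f g"
proof (cases "c = 0")
  case True then show ?thesis by (simp add: fock_form_def fock_scale_def)
next
  case False then show ?thesis by (simp add: fock_form_def fock_scale_def sum_distrib_left mult.assoc)
qed

lemma fock_form_add_right: "fock_form f (g + g') = fock_form f g + fock_form f g'"
  by (simp add: fock_form_def sum.distrib algebra_simps)

lemma fock_form_scale_right: "fock_form f (fock_scale c g) = c * fock_form f g"
  by (simp add: fock_form_def fock_scale_def sum_distrib_left mult.left_commute)

lemma fock_form_sum_right: "fock_form f (\<lambda>D. \<Sum>i\<in>A. g i D) = (\<Sum>i\<in>A. fock_form f (g i))"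
  unfolding fock_form_def sum_distrib_left by (rule sum.swap)

lemma fock_form_definite:
  assumes "f \<in> fock_finite" "fock_form f f = 0"
  shows "f = 0"
proof -
  have "fock_form f f = of_real (\<Sum>D\<in>{D. f D \<noteq> 0}. (cmod (f D))\<^sup>2)"
    unfolding fock_form_def of_real_sum
    by (intro sum.cong refl) (metis complex_norm_square mult.commute of_real_power)
  then have "(\<Sum>D\<in>{D. f D \<noteq> 0}. (cmod (f D))\<^sup>2) = 0" using assms(2) of_real_eq_0_iff by metis
  then have "\<forall>D\<in>{D. f D \<noteq> 0}. (cmod (f D))\<^sup>2 = 0"
    using assms(1) by (subst (asm) sum_nonneg_eq_0_iff) (auto simp: fock_finite_def)
  then show ?thesis by (auto simp: fun_eq_iff)
qed

lemma nbil_support: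
  "{D. nbil p q f D \<noteq> 0} \<subseteq> {D. f D \<noteq> 0} \<union> (\<lambda>D. flip p (flip q D)) ` {D. f D \<noteq> 0}"
proof
  fix D assume "D \<in> {D. nbil p q f D \<noteq> 0}"
  then have "f D \<noteq> 0 \<or> f (flip q (flip p D)) \<noteq> 0"
    by (auto simp: nbil_def bil_eq split: if_splits)
  moreover have "D = flip p (flip q (flip q (flip p D)))" by simp
  ultimately show "D \<in> {D. f D \<noteq> 0} \<union> (\<lambda>D. flip p (flip q D)) ` {D. f D \<noteq> 0}" by blast
qed

lemma nbil_finite: "f \<in> fock_finite \<Longrightarrow> nbil p q f \<in> fock_finite"
  unfolding fock_finite_def mem_Collect_eq
  by (rule finite_subset[OF nbil_support]) simp

text \<open>The basis states are orthonormal, so creation and annihilation of a mode are adjoint to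
  each other; off the diagonal the two sums are matched by the involution that flips both
  modes.\<close>

lemma fock_form_nbil:
  assumes "f \<in> fock_finite"
  shows "fock_form (nbil p q f) g = fock_form f (nbil q p g)"
proof -
  define T where "T D = flip p (flip q D)" for D
  have TT: "T (T D) = D" for D by (simp add: T_def flip_commute[of q p])
  define S where "S = {D. f D \<noteq> 0} \<union> T ` {D. f D \<noteq> 0}"
  have S: "finite S" "{D. f D \<noteq> 0} \<subseteq> S" "{D. nbil p q f D \<noteq> 0} \<subseteq> S"
    using assms nbil_support[of p q f] by (auto simp: S_def fock_finite_def T_def)
  have TS: "T ` S = S" using TT by (auto simp: S_def image_Un image_image)
  have inj: "inj_on T S" by (metis TT inj_onI)
  show ?thesis
  proof (cases "p = q")
    case True
    show ?thesis unfolding fock_form_superset[OF S(1,2)] fock_form_superset[OF S(1,3)]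
      by (rule sum.cong) (auto simp: True nbil_def bil_eq)
  next
    case False
    have "fock_form (nbil p q f) g = (\<Sum>D\<in>T ` S. cnj (nbil p q f D) * g D)"
      unfolding TS by (rule fock_form_superset[OF S(1,3)])
    also have "\<dots> = (\<Sum>D\<in>S. cnj (nbil p q f (T D)) * g (T D))"
      by (simp add: sum.reindex[OF inj])
    also have "\<dots> = (\<Sum>D\<in>S. cnj (f D) * nbil q p g D)"
    proof (rule sum.cong)
      fix D
      have s: "cnj (jw_sign r E) = jw_sign r E" for r E by (simp add: jw_sign_def)
      show "cnj (nbil p q f (T D)) * g (T D) = cnj (f D) * nbil q p g D"
        using False by (auto simp: nbil_def bil_eq T_def occupied_flip jw_sign_flip s flip_commute[of q p])
    qed simp
    also have "\<dots> = fock_form f (nbil q p g)" by (rule fock_form_superset[OF S(1,2), symmetric])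
    finally show ?thesis .
  qed
qed

lemma fock_finite_sum: "(\<And>i. i \<in> A \<Longrightarrow> f i \<in> fock_finite) \<Longrightarrow> finite A \<Longrightarrow> (\<lambda>D. \<Sum>i\<in>A. f i D) \<in> fock_finite"
  unfolding fock_finite_def mem_Collect_eq
  by (rule finite_subset[of _ "\<Union>i\<in>A. {D. f i D \<noteq> 0}"]) (auto elim: sum.not_neutral_contains_not_neutral)

lemma fock_form_sum_left:
  "finite A \<Longrightarrow> (\<And>i. i \<in> A \<Longrightarrow> f i \<in> fock_finite) \<Longrightarrow> fock_form (\<lambda>D. \<Sum>i\<in>A. f i D) g = (\<Sum>i\<in>A. fock_form (f i) g)"
proof (induction A rule: finite_induct)
  case empty then show ?case by (simp add: fock_form_def)
next
  case (insert x A)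
  have "(\<lambda>D. \<Sum>i\<in>insert x A. f i D) = f x + (\<lambda>D. \<Sum>i\<in>A. f i D)"
    using insert by (simp add: fun_eq_iff)
  moreover have "(\<lambda>D. \<Sum>i\<in>A. f i D) \<in> fock_finite"
    using insert by (intro fock_finite_sum) auto
  ultimately show ?case using insert fock_form_add_left by simp
qed

text \<open>Finite support gives a window uniform in \<open>D\<close>: a nonzero term reads
  \<open>f\<close> at \<open>D\<close> or at the state with both modes flipped, where the reversed
  pair is active, and the state that is read lies in the support.\<close>

lemma quad_eq_wquad:
  assumes f: "f \<in> fock_finite" and b: "band b M"
  shows "\<exists>m. \<forall>n\<ge>m. quad M f = wquad n M f"
proof -
  let ?S = "{D. f D \<noteq> 0}"
  have "\<exists>m. \<forall>n\<ge>m. \<forall>D\<in>?S. \<forall>p q. \<bar>snd p - snd q\<bar> \<le> b \<longrightarrow> active D p q \<longrightarrow> p \<in> window n \<and> q \<in> window n"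
  proof (rule uniform_bound)
    fix D
    show "\<exists>m. \<forall>n\<ge>m. \<forall>p q. \<bar>snd p - snd q\<bar> \<le> b \<longrightarrow> active D p q \<longrightarrow> p \<in> window n \<and> q \<in> window n"
      using active_window[of b D] window_mono by blast
  qed (use f in \<open>simp add: fock_finite_def\<close>)
  then obtain m where m: "\<And>n D p q. n \<ge> m \<Longrightarrow> f D \<noteq> 0 \<Longrightarrow> \<bar>snd p - snd q\<bar> \<le> b \<Longrightarrow> active D p q
      \<Longrightarrow> p \<in> window n \<and> q \<in> window n" by blast
  have "quad M f D = wquad n M f D" if n: "n \<ge> m" for n D
  proof -
    let ?A = "{(p, q). M p q \<noteq> 0 \<and> active D p q}"
    let ?W = "window n \<times> window n"
    obtain l where "\<And>p q. \<bar>snd p - snd q\<bar> \<le> b \<Longrightarrow> active D p q \<Longrightarrow> p \<in> window l \<and> q \<in> window l"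
      using active_window by blast
    then have "?A \<subseteq> window l \<times> window l" using b unfolding band_def by blast
    then have fin: "finite (?A \<union> ?W)" using finite_subset by fastforce
    have win: "p \<in> window n \<and> q \<in> window n" if "M p q \<noteq> 0" "nbil p q f D \<noteq> 0" for p q
    proof (cases "p = q")
      case True
      have "active D p q" using that(2) nbil_inactive by blast
      moreover have "f D \<noteq> 0" using that True by (auto simp: nbil_def bil_eq split: if_splits)
      ultimately show ?thesis using m n True that b unfolding band_def by blast
    next
      case False
      then have "f (flip q (flip p D)) \<noteq> 0" "active (flip q (flip p D)) q p"
        using that by (auto simp: nbil_def bil_eq active_def occupied_flip split: if_splits)
      then show ?thesis using m[of n "flip q (flip p D)" q p] n that b unfolding band_def
        by (metis abs_minus_commute)
    qed
    have "quad M f D = (\<Sum>(p, q)\<in>?A \<union> ?W. M p q * nbil p q f D)"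
      by (rule quad_eq_sum[OF fin]) auto
    also have "\<dots> = (\<Sum>(p, q)\<in>?W. M p q * nbil p q f D)"
    proof (rule sum.mono_neutral_right[OF fin])
      show "\<forall>z\<in>(?A \<union> ?W) - ?W. (case z of (p, q) \<Rightarrow> M p q * nbil p q f D) = 0"
        using win by (auto simp: case_prod_unfold)
    qed auto
    finally show ?thesis by (simp add: wquad_def sum.cartesian_product)
  qed
  then show ?thesis by (auto simp: fun_eq_iff)
qed

lemma wquad_eq_pair_sum:
  "wquad n M f = (\<lambda>D. \<Sum>x\<in>window n \<times> window n. fock_scale (M (fst x) (snd x)) (nbil (fst x) (snd x) f) D)"
  by (simp add: fun_eq_iff wquad_def fock_scale_def sum.cartesian_product case_prod_unfold)

lemma fock_finite_scale: "f \<in> fock_finite \<Longrightarrow> fock_scale c f \<in> fock_finite"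
  unfolding fock_finite_def mem_Collect_eq by (erule finite_subset[rotated]) (auto simp: fock_scale_def)

lemma fock_finite_add: "f \<in> fock_finite \<Longrightarrow> g \<in> fock_finite \<Longrightarrow> f + g \<in> fock_finite"
  unfolding fock_finite_def mem_Collect_eq
  by (rule finite_subset[of _ "{D. f D \<noteq> 0} \<union> {D. g D \<noteq> 0}"]) auto

lemma wquad_finite: "f \<in> fock_finite \<Longrightarrow> wquad n M f \<in> fock_finite"
  unfolding wquad_eq_pair_sum by (intro fock_finite_sum fock_finite_scale nbil_finite) auto

lemma quad_finite: "f \<in> fock_finite \<Longrightarrow> band b M \<Longrightarrow> quad M f \<in> fock_finite"
  using quad_eq_wquad wquad_finite by (metis order_refl)

lemma fock_form_wquad:
  assumes f: "f \<in> fock_finite"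
  shows "fock_form (wquad n M f) g = fock_form f (wquad n (\<lambda>p q. cnj (M q p)) g)"
proof -
  have "fock_form (wquad n M f) g
     = (\<Sum>x\<in>window n \<times> window n. cnj (M (fst x) (snd x)) * fock_form f (nbil (snd x) (fst x) g))"
    unfolding wquad_eq_pair_sum
    by (subst fock_form_sum_left)
      (simp_all add: f fock_finite_scale nbil_finite fock_form_scale_left fock_form_nbil)
  also have "\<dots> = (\<Sum>p\<in>window n. \<Sum>q\<in>window n. cnj (M p q) * fock_form f (nbil q p g))"
    by (simp add: sum.cartesian_product case_prod_unfold)
  also have "\<dots> = (\<Sum>q\<in>window n. \<Sum>p\<in>window n. cnj (M p q) * fock_form f (nbil q p g))"
    by (rule sum.swap)
  also have "\<dots> = fock_form f (wquad n (\<lambda>p q. cnj (M q p)) g)"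
    unfolding wquad_eq_pair_sum fock_form_sum_right fock_form_scale_right
    by (simp add: sum.cartesian_product case_prod_unfold)
  finally show ?thesis .
qed

text \<open>Although \<open>g\<close> is arbitrary, the right-hand side evaluates the operator on
  \<open>g\<close> only at the finite support of \<open>f\<close>, so a common window exists there
  too.\<close>

lemma fock_form_quad:
  assumes f: "f \<in> fock_finite" and b: "band b M"
  shows "fock_form (quad M f) g = fock_form f (quad (\<lambda>p q. cnj (M q p)) g)"
proof -
  have b': "band b (\<lambda>p q. cnj (M q p))" using b unfolding band_def by (metis abs_minus_commute complex_cnj_zero)
  obtain m where m: "\<forall>n\<ge>m. quad M f = wquad n M f" using quad_eq_wquad[OF f b] by blast
  have "\<exists>m. \<forall>n\<ge>m. \<forall>D\<in>{D. f D \<noteq> 0}. quad (\<lambda>p q. cnj (M q p)) g D = wquad n (\<lambda>p q. cnj (M q p)) g D"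
  proof (rule uniform_bound)
    fix D
    show "\<exists>m. \<forall>n\<ge>m. quad (\<lambda>p q. cnj (M q p)) g D = wquad n (\<lambda>p q. cnj (M q p)) g D"
      using quad_window[OF b', of D] by blast
  qed (use f in \<open>simp add: fock_finite_def\<close>)
  then obtain m' where m': "\<forall>n\<ge>m'. \<forall>D\<in>{D. f D \<noteq> 0}. quad (\<lambda>p q. cnj (M q p)) g D = wquad n (\<lambda>p q. cnj (M q p)) g D"
    by blast
  define n where "n = max m m'"
  have "fock_form (quad M f) g = fock_form f (wquad n (\<lambda>p q. cnj (M q p)) g)"
    using m fock_form_wquad[OF f, of n M g] by (metis n_def max.cobounded1)
  also have "\<dots> = fock_form f (quad (\<lambda>p q. cnj (M q p)) g)"
    unfolding fock_form_def
  proof (rule sum.cong)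
    fix D assume "D \<in> {D. f D \<noteq> 0}"
    then show "cnj (f D) * wquad n (\<lambda>p q. cnj (M q p)) g D = cnj (f D) * quad (\<lambda>p q. cnj (M q p)) g D"
      using m' n_def by (metis max.cobounded2)
  qed simp
  finally show ?thesis .
qed

lemma fock_act_loop: "fock_act (loop a m) f = quad (affine_matrix (loop a m)) f"
  by (simp add: fun_eq_iff fock_act_def loop_def)

lemma fock_act_finite:
  assumes "f \<in> fock_finite"
  shows "fock_act x f \<in> fock_finite"
proof -
  obtain b where b: "band b (affine_matrix x)" using affine_matrix_band by blast
  have "fock_act x f = quad (affine_matrix x) f + fock_scale (snd x) f"
    by (simp add: fun_eq_iff fock_act_def fock_scale_def)
  then show ?thesis
    using fock_finite_add[OF quad_finite[OF assms b] fock_finite_scale[OF assms]] by simp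
qed

text \<open>Conjugate transposition exchanges the matrices of x_alpha(m) and x_(-alpha)(-m).\<close>

lemma fock_form_adjoint:
  assumes "f \<in> fock_finite"
  shows "fock_form (fock_act (loop x_pos m) f) g = fock_form f (fock_act (loop x_neg (- m)) g)"
    "fock_form (fock_act (loop x_neg m) f) g = fock_form f (fock_act (loop x_pos (- m)) g)"
proof -
  have "(\<lambda>p q. cnj (affine_matrix (loop x_pos m) q p)) = affine_matrix (loop x_neg (- m))"
    "(\<lambda>p q. cnj (affine_matrix (loop x_neg m) q p)) = affine_matrix (loop x_pos (- m))"
  proof -
    have "cnj (mat_of_sl2 x_pos $ c $ d) = mat_of_sl2 x_neg $ d $ c"
      "cnj (mat_of_sl2 x_neg $ c $ d) = mat_of_sl2 x_pos $ d $ c" for c d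
      using exhaust_2[of c] exhaust_2[of d] by (auto simp: x_pos.rep_eq x_neg.rep_eq)
    then show "(\<lambda>p q. cnj (affine_matrix (loop x_pos m) q p)) = affine_matrix (loop x_neg (- m))"
      "(\<lambda>p q. cnj (affine_matrix (loop x_neg m) q p)) = affine_matrix (loop x_pos (- m))"
      by (auto simp: fun_eq_iff affine_matrix_loop)
  qed
  then show "fock_form (fock_act (loop x_pos m) f) g = fock_form f (fock_act (loop x_neg (- m)) g)"
    "fock_form (fock_act (loop x_neg m) f) g = fock_form f (fock_act (loop x_pos (- m)) g)"
    unfolding fock_act_loop using fock_form_quad[OF assms affine_matrix_loop_band[OF order_refl]] by metis+
qed

lemma fock_unitary: "unitary_module fock_scale fock_act fock_form fock_finite"
proof unfold_locales
  show "submodule fock_scale fock_act fock_finite"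
    unfolding submodule_def
  proof (intro conjI allI ballI fock.subspaceI)
    show "0 \<in> fock_finite" by (simp add: fock_finite_def)
  qed (auto intro: fock_finite_add fock_finite_scale fock_act_finite)
qed (auto intro: fock_form_add_left fock_form_scale_left fock_form_add_right fock_form_scale_right
    fock_form_adjoint fock_form_definite)

section \<open>Dirac seas\<close>

definition in_sea :: "int \<Rightarrow> int \<Rightarrow> mode \<Rightarrow> bool" where
  "in_sea a b p \<longleftrightarrow> (if fst p = 1 then a \<le> snd p else b \<le> snd p)"

definition sea :: "int \<Rightarrow> int \<Rightarrow> mode fset" where
  "sea a b = Abs_fset {p. in_sea a b p \<noteq> (0 \<le> snd p)}"

definition vac :: "int \<Rightarrow> int \<Rightarrow> fock" where
  "vac a b D = (if D = sea a b then 1 else 0)"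

lemma mem_sea: "p |\<in>| sea a b \<longleftrightarrow> in_sea a b p \<noteq> (0 \<le> snd p)"
proof -
  have "{p. in_sea a b p \<noteq> (0 \<le> snd p)} \<subseteq> window (\<bar>a\<bar> + \<bar>b\<bar>)"
    by (auto simp: in_sea_def window_def split: if_splits)
  then have "finite {p. in_sea a b p \<noteq> (0 \<le> snd p)}" by (rule finite_subset) simp
  then show ?thesis by (simp add: sea_def Abs_fset_inverse)
qed

lemma occupied_sea: "occupied (sea a b) p \<longleftrightarrow> in_sea a b p"
  by (auto simp: occupied_def mem_sea)

lemma occupied_inject: "(\<And>p. occupied D p \<longleftrightarrow> occupied E p) \<Longrightarrow> D = E"
  by (rule fset_eqI) (auto simp: occupied_def)

lemma nbil_vac:
  assumes "p \<noteq> q" "nbil p q (vac a b) D \<noteq> 0"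
  shows "in_sea a b q" "\<not> in_sea a b p"
proof -
  have D: "occupied D p" "\<not> occupied D q" "flip q (flip p D) = sea a b"
    using assms by (auto simp: nbil_def bil_eq vac_def split: if_splits)
  show "in_sea a b q" "\<not> in_sea a b p"
    using assms D(1,2) unfolding occupied_sea[symmetric] D(3)[symmetric] by (auto simp: occupied_flip)
qed

text \<open>An off-diagonal term acts on the sea only by moving a filled mode \<open>q\<close> to an
  empty mode \<open>p\<close>, and the hypothesis forbids \<open>M\<close> to lead out of the
  sea.\<close>

lemma quad_vac_eq_0:
  assumes "\<And>p q. M p q \<noteq> 0 \<Longrightarrow> p \<noteq> q \<and> (in_sea a b q \<longrightarrow> in_sea a b p)"
  shows "quad M (vac a b) = 0"
proof
  fix D
  have z: "M p q * nbil p q (vac a b) D = 0" for p q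
    using assms[of p q] nbil_vac[of p q a b D] by auto
  show "quad M (vac a b) D = 0 D"
    unfolding quad_def case_prod_unfold z by simp
qed

lemma x_pos_entry: "mat_of_sl2 x_pos $ c $ d = (if c = 1 \<and> d = 2 then 1 else 0)"
  using exhaust_2[of c] exhaust_2[of d] by (auto simp: x_pos.rep_eq)

lemma x_neg_entry: "mat_of_sl2 x_neg $ c $ d = (if c = 2 \<and> d = 1 then 1 else 0)"
  using exhaust_2[of c] exhaust_2[of d] by (auto simp: x_neg.rep_eq)

lemma h_cartan_entry: "mat_of_sl2 h_cartan $ c $ d = (if c = d then if c = 1 then 1 else -1 else 0)"
  using exhaust_2[of c] exhaust_2[of d] by (auto simp: h_cartan.rep_eq)

text \<open>A filled mode (2, j) with j >= b would move to (1, j + m) with j + m >= a, which is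
  already filled.\<close>

lemma xp_vac: "m \<ge> a - b \<Longrightarrow> fock_act (loop x_pos m) (vac a b) = 0"
  unfolding fock_act_loop
  by (rule quad_vac_eq_0) (auto simp: affine_matrix_loop x_pos_entry in_sea_def split: if_splits)

lemma xm_vac: "m \<ge> b - a \<Longrightarrow> fock_act (loop x_neg m) (vac a b) = 0"
  unfolding fock_act_loop
  by (rule quad_vac_eq_0) (auto simp: affine_matrix_loop x_neg_entry in_sea_def split: if_splits)

lemma hh_vac: "m > 0 \<Longrightarrow> fock_act (loop h_cartan m) (vac a b) = 0"
  unfolding fock_act_loop
  by (rule quad_vac_eq_0) (auto simp: affine_matrix_loop h_cartan_entry in_sea_def split: if_splits)

lemma vac_nonzero: "vac a b \<noteq> 0"
  by (auto simp: fun_eq_iff vac_def)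

lemma vac_finite: "vac a b \<in> fock_finite"
  by (simp add: fock_finite_def vac_def)

lemma highest_weight_vac_0: "fock.highest_weight 0 (vac 0 0)"
proof -
  have "fock_act (loop h_cartan 0) (vac 0 0) = 0"
    using fock.xp_xm[of 0 0 "vac 0 0"] fock.act_zero_right by (simp add: xp_vac xm_vac)
  then show ?thesis
    by (simp add: fock.highest_weight_def vac_nonzero xp_vac xm_vac hh_vac)
qed

text \<open>Here \<open>xp (-1)\<close> and \<open>xm 1\<close> both kill the sea. Their commutator
  is h(0) - 1, where -1 is the central term, and this gives the weight 1.\<close>

lemma highest_weight_vac_1: "fock.highest_weight 1 (vac (-1) 0)"
proof -
  have "fock_act (loop h_cartan 0) (vac (-1) 0) = fock_scale 1 (vac (-1) 0)"
    using fock.xp_xm[of "-1" 1 "vac (-1) 0"] fock.act_zero_right by (simp add: xp_vac xm_vac)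
  then show ?thesis
    by (simp add: fock.highest_weight_def vac_nonzero xp_vac xm_vac hh_vac)
qed

lemma cre_vac: "\<exists>c. c \<noteq> 0 \<and> cre (1, a - 1) (vac a b) = fock_scale c (vac (a - 1) b)"
proof (intro exI conjI)
  show "jw_sign (1, a - 1) (sea (a - 1) b) \<noteq> 0" by simp
  have s: "flip (1, a - 1) (sea (a - 1) b) = sea a b"
    by (rule occupied_inject) (auto simp: occupied_flip occupied_sea in_sea_def)
  show "cre (1, a - 1) (vac a b) = fock_scale (jw_sign (1, a - 1) (sea (a - 1) b)) (vac (a - 1) b)"
  proof
    fix D
    have "flip (1, a - 1) D = sea a b \<longleftrightarrow> D = sea (a - 1) b" using s by (metis flip_flip)
    then show "cre (1, a - 1) (vac a b) D = fock_scale (jw_sign (1, a - 1) (sea (a - 1) b)) (vac (a - 1) b) D"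
      by (auto simp: cre_def fock_scale_def vac_def occupied_sea in_sea_def)
  qed
qed

text \<open>This mode is one below the bound of \<open>xp_vac\<close>, and it opens a single
  transition: the surface mode (2, b) moves to (1, a - 1). Every other filled mode of color 2 would
  land on a filled mode.\<close>

lemma xp_vac_edge:
  "\<exists>c. c \<noteq> 0 \<and> fock_act (loop x_pos (a - b - 1)) (vac a b) = fock_scale c (vac (a - 1) (b + 1))"
proof (intro exI conjI)
  let ?p = "(1, a - 1) :: mode" and ?q = "(2, b) :: mode"
  let ?M = "affine_matrix (loop x_pos (a - b - 1))"
  let ?E = "sea (a - 1) (b + 1)"
  let ?c = "jw_sign ?p ?E * jw_sign ?q (flip ?p ?E)"
  show "?c \<noteq> 0" by simp
  have s: "flip ?q (flip ?p ?E) = sea a b"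
  proof (rule occupied_inject)
    show "occupied (flip ?q (flip ?p ?E)) p \<longleftrightarrow> occupied (sea a b) p" for p
      using exhaust_2[of "fst p"] by (cases p) (auto simp: occupied_flip occupied_sea in_sea_def)
  qed
  show "fock_act (loop x_pos (a - b - 1)) (vac a b) = fock_scale ?c (vac (a - 1) (b + 1))"
  proof
    fix D
    obtain m where m: "\<forall>n\<ge>m. \<forall>f. quad ?M f D = wquad n ?M f D"
      using quad_window affine_matrix_loop_band order_refl by metis
    define n where "n = max m (max \<bar>a - 1\<bar> \<bar>b\<bar>)"
    have "quad ?M (vac a b) D = (\<Sum>x\<in>window n \<times> window n. ?M (fst x) (snd x) * nbil (fst x) (snd x) (vac a b) D)"
      using m by (simp add: wquad_def n_def sum.cartesian_product case_prod_unfold)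
    also have "\<dots> = (\<Sum>x\<in>{(?p, ?q)}. ?M (fst x) (snd x) * nbil (fst x) (snd x) (vac a b) D)"
    proof (rule sum.mono_neutral_right)
      show "{(?p, ?q)} \<subseteq> window n \<times> window n" by (auto simp: window_def n_def)
      have "?M p q * nbil p q (vac a b) D = 0" if "p \<noteq> ?p \<or> q \<noteq> ?q" for p q
      proof (rule ccontr)
        assume nz: "?M p q * nbil p q (vac a b) D \<noteq> 0"
        then have M: "fst p = 1" "fst q = 2" "snd p = snd q + (a - b - 1)"
          by (auto simp: affine_matrix_loop x_pos_entry split: if_splits)
        then have "p \<noteq> q" by auto
        then have "in_sea a b q" "\<not> in_sea a b p" using nbil_vac[of p q a b D] nz by auto
        then have "snd q = b" "snd p = a - 1" using M by (auto simp: in_sea_def)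
        then show False using that M by (simp add: prod_eq_iff)
      qed
      then show "\<forall>x\<in>window n \<times> window n - {(?p, ?q)}. ?M (fst x) (snd x) * nbil (fst x) (snd x) (vac a b) D = 0"
        by (metis DiffD2 insertCI prod.collapse)
    qed simp
    also have "\<dots> = nbil ?p ?q (vac a b) D"
      by (simp add: affine_matrix_loop x_pos_entry)
    also have "\<dots> = fock_scale ?c (vac (a - 1) (b + 1)) D"
    proof -
      have "flip ?q (flip ?p D) = sea a b \<longleftrightarrow> D = ?E" using s by (metis flip_flip)
      moreover have "occupied ?E ?p" "\<not> occupied ?E ?q" by (simp_all add: occupied_sea in_sea_def)
      ultimately show ?thesis by (auto simp: nbil_def bil_eq fock_scale_def vac_def)
    qed
    finally show "fock_act (loop x_pos (a - b - 1)) (vac a b) D = fock_scale ?c (vac (a - 1) (b + 1)) D"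
      by (simp add: fock_act_loop)
  qed
qed

text \<open>\<open>cre l\<close> anticommutes with both factors of \<open>bil p q\<close> when
  \<open>q\<close> differs from \<open>l\<close>, hence commutes with the product. The vanishing
  column ensures this, and the vanishing diagonal avoids the normal ordering scalar. For x_alpha(m)
  all columns of color 1 vanish.\<close>

lemma quad_cre:
  assumes b: "band b M" and M: "\<And>p. M p p = 0" "\<And>p. M p l = 0"
  shows "quad M (cre l f) = cre l (quad M f)"
proof
  fix D
  obtain m where m: "\<forall>n\<ge>m. \<forall>f. quad M f D = wquad n M f D" using quad_window[OF b] by blast
  obtain m' where m': "\<forall>n\<ge>m'. \<forall>f. quad M f (flip l D) = wquad n M f (flip l D)" using quad_window[OF b] by blast
  define n where "n = max m m'"
  have t: "M p q * nbil p q (cre l f) D = (if occupied D l then jw_sign l D * (M p q * nbil p q f (flip l D)) else 0)" for p q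
  proof (cases "M p q = 0")
    case False
    then have pq: "p \<noteq> q" "q \<noteq> l" using M by metis+
    have "bil p q (cre l f) = cre l (bil p q f)"
      using pq by (simp add: bil_def ann_cre cre_linear cre_cre[of p l])
    then show ?thesis using pq by (simp add: nbil_def) (simp add: cre_def)
  qed simp
  have "quad M (cre l f) D = wquad n M (cre l f) D" using m by (simp add: n_def)
  also have "\<dots> = (if occupied D l then jw_sign l D * wquad n M f (flip l D) else 0)"
    by (simp add: wquad_def t sum_distrib_left)
  also have "\<dots> = cre l (quad M f) D" using m'[rule_format, of n f] by (simp add: cre_def n_def)
  finally show "quad M (cre l f) D = cre l (quad M f) D" .
qed

lemma xp_cre: "fock_act (loop x_pos m) (cre (1, i) f) = cre (1, i) (fock_act (loop x_pos m) f)"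
  unfolding fock_act_loop
  by (rule quad_cre[OF affine_matrix_loop_band[OF order_refl]]) (auto simp: affine_matrix_loop x_pos_entry)

text \<open>A translation operator annihilating \<open>vac a b\<close>: it moves a mode of color 1 (2) one step
  down with coefficient vanishing at the surface \<open>a\<close> (\<open>b\<close>) of the sea.\<close>
definition translation_matrix :: "int \<Rightarrow> int \<Rightarrow> mode_matrix" where
  "translation_matrix a b p q = (if fst p = fst q \<and> snd p = snd q - 1
     then of_int ((if fst q = 1 then a else b) - snd q) else 0)"

definition translation :: "int \<Rightarrow> int \<Rightarrow> fock \<Rightarrow> fock" where
  "translation a b = quad (translation_matrix a b)"

lemma translation_vac: "translation a b (vac a b) = 0"
  unfolding translation_def
  by (rule quad_vac_eq_0) (auto simp: translation_matrix_def in_sea_def split: if_splits)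

lemma translation_add: "translation a b (f + g) = translation a b f + translation a b g"
  by (simp add: fun_eq_iff translation_def quad_add_arg)

lemma translation_scale: "translation a b (fock_scale c f) = fock_scale c (translation a b f)"
proof -
  have "fock_scale c f = (\<lambda>D. c * f D)" by (simp add: fun_eq_iff fock_scale_def)
  then have "quad M (fock_scale c f) D = c * quad M f D" for M D by (simp only: quad_scale_arg)
  then show ?thesis by (simp add: fun_eq_iff translation_def fock_scale_def)
qed

text \<open>On C^2 tensored with C[t, t^-1] the translation matrix is -d/dt + diag(a, b) t^-1. In
  the commutator with x_alpha t^m the derivative contributes -m t^(m-1) and the diagonal part (a -
  b) t^(m-1). The central term is 0, since the product of a color-preserving and a color-changing
  matrix has zero diagonal.\<close>

lemma translation_xp:
  "translation a b (fock_act (loop x_pos m) f)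
    = fock_act (loop x_pos m) (translation a b f) + fock_scale (of_int (a - b - m)) (fock_act (loop x_pos (m - 1)) f)"
proof
  fix D
  let ?T = "translation_matrix a b" and ?M = "affine_matrix (loop x_pos m)"
  let ?K = "\<lambda>p q. of_int (a - b - m) * affine_matrix (loop x_pos (m - 1)) p q"
  have bK: "band (1 + \<bar>m\<bar>) (affine_matrix (loop x_pos (m - 1)))" by (rule affine_matrix_loop_band) simp
  have "quad ?T (quad ?M f) D - quad ?M (quad ?T f) D = quad ?K f D + 0 * f D"
  proof (rule quad_commutator[where b = "1 + \<bar>m\<bar>"])
    show "band (1 + \<bar>m\<bar>) ?T" by (auto simp: band_def translation_matrix_def)
    show "band (1 + \<bar>m\<bar>) ?M" by (rule affine_matrix_loop_band) simp
    show "band (1 + \<bar>m\<bar>) ?K" using bK unfolding band_def by (metis mult_zero_right)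
  next
    fix p s :: mode and n :: int assume n: "1 + \<bar>m\<bar> + \<bar>snd p\<bar> \<le> n"
    let ?q = "(fst p, snd p + 1)" and ?r = "(fst s, snd s - 1)"
    have "(\<Sum>q\<in>window n. ?T p q * ?M q s) = (\<Sum>q\<in>window n. if q = ?q then ?T p ?q * ?M ?q s else 0)"
      by (intro sum.cong refl) (auto simp: translation_matrix_def prod_eq_iff)
    also have "\<dots> = ?T p ?q * ?M ?q s" using n by (subst sum.delta, simp) (auto simp: window_def)
    finally have 1: "(\<Sum>q\<in>window n. ?T p q * ?M q s) = ?T p ?q * ?M ?q s" .
    have "(\<Sum>q\<in>window n. ?M p q * ?T q s) = (\<Sum>q\<in>window n. if q = ?r then ?M p ?r * ?T ?r s else 0)"
      by (intro sum.cong refl) (auto simp: translation_matrix_def prod_eq_iff)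
    also have "\<dots> = ?M p ?r * ?T ?r s"
      using n by (subst sum.delta, simp) (auto simp: window_def affine_matrix_loop)
    finally have 2: "(\<Sum>q\<in>window n. ?M p q * ?T q s) = ?M p ?r * ?T ?r s" .
    show "?K p s = (\<Sum>q\<in>window n. ?T p q * ?M q s - ?M p q * ?T q s)"
      unfolding sum_subtractf 1 2
      by (auto simp: translation_matrix_def affine_matrix_loop x_pos_entry algebra_simps)
        (metis of_int_1 of_int_add)
  next
    fix n
    have z: "?T p q * ?M q p = 0" "?M p q * ?T q p = 0" for p q
      by (auto simp: translation_matrix_def affine_matrix_loop x_pos_entry)
    show "(\<Sum>p\<in>{p\<in>window n. 0 \<le> snd p}. \<Sum>q\<in>{q\<in>window n. snd q < 0}. ?T p q * ?M q p - ?M p q * ?T q p) = 0"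
      unfolding z by simp
  qed simp
  then show "translation a b (fock_act (loop x_pos m) f) D = (fock_act (loop x_pos m) (translation a b f)
      + fock_scale (of_int (a - b - m)) (fock_act (loop x_pos (m - 1)) f)) D"
    using quad_scale[OF bK, of "of_int (a - b - m)" f D]
    by (simp add: translation_def fock_act_loop fock_scale_def diff_eq_eq add.commute)
qed

section \<open>The quadratic ideals\<close>

lemma U_nbar_le_0 [simp]: "0 \<in> U_nbar_le k"
  by (simp add: U_nbar_le_def)

lemma U_nbar_le_single: "c = 0 \<or> Poly_Mapping.keys e \<subseteq> {..k} \<Longrightarrow> Poly_Mapping.single e c \<in> U_nbar_le k"
  by (auto simp: U_nbar_le_def)

lemma U_nbar_le_1 [simp]: "1 \<in> U_nbar_le k"
  unfolding one_poly_mapping_def[folded single_one, symmetric]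
  by (simp add: U_nbar_le_def)

lemma U_nbar_le_add: "p \<in> U_nbar_le k \<Longrightarrow> q \<in> U_nbar_le k \<Longrightarrow> p + q \<in> U_nbar_le k"
  using keys_add[of p q] by (fastforce simp: U_nbar_le_def)

lemma U_nbar_le_uminus: "p \<in> U_nbar_le k \<Longrightarrow> - p \<in> U_nbar_le k"
  by (simp add: U_nbar_le_def)

lemma U_nbar_le_sum: "(\<And>i. i \<in> A \<Longrightarrow> f i \<in> U_nbar_le k) \<Longrightarrow> sum f A \<in> U_nbar_le k"
  by (induction A rule: infinite_finite_induct) (auto intro: U_nbar_le_add)

lemma U_nbar_le_mult:
  assumes "p \<in> U_nbar_le k" "q \<in> U_nbar_le k" shows "p * q \<in> U_nbar_le k"
proof -
  have "Poly_Mapping.keys e \<subseteq> {..k}" if e: "e \<in> Poly_Mapping.keys (p * q)" for e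
  proof -
    obtain e1 e2 where "e = e1 + e2" "e1 \<in> Poly_Mapping.keys p" "e2 \<in> Poly_Mapping.keys q"
      using e keys_mult[of p q] by blast
    then show ?thesis using assms keys_add[of e1 e2] unfolding U_nbar_le_def by blast
  qed
  then show ?thesis by (simp add: U_nbar_le_def)
qed

lemma U_nbar_le_xvar: "m \<le> k \<Longrightarrow> xvar m \<in> U_nbar_le k"
  unfolding xvar_def by (rule U_nbar_le_single) simp

lemma U_nbar_le_mono: "k \<le> l \<Longrightarrow> p \<in> U_nbar_le k \<Longrightarrow> p \<in> U_nbar_le l"
  unfolding U_nbar_le_def by fastforce

lemma U_nbar_le_keys_subset:
  "p \<in> U_nbar_le k \<Longrightarrow> Poly_Mapping.keys q \<subseteq> Poly_Mapping.keys p \<Longrightarrow> q \<in> U_nbar_le k"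
  unfolding U_nbar_le_def by blast

text \<open>The values -1 and -2 of \<open>k\<close> give \<open>I_Lambda0\<close> and
  \<open>I_Lambda1'\<close>; the induction over seas passes through smaller \<open>k\<close>. The
  bound \<open>-2 * k\<close> is the least \<open>t\<close> for which the sum has a term.\<close>

definition quad_ideal :: "int \<Rightarrow> U_nbar set" where
  "quad_ideal k = ideal_sum (U_nbar_le k) {-2 * k..} (quad_sum k)"

lemma quad_ideal_gen:
  assumes "a \<in> U_nbar_le k" "t \<ge> -2 * k" shows "a * quad_sum k t \<in> quad_ideal k"
  unfolding quad_ideal_def ideal_sum_def mem_Collect_eq
  by (rule exI[of _ "{t}"], rule exI[of _ "\<lambda>_. a"]) (use assms in simp)

lemma quad_ideal_0: "0 \<in> quad_ideal k"
  using quad_ideal_gen[of 0 k "-2 * k"] by simp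

lemma quad_ideal_add:
  assumes "p \<in> quad_ideal k" "q \<in> quad_ideal k" shows "p + q \<in> quad_ideal k"
proof -
  obtain F a where F: "p = (\<Sum>t\<in>F. a t * quad_sum k t)" "finite F" "F \<subseteq> {-2*k..}" "\<forall>t\<in>F. a t \<in> U_nbar_le k"
    using assms(1) unfolding quad_ideal_def ideal_sum_def by blast
  obtain G b where G: "q = (\<Sum>t\<in>G. b t * quad_sum k t)" "finite G" "G \<subseteq> {-2*k..}" "\<forall>t\<in>G. b t \<in> U_nbar_le k"
    using assms(2) unfolding quad_ideal_def ideal_sum_def by blast
  define c where "c t = (if t \<in> F then a t else 0) + (if t \<in> G then b t else 0)" for t
  have "p = (\<Sum>t\<in>F \<union> G. (if t \<in> F then a t else 0) * quad_sum k t)"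
    unfolding F(1) by (rule sum.mono_neutral_cong_left) (use F G in auto)
  moreover have "q = (\<Sum>t\<in>F \<union> G. (if t \<in> G then b t else 0) * quad_sum k t)"
    unfolding G(1) by (rule sum.mono_neutral_cong_left) (use F G in auto)
  ultimately have "p + q = (\<Sum>t\<in>F \<union> G. c t * quad_sum k t)"
    by (simp add: c_def distrib_right sum.distrib)
  moreover have "\<forall>t\<in>F \<union> G. c t \<in> U_nbar_le k"
    using F(4) G(4) unfolding c_def by (auto intro!: U_nbar_le_add)
  ultimately show ?thesis unfolding quad_ideal_def ideal_sum_def mem_Collect_eq
    by (intro exI[of _ "F \<union> G"] exI[of _ c]) (use F G in auto)
qed

lemma quad_ideal_induct [consumes 1, case_names zero gen add]:
  assumes "p \<in> quad_ideal k" "P 0" "\<And>a t. a \<in> U_nbar_le k \<Longrightarrow> t \<ge> -2 * k \<Longrightarrow> P (a * quad_sum k t)"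
    "\<And>x y. P x \<Longrightarrow> P y \<Longrightarrow> P (x + y)"
  shows "P p"
proof -
  obtain F a where F: "p = (\<Sum>t\<in>F. a t * quad_sum k t)" "finite F" "F \<subseteq> {-2*k..}" "\<forall>t\<in>F. a t \<in> U_nbar_le k"
    using assms(1) unfolding quad_ideal_def ideal_sum_def by blast
  have "P (\<Sum>t\<in>G. a t * quad_sum k t)" if "finite G" "G \<subseteq> F" for G
    using that by (induction G rule: finite_induct) (use F assms in auto)
  then show ?thesis using F by simp
qed

lemma quad_ideal_mult: "p \<in> quad_ideal k \<Longrightarrow> a \<in> U_nbar_le k \<Longrightarrow> a * p \<in> quad_ideal k"
proof (induction rule: quad_ideal_induct)
  case (gen b t)
  then show ?case using quad_ideal_gen[OF U_nbar_le_mult, of a k b t] by (simp add: mult.assoc)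
qed (auto simp: quad_ideal_0 distrib_left intro: quad_ideal_add)

lemma quad_ideal_uminus: "p \<in> quad_ideal k \<Longrightarrow> - p \<in> quad_ideal k"
  using quad_ideal_mult[of p k "-1"] U_nbar_le_uminus[of 1 k] by simp

lemma quad_ideal_diff: "p \<in> quad_ideal k \<Longrightarrow> q \<in> quad_ideal k \<Longrightarrow> p - q \<in> quad_ideal k"
  using quad_ideal_add[of p k "- q"] quad_ideal_uminus[of q k] by simp

lemma quad_sum_eq: "quad_sum k t = (\<Sum>m\<in>{-t-k..k}. xvar m * xvar (-t-m))"
proof -
  have "m1 + m2 = -t \<longleftrightarrow> m2 = -t-m1" for m1 m2 by auto
  then show ?thesis
    unfolding quad_sum_def
    by (simp only:) (rule sum.reindex_bij_witness[where i = "\<lambda>m. (m, -t-m)" and j = fst], auto)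
qed

text \<open>Only the two extreme terms contain x(k). They coincide when t = -2k, so the cofactor is
  x(k) there and 2 x(-t-k) for larger t.\<close>

lemma quad_sum_step:
  "\<exists>c\<in>U_nbar_le k. quad_sum k t = quad_sum (k - 1) t + c * xvar k"
proof -
  consider "-t-k > k" | "-t-k = k" | "-t-k < k" by linarith
  then show ?thesis
  proof cases
    case 1
    then show ?thesis by (intro bexI[of _ 0]) (simp_all add: quad_sum_eq)
  next
    case 2
    then have "t = -2 * k" by simp
    then show ?thesis by (intro bexI[of _ "xvar k"]) (simp_all add: quad_sum_eq U_nbar_le_xvar)
  next
    case 3
    define l where "l = -t-k"
    have e: "-t-l = k" "-t-k = l" "l < k" using 3 by (auto simp: l_def)
    have "{l..k} = insert l (insert k {l+1..k-1})" using e by auto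
    then have "quad_sum k t = xvar l * xvar (-t-l) + (xvar k * xvar (-t-k) + (\<Sum>m\<in>{l+1..k-1}. xvar m * xvar (-t-m)))"
      using e(3) by (simp add: quad_sum_eq l_def)
    also have "(\<Sum>m\<in>{l+1..k-1}. xvar m * xvar (-t-m)) = quad_sum (k - 1) t"
      by (simp add: quad_sum_eq l_def algebra_simps)
    finally have "quad_sum k t = quad_sum (k - 1) t + (xvar l + xvar l) * xvar k"
      unfolding e by (simp add: algebra_simps)
    then show ?thesis using e(3) by (intro bexI[of _ "xvar l + xvar l"] U_nbar_le_add U_nbar_le_xvar) auto
  qed
qed

lemma quad_sum_bottom: "quad_sum k (-2 * k) = xvar k * xvar k"
  by (simp add: quad_sum_eq)

lemma xvar_square_in_quad_ideal: "xvar k * xvar k \<in> quad_ideal k"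
  using quad_ideal_gen[of 1 k "-2 * k"] quad_sum_bottom[of k] by simp

lemma xvar_adjacent_in_quad_ideal: "xvar (k - 1) * xvar k \<in> quad_ideal k"
proof -
  let ?half = "Poly_Mapping.single 0 (1/2) :: U_nbar"
  have "{k-1..k} = {k-1, k}" by auto
  then have "quad_sum k (1 - 2 * k) = xvar (k - 1) * xvar k + xvar (k - 1) * xvar k"
    by (simp add: quad_sum_eq mult.commute)
  then have "?half * quad_sum k (1 - 2 * k) = (?half + ?half) * (xvar (k - 1) * xvar k)"
    by (simp add: algebra_simps)
  also have "?half + ?half = 1" by (simp add: single_add[symmetric])
  finally show ?thesis using quad_ideal_gen[of ?half k "1 - 2 * k"] by (simp add: U_nbar_le_single)
qed

text \<open>Generators of the two ideals with the same \<open>t\<close> differ by a multiple of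
  x(k). For k = -1 this passes from \<open>R1\<close> to \<open>R0\<close> with x(-1)
  adjoined.\<close>

lemma quad_ideal_lower:
  "p \<in> quad_ideal (k - 1) \<Longrightarrow> \<exists>q b. q \<in> quad_ideal k \<and> b \<in> U_nbar_le k \<and> p = q + b * xvar k"
proof (induction rule: quad_ideal_induct)
  case zero
  show ?case by (rule exI[of _ 0], rule exI[of _ 0]) (simp add: quad_ideal_0)
next
  case (gen a t)
  have a: "a \<in> U_nbar_le k" using U_nbar_le_mono[OF _ gen(1)] by simp
  obtain c where c: "c \<in> U_nbar_le k" "quad_sum k t = quad_sum (k - 1) t + c * xvar k"
    using quad_sum_step by blast
  show ?case
  proof (intro exI conjI)
    show "a * quad_sum k t \<in> quad_ideal k" using quad_ideal_gen a gen by simp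
    show "- (a * c) \<in> U_nbar_le k" by (intro U_nbar_le_uminus U_nbar_le_mult a c)
    show "a * quad_sum (k - 1) t = a * quad_sum k t + - (a * c) * xvar k" by (simp add: c(2) algebra_simps)
  qed
next
  case (add x y)
  then obtain q b q' b' where "q \<in> quad_ideal k" "b \<in> U_nbar_le k" "x = q + b * xvar k"
    "q' \<in> quad_ideal k" "b' \<in> U_nbar_le k" "y = q' + b' * xvar k" by blast
  then show ?case
    by (intro exI[of _ "q + q'"] exI[of _ "b + b'"]) (auto simp: algebra_simps intro: quad_ideal_add U_nbar_le_add)
qed

text \<open>Multiplication by x(k) makes the correction terms with x(k) and x(k - 1) harmless,
  because x(k)^2 and x(k - 1) x(k) are in the ideal, coming from t = -2k and t = 1 - 2k. Knowledge
  about the sea reached by x_alpha(k) is pulled back this way.\<close>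

lemma quad_ideal_lower2_mult_xvar: "p \<in> quad_ideal (k - 2) \<Longrightarrow> p * xvar k \<in> quad_ideal k"
proof (induction rule: quad_ideal_induct)
  case (gen a t)
  have a: "a \<in> U_nbar_le k" using U_nbar_le_mono[OF _ gen(1)] by simp
  obtain c where c: "c \<in> U_nbar_le k" "quad_sum k t = quad_sum (k - 1) t + c * xvar k"
    using quad_sum_step by blast
  obtain d where d: "d \<in> U_nbar_le (k - 1)" "quad_sum (k - 1) t = quad_sum (k - 2) t + d * xvar (k - 1)"
    using quad_sum_step[of "k - 1" t] by auto
  have d': "d \<in> U_nbar_le k" using U_nbar_le_mono[OF _ d(1)] by simp
  have "a * quad_sum (k - 2) t * xvar k = (a * xvar k) * quad_sum k t - (a * c) * (xvar k * xvar k)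
      - (a * d) * (xvar (k - 1) * xvar k)"
    using c(2) d(2) by (simp add: algebra_simps)
  also have "\<dots> \<in> quad_ideal k"
    by (intro quad_ideal_diff quad_ideal_mult xvar_square_in_quad_ideal xvar_adjacent_in_quad_ideal U_nbar_le_mult a c d' quad_ideal_gen)
      (use gen in \<open>auto intro: U_nbar_le_xvar\<close>)
  finally show ?case .
qed (auto simp: quad_ideal_0 distrib_right intro: quad_ideal_add)

text \<open>Monomials are separated by divisibility by x(k). The last conjunct hands weight bounds
  on \<open>p\<close> over to \<open>a\<close>.\<close>

lemma U_nbar_le_step:
  assumes "p \<in> U_nbar_le k"
  shows "\<exists>a b. a \<in> U_nbar_le (k - 1) \<and> b \<in> U_nbar_le k \<and> p = a + b * xvar k
    \<and> Poly_Mapping.keys a \<subseteq> Poly_Mapping.keys p"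
proof -
  let ?s = "Poly_Mapping.single k 1 :: int \<Rightarrow>\<^sub>0 nat"
  define A where "A = {e\<in>Poly_Mapping.keys p. Poly_Mapping.lookup e k = 0}"
  define B where "B = {e\<in>Poly_Mapping.keys p. Poly_Mapping.lookup e k \<noteq> 0}"
  define a where "a = (\<Sum>e\<in>A. Poly_Mapping.single e (Poly_Mapping.lookup p e))"
  define b where "b = (\<Sum>e\<in>B. Poly_Mapping.single (e - ?s) (Poly_Mapping.lookup p e))"
  have fin: "finite A" "finite B" by (auto simp: A_def B_def)
  have kp: "Poly_Mapping.keys e \<subseteq> {..k}" if "e \<in> Poly_Mapping.keys p" for e
    using assms that by (auto simp: U_nbar_le_def)
  have "p = (\<Sum>e\<in>A \<union> B. Poly_Mapping.single e (Poly_Mapping.lookup p e))"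
  proof -
    have "A \<union> B = Poly_Mapping.keys p" by (auto simp: A_def B_def)
    then show ?thesis using poly_mapping_sum_single[of p] by simp
  qed
  also have "\<dots> = a + (\<Sum>e\<in>B. Poly_Mapping.single e (Poly_Mapping.lookup p e))"
    unfolding a_def by (rule sum.union_disjoint) (auto simp: A_def B_def)
  also have "(\<Sum>e\<in>B. Poly_Mapping.single e (Poly_Mapping.lookup p e)) = b * xvar k"
    unfolding b_def sum_distrib_right
  proof (rule sum.cong)
    fix e assume "e \<in> B"
    then have "e - ?s + ?s = e"
      by (intro poly_mapping_eqI) (auto simp: B_def lookup_add lookup_minus lookup_single when_def)
    then show "Poly_Mapping.single e (Poly_Mapping.lookup p e) = Poly_Mapping.single (e - ?s) (Poly_Mapping.lookup p e) * xvar k"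
      by (simp add: xvar_def mult_single)
  qed simp
  finally have "p = a + b * xvar k" .
  moreover have "a \<in> U_nbar_le (k - 1)"
    unfolding a_def
  proof (intro U_nbar_le_sum U_nbar_le_single disjI2 subsetI)
    fix e m assume e: "e \<in> A" "m \<in> Poly_Mapping.keys e"
    then have "m \<le> k" using kp[of e] by (auto simp: A_def)
    moreover have "m \<noteq> k" using e by (auto simp: A_def in_keys_iff)
    ultimately show "m \<in> {..k - 1}" by simp
  qed
  moreover have "b \<in> U_nbar_le k"
    unfolding b_def
  proof (intro U_nbar_le_sum U_nbar_le_single disjI2 subsetI)
    fix e m assume e: "e \<in> B" "m \<in> Poly_Mapping.keys (e - ?s)"
    then have "m \<in> Poly_Mapping.keys e" by (auto simp: in_keys_iff lookup_minus)
    then show "m \<in> {..k}" using kp[of e] e(1) by (auto simp: B_def)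
  qed
  moreover have "Poly_Mapping.keys a \<subseteq> Poly_Mapping.keys p"
  proof -
    have "Poly_Mapping.keys a \<subseteq> (\<Union>e\<in>A. Poly_Mapping.keys (Poly_Mapping.single e (Poly_Mapping.lookup p e)))"
      unfolding a_def by (rule keys_sum)
    then show ?thesis by (auto simp: A_def split: if_splits)
  qed
  ultimately show ?thesis by blast
qed

section \<open>Weights and truncation\<close>

definition wt :: "int \<Rightarrow> (int \<Rightarrow>\<^sub>0 nat) \<Rightarrow> int" where
  "wt k e = (\<Sum>m\<in>Poly_Mapping.keys e. int (Poly_Mapping.lookup e m) * (k + 1 - m))"

lemma wt_superset:
  "finite S \<Longrightarrow> Poly_Mapping.keys e \<subseteq> S \<Longrightarrow> wt k e = (\<Sum>m\<in>S. int (Poly_Mapping.lookup e m) * (k + 1 - m))"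
  unfolding wt_def by (rule sum.mono_neutral_left) (auto simp: in_keys_iff)

lemma wt_add: "wt k (e + e') = wt k e + wt k e'"
proof -
  define S where "S = Poly_Mapping.keys e \<union> Poly_Mapping.keys e'"
  have S: "finite S" "Poly_Mapping.keys e \<subseteq> S" "Poly_Mapping.keys e' \<subseteq> S" "Poly_Mapping.keys (e + e') \<subseteq> S"
    using keys_add[of e e'] by (auto simp: S_def)
  show ?thesis
    unfolding wt_superset[OF S(1,2)] wt_superset[OF S(1,3)] wt_superset[OF S(1,4)]
    by (simp add: lookup_add sum.distrib[symmetric] algebra_simps)
qed

lemma wt_single: "wt k (Poly_Mapping.single m (Suc 0)) = k + 1 - m"
  by (simp add: wt_def)

lemma wt_zero [simp]: "wt k 0 = 0"
  by (simp add: wt_def)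

text \<open>Each variable loses one unit when \<open>k\<close> drops by one, so a monomial loses its
  total degree. The offset \<open>k + 1\<close> gives every x(m) with m <= k a weight of at least
  1.\<close>

lemma wt_shift: "wt (k - 1) e \<le> wt k e" "e \<noteq> 0 \<Longrightarrow> wt (k - 1) e < wt k e"
proof -
  have d: "wt k e = wt (k - 1) e + (\<Sum>m\<in>Poly_Mapping.keys e. int (Poly_Mapping.lookup e m))"
    unfolding wt_def sum.distrib[symmetric] by (rule sum.cong) (simp_all add: algebra_simps)
  show "wt (k - 1) e \<le> wt k e" unfolding d by (simp add: sum_nonneg)
  assume "e \<noteq> 0"
  then have "Poly_Mapping.keys e \<noteq> {}" by simp
  then have "(\<Sum>m\<in>Poly_Mapping.keys e. int (Poly_Mapping.lookup e m)) > 0"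
    by (intro sum_pos) (auto simp: in_keys_iff)
  then show "wt (k - 1) e < wt k e" unfolding d by simp
qed

lemma wt_nonpos:
  assumes "Poly_Mapping.keys e \<subseteq> {..k}" "wt k e \<le> 0" shows "e = 0"
proof (rule ccontr)
  assume "e \<noteq> 0"
  then have "Poly_Mapping.keys e \<noteq> {}" by simp
  then have "wt k e > 0" unfolding wt_def
  proof (rule sum_pos[rotated])
    fix m assume "m \<in> Poly_Mapping.keys e"
    then have "m \<le> k" "Poly_Mapping.lookup e m > 0" using assms(1) by (blast, simp add: in_keys_iff)
    then show "0 < int (Poly_Mapping.lookup e m) * (k + 1 - m)" by (intro mult_pos_pos) auto
  qed simp
  then show False using assms(2) by simp
qed

text \<open>The generators \<open>quad_sum k t\<close> are homogeneous, so cutting off at a weight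
  preserves \<open>quad_ideal k\<close>. The kernel proof uses this to bound the weight of a
  cofactor obtained from existence statements.\<close>

definition trunc :: "int \<Rightarrow> int \<Rightarrow> U_nbar \<Rightarrow> U_nbar" where
  "trunc k n p = (\<Sum>e\<in>Poly_Mapping.keys p. if wt k e \<le> n then Poly_Mapping.single e (Poly_Mapping.lookup p e) else 0)"

lemma lookup_trunc: "Poly_Mapping.lookup (trunc k n p) e = (if wt k e \<le> n then Poly_Mapping.lookup p e else 0)"
proof -
  have "Poly_Mapping.lookup (trunc k n p) e
    = (\<Sum>e'\<in>Poly_Mapping.keys p. if e = e' then (if wt k e \<le> n then Poly_Mapping.lookup p e else 0) else 0)"
    unfolding trunc_def lookup_sum by (rule sum.cong) (auto simp: lookup_single when_def)
  then show ?thesis by (subst (asm) sum.delta') (auto simp: in_keys_iff)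
qed

lemma keys_trunc: "Poly_Mapping.keys (trunc k n p) = {e\<in>Poly_Mapping.keys p. wt k e \<le> n}"
  by (auto simp: in_keys_iff lookup_trunc split: if_splits)

lemma trunc_add: "trunc k n (p + q) = trunc k n p + trunc k n q"
  by (rule poly_mapping_eqI) (simp add: lookup_trunc lookup_add)

lemma trunc_zero [simp]: "trunc k n 0 = 0"
  by (simp add: trunc_def)

lemma trunc_sum: "trunc k n (sum f A) = (\<Sum>i\<in>A. trunc k n (f i))"
  by (induction A rule: infinite_finite_induct) (simp_all add: trunc_add)

lemma trunc_single: "trunc k n (Poly_Mapping.single e c) = (if wt k e \<le> n then Poly_Mapping.single e c else 0)"
  by (rule poly_mapping_eqI) (auto simp: lookup_trunc lookup_single when_def)

lemma trunc_id: "(\<And>e. e \<in> Poly_Mapping.keys p \<Longrightarrow> wt k e \<le> n) \<Longrightarrow> trunc k n p = p"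
  by (rule poly_mapping_eqI) (auto simp: lookup_trunc in_keys_iff)

lemma trunc_mult:
  assumes "\<And>e. e \<in> Poly_Mapping.keys r \<Longrightarrow> wt k e = w"
  shows "trunc k n (p * r) = trunc k (n - w) p * r"
proof -
  have "p * r = (\<Sum>e\<in>Poly_Mapping.keys p. Poly_Mapping.single e (Poly_Mapping.lookup p e))
      * (\<Sum>e\<in>Poly_Mapping.keys r. Poly_Mapping.single e (Poly_Mapping.lookup r e))"
    by (simp only: poly_mapping_sum_single[symmetric])
  also have "\<dots> = (\<Sum>e\<in>Poly_Mapping.keys p. \<Sum>f\<in>Poly_Mapping.keys r.
      Poly_Mapping.single (e + f) (Poly_Mapping.lookup p e * Poly_Mapping.lookup r f))"
    by (simp only: sum_product mult_single)
  finally have "trunc k n (p * r) = (\<Sum>e\<in>Poly_Mapping.keys p. \<Sum>f\<in>Poly_Mapping.keys r.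
      if wt k e \<le> n - w then Poly_Mapping.single (e + f) (Poly_Mapping.lookup p e * Poly_Mapping.lookup r f) else 0)"
    using assms by (simp add: trunc_sum trunc_single wt_add algebra_simps cong: sum.cong)
  also have "\<dots> = trunc k (n - w) p * (\<Sum>e\<in>Poly_Mapping.keys r. Poly_Mapping.single e (Poly_Mapping.lookup r e))"
    unfolding trunc_def sum_product by (intro sum.cong refl) (simp add: mult_single)
  finally show ?thesis by (simp only: poly_mapping_sum_single[symmetric])
qed

lemma trunc_mult_xvar: "trunc k n (p * xvar k) = trunc k (n - 1) p * xvar k"
  by (rule trunc_mult) (simp add: xvar_def wt_single)

lemma wt_quad_sum:
  assumes "e \<in> Poly_Mapping.keys (quad_sum k t)" shows "wt k e = 2 * (k + 1) + t"
proof -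
  have "Poly_Mapping.keys (quad_sum k t) \<subseteq> (\<Union>m\<in>{-t-k..k}. Poly_Mapping.keys (xvar m * xvar (-t-m)))"
    unfolding quad_sum_eq by (rule keys_sum)
  then obtain m where "e \<in> Poly_Mapping.keys (xvar m * xvar (-t-m))" using assms by blast
  then have "e = Poly_Mapping.single m 1 + Poly_Mapping.single (-t-m) 1"
    by (simp add: xvar_def mult_single)
  then show ?thesis by (simp add: wt_add wt_single)
qed

lemma trunc_in_U: "p \<in> U_nbar_le k \<Longrightarrow> trunc l n p \<in> U_nbar_le k"
  by (rule U_nbar_le_keys_subset) (auto simp: keys_trunc)

lemma trunc_in_quad_ideal: "p \<in> quad_ideal k \<Longrightarrow> trunc k n p \<in> quad_ideal k"
proof (induction rule: quad_ideal_induct)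
  case (gen a t)
  have "trunc k n (a * quad_sum k t) = trunc k (n - (2 * (k + 1) + t)) a * quad_sum k t"
    by (rule trunc_mult) (rule wt_quad_sum)
  then show ?case using quad_ideal_gen[OF trunc_in_U[OF gen(1)] gen(2)] by simp
qed (auto simp: quad_ideal_0 trunc_add intro: quad_ideal_add)

section \<open>Kernels on Fock space\<close>

context affine_module
begin

lemma U_act_scalar: "U_act scl act (Poly_Mapping.single 0 c) w = scl c w"
  by (simp add: U_act_single mono_act_def)

lemma U_act_intertwine:
  assumes add: "\<And>u w. T (u + w) = T u + T w" and scale: "\<And>c w. T (scl c w) = scl c (T w)"
    and comm: "\<And>m w. T (act (loop x_pos m) w) = act (loop x_pos m) (T w)"
  shows "U_act scl act p (T w) = T (U_act scl act p w)"
proof -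
  have T0: "T 0 = 0" using scale[of 0 0] by simp
  have Ts: "T (sum g A) = (\<Sum>i\<in>A. T (g i))" for g and A :: "(int \<Rightarrow>\<^sub>0 nat) set"
    by (induction A rule: infinite_finite_induct) (simp_all add: T0 add)
  have pow: "(act (loop x_pos m) ^^ k) (T w) = T ((act (loop x_pos m) ^^ k) w)" for m k w
    by (induction k) (simp_all add: comm)
  have "foldr (\<lambda>m. act (loop x_pos m) ^^ g m) xs (T w) = T (foldr (\<lambda>m. act (loop x_pos m) ^^ g m) xs w)" for g xs
    by (induction xs) (simp_all add: pow)
  then show ?thesis by (simp add: U_act_def mono_act_def Ts scale)
qed

lemma U_act_quad_sum:
  "U_act scl act (quad_sum k t) w = (\<Sum>m\<in>{-t-k..k}. act (loop x_pos m) (act (loop x_pos (-t-m)) w))"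
  by (simp add: quad_sum_eq U_act_sum U_act_mult U_act_xvar)

end

abbreviation fock_U :: "U_nbar \<Rightarrow> fock \<Rightarrow> fock" where
  "fock_U \<equiv> U_act fock_scale fock_act"

lemma fock_U_cre: "fock_U p (cre (1, i) f) = cre (1, i) (fock_U p f)"
proof (rule fock.U_act_intertwine)
  show "cre (1, i) (fock_scale c w) = fock_scale c (cre (1, i) w)" for c w
    by (simp add: cre_def fock_scale_def fun_eq_iff)
qed (rule cre_linear(1), rule xp_cre[symmetric])

lemma fock_scale_eq_0: "c \<noteq> 0 \<Longrightarrow> fock_scale c f = 0 \<Longrightarrow> f = 0"
  by (simp add: fock_scale_def fun_eq_iff)

text \<open>With k = a - b - 1, x(k) carries the sea to \<open>vac (a - 1) (b + 1)\<close>, which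
  x(k) kills; this is the case t = -2k. The translation operator kills the sea and turns the
  relation for t into 2k + 1 + t times the relation for t + 1, and this factor is positive.\<close>

lemma fock_U_quad_sum_vac:
  assumes "t \<ge> -2 * (a - b - 1)"
  shows "fock_U (quad_sum (a - b - 1) t) (vac a b) = 0"
  using assms
proof (induction t rule: int_ge_induct)
  case base
  obtain c where c: "fock_act (loop x_pos (a - b - 1)) (vac a b) = fock_scale c (vac (a - 1) (b + 1))"
    using xp_vac_edge by blast
  have "fock_act (loop x_pos (a - b - 1)) (vac (a - 1) (b + 1)) = 0" by (rule xp_vac) simp
  then show ?case
    unfolding quad_sum_bottom fock.U_act_mult fock.U_act_xvar c fock_act_scale_right
    by (simp only: fock.scale_zero_right)
next
  case (step t)
  define k where "k = a - b - 1"
  define X where "X = (\<lambda>m. fock_act (loop x_pos m))"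
  define l where "l = - t - k"
  have l: "l \<le> k" using step by (simp add: l_def k_def)
  have TX: "translation a b (X m f) = X m (translation a b f) + fock_scale (of_int (k + 1 - m)) (X (m - 1) f)" for m f
    using translation_xp[of a b m f] by (simp add: X_def k_def)
  have X0: "X m 0 = 0" and Xa: "X m (f + g) = X m f + X m g" and Xs: "X m (fock_scale c f) = fock_scale c (X m f)" for m f g c
    by (simp_all add: X_def fock.act_zero_right fock_act_add_right fock_act_scale_right)
  have Ts: "translation a b (sum g A) = (\<Sum>i\<in>A. translation a b (g i))" for g and A :: "int set"
  proof -
    have "translation a b 0 = 0" using translation_scale[of a b 0 0] by (simp add: fock_scale_def fun_eq_iff)
    then show ?thesis by (induction A rule: infinite_finite_induct) (simp_all add: translation_add)
  qed
  have TXX: "translation a b (X m (X (- t - m) (vac a b)))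
     = fock_scale (of_int (k + 1 + t + m)) (X m (X (- (t + 1) - m) (vac a b)))
      + fock_scale (of_int (k + 1 - m)) (X (m - 1) (X (- (t + 1) - (m - 1)) (vac a b)))" for m
  proof -
    have e: "- t - m - 1 = - (t + 1) - m" "- (t + 1) - (m - 1) = - t - m" "k + 1 - (- t - m) = k + 1 + t + m" by auto
    show ?thesis unfolding TX translation_vac X0 Xa Xs e by simp
  qed
  have "fock_U (quad_sum k t) (vac a b) = 0" unfolding k_def by (rule step.IH)
  then have "0 = translation a b (\<Sum>m\<in>{l..k}. X m (X (- t - m) (vac a b)))"
    using Ts[of "\<lambda>_. 0" "{}"] by (simp add: fock.U_act_quad_sum X_def l_def)
  also have "\<dots> = (\<Sum>m\<in>{l..k}. fock_scale (of_int (k + 1 + t + m)) (X m (X (- (t + 1) - m) (vac a b))))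
      + (\<Sum>m\<in>{l..k}. fock_scale (of_int (k + 1 - m)) (X (m - 1) (X (- (t + 1) - (m - 1)) (vac a b))))"
    unfolding Ts TXX sum.distrib ..
  also have "(\<Sum>m\<in>{l..k}. fock_scale (of_int (k + 1 + t + m)) (X m (X (- (t + 1) - m) (vac a b))))
      = (\<Sum>m\<in>{l-1..k}. fock_scale (of_int (k + 1 + t + m)) (X m (X (- (t + 1) - m) (vac a b))))"
  \<comment> \<open>The added index l - 1 has coefficient k + t + l = 0, and in the shifted second
    sum the added index k has coefficient 0. Both sums then run over the index set of
    \<open>quad_sum k (t + 1)\<close>, and their coefficients add up to 2k + 1 + t for every
    m.\<close>
  proof (rule sum.mono_neutral_left)
    show "\<forall>m\<in>{l-1..k} - {l..k}. fock_scale (of_int (k + 1 + t + m)) (X m (X (- (t + 1) - m) (vac a b))) = 0"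
    proof
      fix m assume "m \<in> {l-1..k} - {l..k}"
      then have "k + 1 + t + m = 0" by (auto simp: l_def)
      then show "fock_scale (of_int (k + 1 + t + m)) (X m (X (- (t + 1) - m) (vac a b))) = 0" by simp
    qed
  qed auto
  also have "(\<Sum>m\<in>{l..k}. fock_scale (of_int (k + 1 - m)) (X (m - 1) (X (- (t + 1) - (m - 1)) (vac a b))))
      = (\<Sum>m\<in>{l-1..k-1}. fock_scale (of_int (k - m)) (X m (X (- (t + 1) - m) (vac a b))))"
    by (rule sum.reindex_bij_witness[where i = "\<lambda>m. m + 1" and j = "\<lambda>m. m - 1"]) auto
  also have "\<dots> = (\<Sum>m\<in>{l-1..k}. fock_scale (of_int (k - m)) (X m (X (- (t + 1) - m) (vac a b))))"
  proof (rule sum.mono_neutral_left)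
    show "\<forall>m\<in>{l-1..k} - {l-1..k-1}. fock_scale (of_int (k - m)) (X m (X (- (t + 1) - m) (vac a b))) = 0"
    proof
      fix m assume "m \<in> {l-1..k} - {l-1..k-1}"
      then have "k - m = 0" by auto
      then show "fock_scale (of_int (k - m)) (X m (X (- (t + 1) - m) (vac a b))) = 0" by simp
    qed
  qed auto
  also have "(\<Sum>m\<in>{l-1..k}. fock_scale (of_int (k + 1 + t + m)) (X m (X (- (t + 1) - m) (vac a b)))) + \<dots>
      = (\<Sum>m\<in>{l-1..k}. fock_scale (of_int (2 * k + 1 + t)) (X m (X (- (t + 1) - m) (vac a b))))"
    unfolding sum.distrib[symmetric] fock.scale_left_distrib[symmetric] of_int_add[symmetric]
    by (simp add: algebra_simps)
  also have "\<dots> = fock_scale (of_int (2 * k + 1 + t)) (fock_U (quad_sum k (t + 1)) (vac a b))"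
  proof -
    have e: "- (t + 1) - k = l - 1" by (simp add: l_def)
    show ?thesis unfolding fock.U_act_quad_sum e X_def by (rule fock.scale_sum_right[symmetric])
  qed
  finally have "fock_scale (of_int (2 * k + 1 + t)) (fock_U (quad_sum k (t + 1)) (vac a b)) = 0" ..
  moreover have "of_int (2 * k + 1 + t) \<noteq> (0 :: complex)"
    unfolding of_int_eq_0_iff using step by (simp add: k_def)
  ultimately show ?case using fock_scale_eq_0 unfolding k_def by blast
qed

lemma fock_U_quad_ideal_vac: "p \<in> quad_ideal (a - b - 1) \<Longrightarrow> fock_U p (vac a b) = 0"
proof (induction rule: quad_ideal_induct)
  case (gen c t)
  then show ?case by (simp add: fock.U_act_mult fock_U_quad_sum_vac fock.U_act_zero_right)
qed (simp_all add: fock.U_act_add)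

lemma fock_U_vac_lower: "fock_U p (vac a b) = 0 \<Longrightarrow> fock_U p (vac (a - 1) b) = 0"
proof -
  assume p: "fock_U p (vac a b) = 0"
  obtain c where c: "c \<noteq> 0" "cre (1, a - 1) (vac a b) = fock_scale c (vac (a - 1) b)" using cre_vac by blast
  have "fock_scale c (fock_U p (vac (a - 1) b)) = fock_U p (cre (1, a - 1) (vac a b))"
    by (simp add: c(2) fock.U_act_scale_right)
  also have "\<dots> = 0" by (simp add: fock_U_cre p cre_linear)
  finally show ?thesis using c(1) fock_scale_eq_0 by blast
qed

text \<open>Induction on the weight, for all seas at once. Creating one more particle of color 1 shows
  that the part of \<open>p\<close> free of \<open>x(k)\<close> lies in the next smaller ideal by induction; what remains is a
  multiple of \<open>x(k)\<close>, and \<open>x(k)\<close> carries the sea to another sea, so that induction applies again.\<close>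
lemma fock_kernel_subset:
  "p \<in> U_nbar_le (a - b - 1) \<Longrightarrow> (\<And>e. e \<in> Poly_Mapping.keys p \<Longrightarrow> wt (a - b - 1) e \<le> int n)
    \<Longrightarrow> fock_U p (vac a b) = 0 \<Longrightarrow> p \<in> quad_ideal (a - b - 1)"
proof (induction n arbitrary: a b p)
  case 0
  have "e = 0" if "e \<in> Poly_Mapping.keys p" for e
    using 0(1) 0(2)[OF that] that by (intro wt_nonpos[of e "a - b - 1"]) (auto simp: U_nbar_le_def)
  then have "Poly_Mapping.keys p \<subseteq> {0}" by auto
  then have p: "p = Poly_Mapping.single 0 (Poly_Mapping.lookup p 0)"
    by (intro poly_mapping_eqI) (auto simp: lookup_single when_def in_keys_iff)
  then have "fock_scale (Poly_Mapping.lookup p 0) (vac a b) = 0"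
    using 0(3) fock.U_act_scalar by metis
  then have "Poly_Mapping.lookup p 0 = 0" using fock_scale_eq_0 vac_nonzero by blast
  then show ?case using p quad_ideal_0 by simp
next
  case (Suc n)
  define k where "k = a - b - 1"
  have p: "p \<in> U_nbar_le k" "\<And>e. e \<in> Poly_Mapping.keys p \<Longrightarrow> wt k e \<le> int n + 1" "fock_U p (vac a b) = 0"
    using Suc.prems by (auto simp: k_def add.commute)
  have ks: "(a - 1) - b - 1 = k - 1" "(a - 1) - (b + 1) - 1 = k - 2" by (auto simp: k_def)
  obtain a' b' where ab: "a' \<in> U_nbar_le (k - 1)" "b' \<in> U_nbar_le k" "p = a' + b' * xvar k"
      "Poly_Mapping.keys a' \<subseteq> Poly_Mapping.keys p"
    using U_nbar_le_step[OF p(1)] by blast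
  have "fock_U p (vac (a - 1) b) = 0" by (rule fock_U_vac_lower[OF p(3)])
  \<comment> \<open>On this sea, whose parameter is k - 1, only the part \<open>a'\<close> free of
    x(k) is tested.\<close>
  moreover have "fock_act (loop x_pos k) (vac (a - 1) b) = 0" by (rule xp_vac) (simp add: k_def)
  ultimately have a'0: "fock_U a' (vac (a - 1) b) = 0"
    by (simp add: ab(3) fock.U_act_add fock.U_act_mult fock.U_act_xvar fock.U_act_zero_right)
  have "a' \<in> quad_ideal (k - 1)"
  proof (rule Suc.IH[where a = "a - 1" and b = b and p = a', unfolded ks, OF ab(1) _ a'0])
    fix e assume e: "e \<in> Poly_Mapping.keys a'"
    then have "wt k e \<le> int n + 1" using ab(4) p(2) by blast
    then show "wt (k - 1) e \<le> int n" using wt_shift(2)[of e k] by (cases "e = 0") auto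
  qed
  then obtain q c where q: "q \<in> quad_ideal k" "c \<in> U_nbar_le k" "a' = q + c * xvar k" using quad_ideal_lower by blast
  \<comment> \<open>\<open>c\<close> and \<open>b'\<close> come without a weight bound. As
    \<open>p\<close> has weight at most n + 1 and x(k) has weight 1, truncating the whole identity
    leaves \<open>p\<close> unchanged and bounds the cofactor by n.\<close>
  define d where "d = trunc k (int n) (c + b')"
  have "p = trunc k (int n + 1) p" using p(2) by (simp add: trunc_id)
  also have "\<dots> = trunc k (int n + 1) (q + (c + b') * xvar k)" by (simp add: ab(3) q(3) algebra_simps)
  also have "\<dots> = trunc k (int n + 1) q + d * xvar k" by (simp add: trunc_add trunc_mult_xvar d_def)
  finally have pd: "p = trunc k (int n + 1) q + d * xvar k" .
  have qJ: "trunc k (int n + 1) q \<in> quad_ideal k" by (rule trunc_in_quad_ideal[OF q(1)])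
  have d: "d \<in> U_nbar_le k" unfolding d_def by (intro trunc_in_U U_nbar_le_add q ab)
  have dn: "wt k e \<le> int n" if "e \<in> Poly_Mapping.keys d" for e
    using that by (auto simp: d_def keys_trunc)
  have "fock_U d (fock_act (loop x_pos k) (vac a b)) = 0"
    using p(3) fock_U_quad_ideal_vac[of "trunc k (int n + 1) q" a b] qJ
    by (subst (asm) pd) (simp add: fock.U_act_add fock.U_act_mult fock.U_act_xvar k_def)
  moreover obtain s where s: "s \<noteq> 0" "fock_act (loop x_pos k) (vac a b) = fock_scale s (vac (a - 1) (b + 1))"
    using xp_vac_edge unfolding k_def by blast
  ultimately have d0: "fock_U d (vac (a - 1) (b + 1)) = 0"
    using fock_scale_eq_0 by (simp add: fock.U_act_scale_right)
  \<comment> \<open>The sea \<open>vac (a - 1) (b + 1)\<close> has parameter k - 2, so x(k) and x(k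
    - 1) both kill it, and the induction hypothesis applies to \<open>d''\<close> only. The two
    parts of \<open>d\<close> split off here return multiplied by x(k), and x(k)^2 and x(k - 1) x(k)
    are in the ideal.\<close>
  obtain d' d1 where d': "d' \<in> U_nbar_le (k - 1)" "d1 \<in> U_nbar_le k" "d = d' + d1 * xvar k"
      "Poly_Mapping.keys d' \<subseteq> Poly_Mapping.keys d"
    using U_nbar_le_step[OF d] by blast
  obtain d'' d2 where d'': "d'' \<in> U_nbar_le (k - 2)" "d2 \<in> U_nbar_le (k - 1)" "d' = d'' + d2 * xvar (k - 1)"
      "Poly_Mapping.keys d'' \<subseteq> Poly_Mapping.keys d'"
    using U_nbar_le_step[OF d'(1)] by auto
  have "fock_act (loop x_pos m) (vac (a - 1) (b + 1)) = 0" if "m \<in> {k, k - 1}" for m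
    by (rule xp_vac) (use that in \<open>auto simp: k_def\<close>)
  then have "fock_U d'' (vac (a - 1) (b + 1)) = 0"
    using d0 by (simp add: d'(3) d''(3) fock.U_act_add fock.U_act_mult fock.U_act_xvar fock.U_act_zero_right)
  then have "d'' \<in> quad_ideal (k - 2)"
  proof (rule Suc.IH[where a = "a - 1" and b = "b + 1" and p = d'', unfolded ks, OF d''(1), rotated])
    fix e assume "e \<in> Poly_Mapping.keys d''"
    then have "wt k e \<le> int n" using d'(4) d''(4) dn by blast
    then show "wt (k - 2) e \<le> int n" using wt_shift(1)[of "k - 1" e] wt_shift(1)[of k e] by simp
  qed
  moreover have "p = trunc k (int n + 1) q + (d'' * xvar k + (d2 * (xvar (k - 1) * xvar k) + d1 * (xvar k * xvar k)))"
    unfolding pd by (simp add: d'(3) d''(3) algebra_simps)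
  moreover have "d2 \<in> U_nbar_le k" using U_nbar_le_mono[OF _ d''(2)] by simp
  ultimately have "p \<in> quad_ideal k"
    using qJ quad_ideal_lower2_mult_xvar d'(2) xvar_square_in_quad_ideal xvar_adjacent_in_quad_ideal by (metis quad_ideal_add quad_ideal_mult)
  then show ?case by (simp add: k_def)
qed

lemma fock_kernel:
  assumes "p \<in> U_nbar_le (a - b - 1)"
  shows "fock_U p (vac a b) = 0 \<longleftrightarrow> p \<in> quad_ideal (a - b - 1)"
proof
  assume p: "fock_U p (vac a b) = 0"
  define n where "n = (\<Sum>e\<in>Poly_Mapping.keys p. nat (wt (a - b - 1) e))"
  have "wt (a - b - 1) e \<le> int n" if "e \<in> Poly_Mapping.keys p" for e
  proof -
    have "nat (wt (a - b - 1) e) \<le> n" unfolding n_def using that by (intro member_le_sum) auto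
    then show ?thesis by simp
  qed
  then show "p \<in> quad_ideal (a - b - 1)" using fock_kernel_subset assms p by blast
qed (rule fock_U_quad_ideal_vac)

lemma quad_ideal_subset_U_nbar_le: "p \<in> quad_ideal k \<Longrightarrow> p \<in> U_nbar_le k"
proof (induction rule: quad_ideal_induct)
  case (gen a t)
  have "quad_sum k t \<in> U_nbar_le k"
    unfolding quad_sum_eq by (intro U_nbar_le_sum U_nbar_le_mult U_nbar_le_xvar) auto
  then show ?case using gen U_nbar_le_mult by blast
qed (auto intro: U_nbar_le_add)

theorem theorem2p1:
  fixes scale0 :: "complex \<Rightarrow> 'v::ab_group_add \<Rightarrow> 'v" and act0 :: "affine \<Rightarrow> 'v \<Rightarrow> 'v" and v0 :: 'v
    and scale1 :: "complex \<Rightarrow> 'w::ab_group_add \<Rightarrow> 'w" and act1 :: "affine \<Rightarrow> 'w \<Rightarrow> 'w" and v1 :: 'w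
  assumes "irreducible_highest_weight_module scale0 act0 (fundamental_weight 0) v0"
    and "irreducible_highest_weight_module scale1 act1 (fundamental_weight 1) v1"
  shows "kernel_on U_nbar_minus (\<lambda>a. U_act scale0 act0 a v0) = I_Lambda0 \<and>
    kernel_on U_nbar_le_minus2 (\<lambda>a. U_act scale1 act1 a v1) = I_Lambda1' \<and>
    kernel_on U_nbar_minus (\<lambda>a. U_act scale1 act1 a v1) = I_Lambda1"
proof -
  have "irreducible_highest_weight_module scale0 act0 (0, 1) v0"
    and "irreducible_highest_weight_module scale1 act1 (1, 1) v1"
    using assms by (simp_all add: fundamental_weight_def)
  note L0 = irreducible_highest_weight_module_level_one[OF this(1)]
    and L1 = irreducible_highest_weight_module_level_one[OF this(2)]
  have act0: "U_act scale0 act0 p v0 = 0 \<longleftrightarrow> fock_U p (vac 0 0) = 0" for p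
    by (rule U_act_eq_0_transfer[OF fock_unitary L0(1,2) highest_weight_vac_0 vac_finite L0(3)])
  have act1: "U_act scale1 act1 p v1 = 0 \<longleftrightarrow> fock_U p (vac (-1) 0) = 0" for p
    by (rule U_act_eq_0_transfer[OF fock_unitary L1(1,2) highest_weight_vac_1 vac_finite L1(3)])
  have I0: "I_Lambda0 = quad_ideal (-1)" and I1': "I_Lambda1' = quad_ideal (-2)"
    by (simp_all add: I_Lambda0_def I_Lambda1'_def quad_ideal_def)
  have I1: "I_Lambda1 = {p + b * xvar (-1) | p b. p \<in> quad_ideal (-1) \<and> b \<in> U_nbar_minus}"
    by (simp add: I_Lambda1_def quad_ideal_def)
  have x: "fock_act (loop x_pos (-1)) (vac (-1) 0) = 0" by (simp add: xp_vac)
  have "kernel_on U_nbar_minus (\<lambda>a. U_act scale0 act0 a v0) = I_Lambda0"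
    using fock_kernel[of _ 0 0] quad_ideal_subset_U_nbar_le[of _ "-1"] by (auto simp: kernel_on_def act0 I0)
  moreover have "kernel_on U_nbar_le_minus2 (\<lambda>a. U_act scale1 act1 a v1) = I_Lambda1'"
    using fock_kernel[of _ "-1" 0] quad_ideal_subset_U_nbar_le[of _ "-2"] by (auto simp: kernel_on_def act1 I1')
  moreover have "kernel_on U_nbar_minus (\<lambda>a. U_act scale1 act1 a v1) = I_Lambda1"
  proof (intro set_eqI iffI)
    fix p assume "p \<in> kernel_on U_nbar_minus (\<lambda>a. U_act scale1 act1 a v1)"
    then have p: "p \<in> U_nbar_minus" "fock_U p (vac (-1) 0) = 0" by (auto simp: kernel_on_def act1)
    \<comment> \<open>x(-1) kills the sea, so the part \<open>a\<close> free of x(-1) is in the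
      kernel treated before; \<open>quad_ideal_lower\<close> then rewrites it over the generators
      \<open>R0\<close>.\<close>
    obtain a b where ab: "a \<in> U_nbar_le (-2)" "b \<in> U_nbar_le (-1)" "p = a + b * xvar (-1)"
      using U_nbar_le_step[OF p(1)] by auto
    have "fock_U a (vac (-1) 0) = 0"
      using p(2) by (simp add: ab(3) fock.U_act_add fock.U_act_mult fock.U_act_xvar x fock.U_act_zero_right)
    then have "a \<in> quad_ideal (-1 - 1)" using fock_kernel[of a "-1" 0] ab(1) by simp
    then obtain q c where q: "q \<in> quad_ideal (-1)" "c \<in> U_nbar_minus" "a = q + c * xvar (-1)"
      using quad_ideal_lower[of a "-1"] by blast
    have "p = q + (c + b) * xvar (-1)" by (simp add: ab(3) q(3) algebra_simps)
    then show "p \<in> I_Lambda1" using q ab U_nbar_le_add unfolding I1 by blast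
  next
    fix p assume "p \<in> I_Lambda1"
    then obtain q b where q: "p = q + b * xvar (-1)" "q \<in> quad_ideal (-1)" "b \<in> U_nbar_minus" unfolding I1 by blast
    \<comment> \<open>The \<open>R0\<close> relations hold on \<open>vac 0 0\<close>, and creation
      of the mode (1, -1) carries them over to \<open>vac (-1) 0\<close>.\<close>
    have "fock_U q (vac (-1) 0) = 0"
      using fock_U_vac_lower[of q 0 0] fock_U_quad_ideal_vac[of q 0 0] q(2) by simp
    then have "fock_U p (vac (-1) 0) = 0"
      by (simp add: q(1) fock.U_act_add fock.U_act_mult fock.U_act_xvar x fock.U_act_zero_right)
    moreover have "p \<in> U_nbar_minus"
      unfolding q(1) using q quad_ideal_subset_U_nbar_le by (intro U_nbar_le_add U_nbar_le_mult U_nbar_le_xvar) auto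
    ultimately show "p \<in> kernel_on U_nbar_minus (\<lambda>a. U_act scale1 act1 a v1)"
      by (simp add: kernel_on_def act1)
  qed
  ultimately show ?thesis by blast
qed

end
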